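(* Let $H$ be a holomorphic vertex bialgebra which is commutative and cocommutative, with spectral quasitriangular element $R(z)\in H\otimes H((z^{-1}))$, and let $B$ be a vertex bialgebra inside the category of $H$-modules with braiding induced by $R(z)$. Then the vector space $B\rtimes H=B\otimes H$ with product $$(b\otimes h)\cdot(b'\otimes h')=b\,(h_{(1)}\cdot b')\otimes h_{(2)}h'$$ is an associative algebra, and the vertex coproduct $$\Delta(b\otimes h,z)=\big(b_{(1,z)}\otimes R^{(2)}(z)h_{(1,z)}\big)\otimes\big(R^{(1)}(z)\cdot b_{(2,z)}\otimes h_{(2,z)}\big)$$ makes $B\rtimes H$ into a (nonlocal) vertex bialgebra.
   Context: Everything is over a field of characteristic zero (e.g. $\mathbb C$). Sweedler notation: $\Delta(a)=a_{(1)}\otimes a_{(2)}$ for ordinary coproducts, $\Delta(a,z)=a_{(1,z)}\otimes a_{(2,z)}$ for vertex coproducts, $R(z)=R^{(1)}(z)\otimes R^{(2)}(z)$. **Nonlocal vertex coalgebra.** A vector space $V$ with a translation $T:V\to V$, a covacuum $\epsilon:V\to k$ and $\Delta(z):V\to V\otimes V((z^{-1}))$ such that $\Delta(z)T=\frac d{dz}\Delta(z)+(1\otimes T)\Delta(z)$; $(\Delta(z)\otimes\mathrm{id})\Delta(w)=(\mathrm{id}\otimes\Delta(w))\Delta(z+w)$ (weak coassociativity: both sides applied to a vector are expansions of the same series in $z,w,z+w$ and their inverses); $(\epsilon\otimes\mathrm{id})\Delta(z)=\mathrm{id}$, and $(\mathrm{id}\otimes\epsilon)\Delta(z)=\mathrm{id}+O(z)$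 is $V[z]$-valued. It is holomorphic if $\Delta(z)$ takes values in $V\otimes V[z]$. **The data $H$.** $H$ is a commutative, cocommutative bialgebra with coproduct $\Delta_H$ and a locally nilpotent biderivation $T_H$; its holomorphic vertex coproduct is $\Delta_H(z)=(e^{zT_H}\otimes\mathrm{id})\Delta_H$. The spectral quasitriangular element $R(z)\in H\otimes H((z^{-1}))$ is invertible and satisfies the spectral hexagon relations $$(\Delta_H(w)\otimes\mathrm{id})R(z)=R_{13}(z-w)R_{23}(z),\qquad(\mathrm{id}\otimes\Delta_H(w))R(z)=R_{12}(z+w)R_{13}(z)$$ (expanded in nonnegative powers of $w$). **Vertex bialgebra $B$ inside $H$-modules.** $B$ is an $H$-module with: an associative product which is $H$-linear, $h\cdot(bb')=(h_{(1)}\cdot b)(h_{(2)}\cdot b')$; a nonlocal vertex coalgebra structure $(\Delta(z),T_B,\epsilon)$ which is $H$-linear, $\Delta(h\cdot b,z)=\Delta_H(h,z)\cdot\Delta(b,z)$; translation endomorphisms compatible with these structures ($T_B$ is a derivation of the product and $T_B(h\cdot b)=(T_Hh)\cdot b+h\cdot T_Bb$); and $$\Delta(bb',z)=b_{(1,z)}\big(R^{(2)}(z)\cdot b'_{(1,z)}\big)\otimes\big(R^{(1)}(z)\cdot b_{(2,z)}\big)b'_{(2,z)},$$ i.e. $\Delta(z)$ is multiplicative with respect to the braiding $\beta(z)(v\otimes w)=\sigma(R(z)\cdot v\otimes w)$, $\sigma$ the swap, applied to the middle two factors. **Vertex bialgebra (in vector spaces).** An associative algebra $A$ with a nonlocal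 vertex coalgebra structure such that $\Delta(aa',z)=\Delta(a,z)\Delta(a',z)$ for the componentwise product. On $B\rtimes H$ the translation is $T_B\otimes\mathrm{id}+\mathrm{id}\otimes T_H$ and the covacuum is $\epsilon_B\otimes\epsilon_H$. *)

theory Defs
  imports Complex_Main "HOL-Library.Poly_Mapping"
begin

section \<open>Tensor products of vector spaces\<close>

text \<open>
  A vector space over the field \<open>'k\<close> is a type \<open>'v\<close> of class \<^class>\<open>ab_group_add\<close> together with
  a scalar multiplication satisfying the locale \<^locale>\<open>vector_space\<close>.  The tensor product of two
  such spaces depends on the scalar multiplications, so it cannot be a type constructor.
  Instead \<open>tensor_product sA sB sT t\<close> says that \<open>'t\<close> with the map \<open>t a b = a \<otimes> b\<close> is a
  tensor product: it is the quotient of the free vector space on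
  \<open>'a \<times> 'b\<close> by the span of the bilinearity relations, up to the isomorphism induced by \<open>t\<close>.
\<close>

definition bilinear_map ::
  "('k::field \<Rightarrow> 'a::ab_group_add \<Rightarrow> 'a) \<Rightarrow> ('k \<Rightarrow> 'b::ab_group_add \<Rightarrow> 'b) \<Rightarrow>
   ('k \<Rightarrow> 'c::ab_group_add \<Rightarrow> 'c) \<Rightarrow> ('a \<Rightarrow> 'b \<Rightarrow> 'c) \<Rightarrow> bool" where
  "bilinear_map sA sB sC f \<longleftrightarrow>
     (\<forall>a. Vector_Spaces.linear sB sC (f a)) \<and> (\<forall>b. Vector_Spaces.linear sA sC (\<lambda>a. f a b))"

definition free_scale :: "'k::field \<Rightarrow> ('i \<Rightarrow>\<^sub>0 'k) \<Rightarrow> ('i \<Rightarrow>\<^sub>0 'k)" where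
  "free_scale c = Poly_Mapping.map ((*) c)"

definition free_extend ::
  "('k::field \<Rightarrow> 'c::ab_group_add \<Rightarrow> 'c) \<Rightarrow> ('a \<Rightarrow> 'b \<Rightarrow> 'c) \<Rightarrow> ('a \<times> 'b \<Rightarrow>\<^sub>0 'k) \<Rightarrow> 'c" where
  "free_extend sC f x = (\<Sum>p\<in>Poly_Mapping.keys x. sC (Poly_Mapping.lookup x p) (f (fst p) (snd p)))"

definition bilinearity_relations ::
  "('k::field \<Rightarrow> 'a::ab_group_add \<Rightarrow> 'a) \<Rightarrow> ('k \<Rightarrow> 'b::ab_group_add \<Rightarrow> 'b) \<Rightarrow>
   ('a \<times> 'b \<Rightarrow>\<^sub>0 'k) set" where
  "bilinearity_relations sA sB =
     {Poly_Mapping.single (a + a', b) 1 - Poly_Mapping.single (a, b) 1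
        - Poly_Mapping.single (a', b) 1 | a a' b. True} \<union>
     {Poly_Mapping.single (a, b + b') 1 - Poly_Mapping.single (a, b) 1
        - Poly_Mapping.single (a, b') 1 | a b b'. True} \<union>
     {Poly_Mapping.single (sA c a, b) 1 - Poly_Mapping.single (a, b) c | c a b. True} \<union>
     {Poly_Mapping.single (a, sB c b) 1 - Poly_Mapping.single (a, b) c | c a b. True}"

locale tensor_product = A: vector_space sA + B: vector_space sB + T: vector_space sT
  for sA :: "'k::field \<Rightarrow> 'a::ab_group_add \<Rightarrow> 'a"
  and sB :: "'k \<Rightarrow> 'b::ab_group_add \<Rightarrow> 'b"
  and sT :: "'k \<Rightarrow> 't::ab_group_add \<Rightarrow> 't" +
  fixes t :: "'a \<Rightarrow> 'b \<Rightarrow> 't"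
  assumes surj_free_extend: "surj (free_extend sT t)"
  and kernel_free_extend:
    "{x. free_extend sT t x = 0} = module.span free_scale (bilinearity_relations sA sB)"

text \<open>
  \<open>tlift t f x\<close> is \<open>f x\<^sub>(\<^sub>1\<^sub>) x\<^sub>(\<^sub>2\<^sub>)\<close> in Sweedler notation: write \<open>x\<close> as a finite sum of pure tensors
  and sum \<open>f\<close> over it.  For bilinear \<open>f\<close> the choice is immaterial, see \<open>tlift_sum_list\<close> below.
\<close>

definition tlift :: "('a \<Rightarrow> 'b \<Rightarrow> 't::ab_group_add) \<Rightarrow> ('a \<Rightarrow> 'b \<Rightarrow> 'c::ab_group_add) \<Rightarrow> 't \<Rightarrow> 'c" where
  "tlift t f x =
     (let ps = (SOME ps. x = (\<Sum>(a, b)\<leftarrow>ps. t a b)) in \<Sum>(a, b)\<leftarrow>ps. f a b)"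

lemma free_extend_superset:
  assumes "vector_space sC" "finite S" "Poly_Mapping.keys x \<subseteq> S"
  shows "free_extend sC f x = (\<Sum>p\<in>S. sC (Poly_Mapping.lookup x p) (f (fst p) (snd p)))"
proof -
  interpret vector_space sC by fact
  show ?thesis
    unfolding free_extend_def
    by (rule sum.mono_neutral_left) (use assms in \<open>auto simp: in_keys_iff\<close>)
qed

lemma lookup_free_scale [simp]:
  "Poly_Mapping.lookup (free_scale c x) p = c * Poly_Mapping.lookup x p"
  by (simp add: free_scale_def Poly_Mapping.map.rep_eq when_def)

lemma vector_space_free_scale: "vector_space free_scale"
  by unfold_locales (auto intro!: poly_mapping_eqI simp: lookup_add algebra_simps)

lemma linear_iff:
  "Vector_Spaces.linear s1 s2 f \<longleftrightarrow> vector_space s1 \<and> vector_space s2 \<and>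
     (\<forall>x y. f (x + y) = f x + f y) \<and> (\<forall>c x. f (s1 c x) = s2 c (f x))"
  by (simp add: linear_iff_module_hom module_hom_iff module_iff_vector_space)

lemma linear_free_extend:
  assumes "vector_space sC"
  shows "Vector_Spaces.linear free_scale sC (free_extend sC f)"
proof -
  interpret C: vector_space sC by fact
  have 1: "free_extend sC f (x + y) = free_extend sC f x + free_extend sC f y" for x y
    using assms keys_add[of x y]
    by (simp add: free_extend_superset[where S = "Poly_Mapping.keys x \<union> Poly_Mapping.keys y"]
        lookup_add C.scale_left_distrib sum.distrib)
  have 2: "free_extend sC f (free_scale c x) = sC c (free_extend sC f x)" for c x
  proof -
    have "Poly_Mapping.keys (free_scale c x) \<subseteq> Poly_Mapping.keys x"
      by (auto simp: in_keys_iff)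
    then show ?thesis using assms
      by (simp add: free_extend_superset[where S = "Poly_Mapping.keys x"] C.scale_sum_right)
  qed
  from 1 2 show ?thesis
    by (simp add: linear_iff vector_space_free_scale assms)
qed

lemma free_extend_single:
  assumes "vector_space sC"
  shows "free_extend sC f (Poly_Mapping.single (a, b) c) = sC c (f a b)"
  using free_extend_superset[OF assms, of "{(a, b)}" "Poly_Mapping.single (a, b) c" f] by simp

lemma free_extend_sum_list:
  assumes "vector_space sC"
  shows "free_extend sC f (\<Sum>(a, b)\<leftarrow>ps. Poly_Mapping.single (a, b) 1) = (\<Sum>(a, b)\<leftarrow>ps. f a b)"
proof -
  interpret C: vector_space sC by fact
  interpret F: Vector_Spaces.linear free_scale sC "free_extend sC f"
    by (rule linear_free_extend) fact
  show ?thesis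
    by (induction ps) (auto simp: F.add free_extend_single[OF assms] F.zero)
qed

lemma bilinear_mapD:
  assumes "bilinear_map sA sB sC f"
  shows "f (x + y) b = f x b + f y b" "f a (u + v) = f a u + f a v"
    "f (sA c x) b = sC c (f x b)" "f a (sB c u) = sC c (f a u)"
    "vector_space sA" "vector_space sB" "vector_space sC"
  using assms by (simp_all add: bilinear_map_def linear_iff)

context tensor_product
begin

lemma bilinear_t: "bilinear_map sA sB sT t"
proof -
  let ?F = "free_extend sT t"
  interpret F: Vector_Spaces.linear free_scale sT ?F
    by (rule linear_free_extend) unfold_locales
  have ker: "?F r = 0" if "r \<in> bilinearity_relations sA sB" for r
    using kernel_free_extend F.vs1.span_base[OF that] by blast
  note s = free_extend_single[OF T.vector_space_axioms]
  have "t (a + a') b = t a b + t a' b" for a a' b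
  proof -
    have "free_extend sT t (Poly_Mapping.single (a + a', b) 1 - Poly_Mapping.single (a, b) 1
        - Poly_Mapping.single (a', b) 1) = 0"
      by (rule ker) (unfold bilinearity_relations_def, blast)
    then show ?thesis by (simp add: F.diff F.add s algebra_simps)
  qed
  moreover have "t a (b + b') = t a b + t a b'" for a b b'
  proof -
    have "free_extend sT t (Poly_Mapping.single (a, b + b') 1 - Poly_Mapping.single (a, b) 1
        - Poly_Mapping.single (a, b') 1) = 0"
      by (rule ker) (unfold bilinearity_relations_def, blast)
    then show ?thesis by (simp add: F.diff F.add s algebra_simps)
  qed
  moreover have "t (sA c a) b = sT c (t a b)" for c a b
  proof -
    have "free_extend sT t (Poly_Mapping.single (sA c a, b) 1 - Poly_Mapping.single (a, b) c) = 0"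
      by (rule ker) (unfold bilinearity_relations_def, blast)
    then show ?thesis by (simp add: F.diff s)
  qed
  moreover have "t a (sB c b) = sT c (t a b)" for c a b
  proof -
    have "free_extend sT t (Poly_Mapping.single (a, sB c b) 1 - Poly_Mapping.single (a, b) c) = 0"
      by (rule ker) (unfold bilinearity_relations_def, blast)
    then show ?thesis by (simp add: F.diff s)
  qed
  ultimately show ?thesis
    by (simp add: bilinear_map_def linear_iff A.vector_space_axioms B.vector_space_axioms
        T.vector_space_axioms)
qed

lemma tensor_sum_list: "\<exists>ps. x = (\<Sum>(a, b)\<leftarrow>ps. t a b)"
proof -
  obtain y where y: "x = free_extend sT t y"
    using surj_free_extend by (metis surjD)
  have "\<exists>ps. (\<Sum>p\<in>S. sT (Poly_Mapping.lookup y p) (t (fst p) (snd p))) = (\<Sum>(a, b)\<leftarrow>ps. t a b)"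
    if "finite S" for S
    using that
  proof induction
    case empty
    show ?case by (rule exI[of _ "[]"]) simp
  next
    case (insert p S)
    then obtain ps where
      "(\<Sum>p\<in>S. sT (Poly_Mapping.lookup y p) (t (fst p) (snd p))) = (\<Sum>(a, b)\<leftarrow>ps. t a b)" by auto
    with insert.hyps show ?case
      by (intro exI[of _ "(sA (Poly_Mapping.lookup y p) (fst p), snd p) # ps"])
        (simp add: bilinear_mapD(3)[OF bilinear_t])
  qed
  then show ?thesis
    unfolding y free_extend_def by (metis finite_keys)
qed

lemma tlift_sum_list:
  assumes "bilinear_map sA sB sC f"
  shows "tlift t f (\<Sum>(a, b)\<leftarrow>ps. t a b) = (\<Sum>(a, b)\<leftarrow>ps. f a b)"
proof -
  let ?x = "\<Sum>(a, b)\<leftarrow>ps. t a b"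
  define qs where "qs = (SOME qs. ?x = (\<Sum>(a, b)\<leftarrow>qs. t a b))"
  have qs: "?x = (\<Sum>(a, b)\<leftarrow>qs. t a b)"
    unfolding qs_def by (rule someI[of _ ps]) simp
  define D where "D = (\<Sum>(a, b)\<leftarrow>ps. Poly_Mapping.single (a, b) (1::'k))
    - (\<Sum>(a, b)\<leftarrow>qs. Poly_Mapping.single (a, b) 1)"
  note vC = bilinear_mapD(7)[OF assms]
  interpret C: vector_space sC by (rule vC)
  interpret F: Vector_Spaces.linear free_scale sT "free_extend sT t"
    by (rule linear_free_extend) unfold_locales
  interpret G: Vector_Spaces.linear free_scale sC "free_extend sC f"
    by (rule linear_free_extend) unfold_locales
  have "free_extend sT t D = 0"
    unfolding D_def F.diff free_extend_sum_list[OF T.vector_space_axioms] using qs by simp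
  then have "D \<in> F.vs1.span (bilinearity_relations sA sB)"
    using kernel_free_extend by blast
  moreover have "free_extend sC f r = 0" if "r \<in> bilinearity_relations sA sB" for r
    using that
    by (auto simp: bilinearity_relations_def G.diff free_extend_single[OF vC]
        bilinear_mapD(1-4)[OF assms])
  ultimately have "free_extend sC f D = 0"
    by (rule G.eq_0_on_span[rotated])
  then have "(\<Sum>(a, b)\<leftarrow>ps. f a b) = (\<Sum>(a, b)\<leftarrow>qs. f a b)"
    unfolding D_def G.diff free_extend_sum_list[OF vC] by simp
  then show ?thesis
    by (simp add: tlift_def qs_def)
qed

lemma tlift_tensor:
  assumes "bilinear_map sA sB sC f"
  shows "tlift t f (t a b) = f a b"
  using tlift_sum_list[OF assms, of "[(a, b)]"] by simp

lemma linear_tlift: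
  assumes "bilinear_map sA sB sC f"
  shows "Vector_Spaces.linear sT sC (tlift t f)"
proof -
  note vC = bilinear_mapD(7)[OF assms]
  interpret C: vector_space sC by (rule vC)
  have "tlift t f (x + y) = tlift t f x + tlift t f y" for x y
  proof -
    obtain ps qs where p: "x = (\<Sum>(a, b)\<leftarrow>ps. t a b)" "y = (\<Sum>(a, b)\<leftarrow>qs. t a b)"
      using tensor_sum_list by metis
    have "x + y = (\<Sum>(a, b)\<leftarrow>ps @ qs. t a b)" using p by simp
    then show ?thesis
      using tlift_sum_list[OF assms, of ps] tlift_sum_list[OF assms, of qs]
        tlift_sum_list[OF assms, of "ps @ qs"] p by simp
  qed
  moreover have "tlift t f (sT c x) = sC c (tlift t f x)" for c x
  proof -
    obtain ps where p: "x = (\<Sum>(a, b)\<leftarrow>ps. t a b)"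
      using tensor_sum_list by metis
    let ?qs = "map (\<lambda>(a, b). (sA c a, b)) ps"
    have *: "(\<Sum>(a, b)\<leftarrow>?qs. g a b) = s c (\<Sum>(a, b)\<leftarrow>ps. g a b)"
      if g: "bilinear_map sA sB s g" for s :: "'k \<Rightarrow> 'z::ab_group_add \<Rightarrow> 'z" and g
    proof -
      interpret vector_space s using bilinear_mapD(7)[OF g] .
      show ?thesis
        by (induction ps) (auto simp: bilinear_mapD(3)[OF g] scale_right_distrib)
    qed
    have "sT c x = (\<Sum>(a, b)\<leftarrow>?qs. t a b)"
      unfolding p *[OF bilinear_t] ..
    then show ?thesis
      using tlift_sum_list[OF assms, of ?qs] tlift_sum_list[OF assms, of ps] *[OF assms] p by simp
  qed
  ultimately show ?thesis
    by (simp add: linear_iff vC T.vector_space_axioms)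
qed

end

definition tmap ::
  "('a \<Rightarrow> 'b \<Rightarrow> 's::ab_group_add) \<Rightarrow> ('c \<Rightarrow> 'd \<Rightarrow> 't::ab_group_add) \<Rightarrow>
   ('a \<Rightarrow> 'c) \<Rightarrow> ('b \<Rightarrow> 'd) \<Rightarrow> 's \<Rightarrow> 't" where
  "tmap t t' f g = tlift t (\<lambda>a b. t' (f a) (g b))"

text \<open>\<open>tmap2 t t' t'' f g (a \<otimes> b) (a' \<otimes> b') = f a a' \<otimes> g b b'\<close>.\<close>

definition tmap2 ::
  "('a \<Rightarrow> 'b \<Rightarrow> 's::ab_group_add) \<Rightarrow> ('c \<Rightarrow> 'd \<Rightarrow> 't::ab_group_add) \<Rightarrow>
   ('e \<Rightarrow> 'f \<Rightarrow> 'u::ab_group_add) \<Rightarrow>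
   ('a \<Rightarrow> 'c \<Rightarrow> 'e) \<Rightarrow> ('b \<Rightarrow> 'd \<Rightarrow> 'f) \<Rightarrow> 's \<Rightarrow> 't \<Rightarrow> 'u" where
  "tmap2 t t' t'' f g x y = tlift t (\<lambda>a b. tlift t' (\<lambda>c d. t'' (f a c) (g b d)) y) x"

text \<open>
  The tensor powers of \<open>V\<close>: \<open>t2\<close> presents \<open>V \<otimes> V\<close> and \<open>t3\<close> presents
  \<open>V \<otimes> V \<otimes> V = (V \<otimes> V) \<otimes> V\<close>.
\<close>

locale tensor_powers =
  V2: tensor_product sV sV sV2 t2 + V3: tensor_product sV2 sV sV3 t3
  for sV :: "'k::field \<Rightarrow> 'v::ab_group_add \<Rightarrow> 'v"
  and sV2 :: "'k \<Rightarrow> 'v2::ab_group_add \<Rightarrow> 'v2"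
  and sV3 :: "'k \<Rightarrow> 'v3::ab_group_add \<Rightarrow> 'v3"
  and t2 :: "'v \<Rightarrow> 'v \<Rightarrow> 'v2"
  and t3 :: "'v2 \<Rightarrow> 'v \<Rightarrow> 'v3"

text \<open>\<open>D \<otimes> id\<close> and \<open>id \<otimes> D\<close> as maps \<open>V \<otimes> V \<Rightarrow> V \<otimes> V \<otimes> V\<close>, for \<open>D : V \<Rightarrow> V \<otimes> V\<close>.\<close>

definition cop_left ::
  "('v \<Rightarrow> 'v \<Rightarrow> 'v2::ab_group_add) \<Rightarrow> ('v2 \<Rightarrow> 'v \<Rightarrow> 'v3::ab_group_add) \<Rightarrow> ('v \<Rightarrow> 'v2) \<Rightarrow> 'v2 \<Rightarrow> 'v3" where
  "cop_left t2 t3 D = tlift t2 (\<lambda>a b. t3 (D a) b)"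

definition cop_right ::
  "('v \<Rightarrow> 'v \<Rightarrow> 'v2::ab_group_add) \<Rightarrow> ('v2 \<Rightarrow> 'v \<Rightarrow> 'v3::ab_group_add) \<Rightarrow> ('v \<Rightarrow> 'v2) \<Rightarrow> 'v2 \<Rightarrow> 'v3" where
  "cop_right t2 t3 D = tlift t2 (\<lambda>a b. tlift t2 (\<lambda>c d. t3 (t2 a c) d) (D b))"


section \<open>Laurent series in \<open>z\<^sup>-\<^sup>1\<close>\<close>

text \<open>
  An element of \<open>V((z\<^sup>-\<^sup>1))\<close> is a function \<open>F :: int \<Rightarrow> 'v\<close>, where \<open>F n\<close> is the coefficient of
  \<open>z\<^sup>n\<close> (so the sign is opposite to that of the library's Laurent series in a variable \<open>X\<close>,
  taken at \<open>X = z\<^sup>-\<^sup>1\<close>), which vanishes for all large \<open>n\<close>.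
\<close>

definition laurent_inf :: "(int \<Rightarrow> 'v::zero) \<Rightarrow> bool" where
  "laurent_inf F \<longleftrightarrow> (\<exists>N. \<forall>n>N. F n = 0)"

text \<open>
  Products of Laurent series with respect to a bilinear or trilinear map of the coefficients.
  The index sets are finite for series satisfying \<^const>\<open>laurent_inf\<close>.
\<close>

definition conv2 ::
  "('a::zero \<Rightarrow> 'b::zero \<Rightarrow> 'c::ab_group_add) \<Rightarrow> (int \<Rightarrow> 'a) \<Rightarrow> (int \<Rightarrow> 'b) \<Rightarrow> int \<Rightarrow> 'c" where
  "conv2 f F G n = (\<Sum>(i, j)\<in>{(i, j). i + j = n \<and> F i \<noteq> 0 \<and> G j \<noteq> 0}. f (F i) (G j))"

definition conv3 ::
  "('a::zero \<Rightarrow> 'b::zero \<Rightarrow> 'c::zero \<Rightarrow> 'd::ab_group_add) \<Rightarrow>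
   (int \<Rightarrow> 'a) \<Rightarrow> (int \<Rightarrow> 'b) \<Rightarrow> (int \<Rightarrow> 'c) \<Rightarrow> int \<Rightarrow> 'd" where
  "conv3 f F G K n =
     (\<Sum>(i, j, l)\<in>{(i, j, l). i + j + l = n \<and> F i \<noteq> 0 \<and> G j \<noteq> 0 \<and> K l \<noteq> 0}. f (F i) (G j) (K l))"

text \<open>
  \<open>taylor_coeff s c m F\<close> is the coefficient of \<open>w\<^sup>m\<close> in \<open>F(z + c w)\<close>, expanded in nonnegative
  powers of \<open>w\<close>, as a series in \<open>z\<close>.
\<close>

definition taylor_coeff ::
  "('k::field_char_0 \<Rightarrow> 'v \<Rightarrow> 'v) \<Rightarrow> 'k \<Rightarrow> nat \<Rightarrow> (int \<Rightarrow> 'v) \<Rightarrow> int \<Rightarrow> 'v" where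
  "taylor_coeff s c m F p = s (c ^ m * (of_int (p + int m) gchoose m)) (F (p + int m))"

text \<open>
  A family \<open>c i j l\<close> with bounded support stands for the series
  \<open>\<Sum> c i j l z\<^sup>i w\<^sup>j (z + w)\<^sup>l\<close> in \<open>V[[z\<^sup>-\<^sup>1, w\<^sup>-\<^sup>1, (z + w)\<^sup>-\<^sup>1]][z, w]\<close>.  The first expansion
  is that of powers of \<open>z + w\<close> in nonnegative powers of \<open>z\<close>; it takes values in
  \<open>V((z\<^sup>-\<^sup>1))((w\<^sup>-\<^sup>1))\<close>, and its coefficient of \<open>z\<^sup>m w\<^sup>n\<close> is given.  The second expansion is
  that of powers of \<open>z = u - w\<close>, \<open>u = z + w\<close>, in nonnegative powers of \<open>w\<close>; it takes values in
  \<open>V((w\<^sup>-\<^sup>1))((u\<^sup>-\<^sup>1))\<close>, and its coefficient of \<open>w\<^sup>n u\<^sup>p\<close> is given.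
  Bounded support makes the index sets finite.
\<close>

definition bounded_support :: "(int \<Rightarrow> int \<Rightarrow> int \<Rightarrow> 'v::zero) \<Rightarrow> bool" where
  "bounded_support c \<longleftrightarrow> (\<exists>N. \<forall>i j l. c i j l \<noteq> 0 \<longrightarrow> i \<le> N \<and> j \<le> N \<and> l \<le> N)"

definition expand_z_w ::
  "('k::field_char_0 \<Rightarrow> 'v::ab_group_add \<Rightarrow> 'v) \<Rightarrow> (int \<Rightarrow> int \<Rightarrow> int \<Rightarrow> 'v) \<Rightarrow> int \<Rightarrow> int \<Rightarrow> 'v" where
  "expand_z_w s c m n =
     (\<Sum>(i, j, l)\<in>{(i, j, l). i \<le> m \<and> i + j + l = m + n \<and> c i j l \<noteq> 0}.
        s (of_int l gchoose nat (m - i)) (c i j l))"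

definition expand_w_u ::
  "('k::field_char_0 \<Rightarrow> 'v::ab_group_add \<Rightarrow> 'v) \<Rightarrow> (int \<Rightarrow> int \<Rightarrow> int \<Rightarrow> 'v) \<Rightarrow> int \<Rightarrow> int \<Rightarrow> 'v" where
  "expand_w_u s c n p =
     (\<Sum>(i, j, l)\<in>{(i, j, l). j \<le> n \<and> i + j + l = n + p \<and> c i j l \<noteq> 0}.
        s ((- 1) ^ nat (n - j) * (of_int i gchoose nat (n - j))) (c i j l))"


section \<open>Nonlocal vertex coalgebras and vertex bialgebras\<close>

locale nonlocal_vertex_coalgebra = tensor_powers sV sV2 sV3 t2 t3
  for sV :: "'k::field_char_0 \<Rightarrow> 'v::ab_group_add \<Rightarrow> 'v"
  and sV2 :: "'k \<Rightarrow> 'v2::ab_group_add \<Rightarrow> 'v2"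
  and sV3 :: "'k \<Rightarrow> 'v3::ab_group_add \<Rightarrow> 'v3"
  and t2 :: "'v \<Rightarrow> 'v \<Rightarrow> 'v2"
  and t3 :: "'v2 \<Rightarrow> 'v \<Rightarrow> 'v3" +
  fixes \<Delta> :: "'v \<Rightarrow> int \<Rightarrow> 'v2"
  and T :: "'v \<Rightarrow> 'v"
  and \<epsilon> :: "'v \<Rightarrow> 'k"
  assumes linear_coproduct: "Vector_Spaces.linear sV sV2 (\<lambda>v. \<Delta> v n)"
  and laurent_coproduct: "laurent_inf (\<Delta> v)"
  and linear_translation: "Vector_Spaces.linear sV sV T"
  and linear_covacuum: "Vector_Spaces.linear sV (*) \<epsilon>"
  and coproduct_translation:
    "\<Delta> (T v) n = sV2 (of_int (n + 1)) (\<Delta> v (n + 1)) + tmap t2 t2 id T (\<Delta> v n)"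
  and weak_coassociativity:
    "\<exists>c. bounded_support c \<and>
       (\<forall>m n. cop_left t2 t3 (\<lambda>a. \<Delta> a m) (\<Delta> v n) = expand_z_w sV3 c m n) \<and>
       (\<forall>n p. cop_right t2 t3 (\<lambda>b. \<Delta> b n) (\<Delta> v p) = expand_w_u sV3 c n p)"
  and covacuum_left: "tlift t2 (\<lambda>a b. sV (\<epsilon> a) b) (\<Delta> v n) = (if n = 0 then v else 0)"
  and covacuum_right_0: "tlift t2 (\<lambda>a b. sV (\<epsilon> b) a) (\<Delta> v 0) = v"
  and covacuum_right_neg: "n < 0 \<Longrightarrow> tlift t2 (\<lambda>a b. sV (\<epsilon> b) a) (\<Delta> v n) = 0"

locale associative_algebra = vector_space sV
  for sV :: "'k::field \<Rightarrow> 'v::ab_group_add \<Rightarrow> 'v" +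
  fixes mul :: "'v \<Rightarrow> 'v \<Rightarrow> 'v"
  assumes bilinear_mul: "bilinear_map sV sV sV mul"
  and assoc_mul: "mul (mul x y) z = mul x (mul y z)"

text \<open>
  Algebras are not required to have a unit; a unit is expressed separately.
\<close>

definition unit_of :: "('v \<Rightarrow> 'v \<Rightarrow> 'v) \<Rightarrow> 'v \<Rightarrow> bool" where
  "unit_of mul e \<longleftrightarrow> (\<forall>x. mul e x = x \<and> mul x e = x)"

locale vertex_bialgebra =
  nonlocal_vertex_coalgebra sV sV2 sV3 t2 t3 \<Delta> T \<epsilon> + associative_algebra sV mul
  for sV :: "'k::field_char_0 \<Rightarrow> 'v::ab_group_add \<Rightarrow> 'v"
  and sV2 :: "'k \<Rightarrow> 'v2::ab_group_add \<Rightarrow> 'v2"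
  and sV3 :: "'k \<Rightarrow> 'v3::ab_group_add \<Rightarrow> 'v3"
  and t2 :: "'v \<Rightarrow> 'v \<Rightarrow> 'v2"
  and t3 :: "'v2 \<Rightarrow> 'v \<Rightarrow> 'v3"
  and mul :: "'v \<Rightarrow> 'v \<Rightarrow> 'v"
  and \<Delta> :: "'v \<Rightarrow> int \<Rightarrow> 'v2"
  and T :: "'v \<Rightarrow> 'v"
  and \<epsilon> :: "'v \<Rightarrow> 'k" +
  assumes coproduct_mul: "\<Delta> (mul x y) n = conv2 (tmap2 t2 t2 t2 mul mul) (\<Delta> x) (\<Delta> y) n"


section \<open>The holomorphic vertex bialgebra \<open>H\<close>\<close>

text \<open>
  The class \<^class>\<open>comm_ring_1\<close> includes \<open>0 \<noteq> 1\<close>; this is no restriction, as \<open>\<epsilon> 1 = 1\<close>.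
\<close>

locale cc_bialgebra =
  tensor_powers sH sHH sHHH tHH tHHH + associative_algebra sH "(*)"
  for sH :: "'k::field_char_0 \<Rightarrow> 'h::comm_ring_1 \<Rightarrow> 'h"
  and sHH :: "'k \<Rightarrow> 'hh::ab_group_add \<Rightarrow> 'hh"
  and sHHH :: "'k \<Rightarrow> 'hhh::ab_group_add \<Rightarrow> 'hhh"
  and tHH :: "'h \<Rightarrow> 'h \<Rightarrow> 'hh"
  and tHHH :: "'hh \<Rightarrow> 'h \<Rightarrow> 'hhh" +
  fixes \<Delta>H :: "'h \<Rightarrow> 'hh"
  and \<epsilon>H :: "'h \<Rightarrow> 'k"
  assumes linear_\<Delta>H: "Vector_Spaces.linear sH sHH \<Delta>H"
  and linear_\<epsilon>H: "Vector_Spaces.linear sH (*) \<epsilon>H"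
  and coassociative: "cop_left tHH tHHH \<Delta>H (\<Delta>H x) = cop_right tHH tHHH \<Delta>H (\<Delta>H x)"
  and counit_left: "tlift tHH (\<lambda>a b. sH (\<epsilon>H a) b) (\<Delta>H x) = x"
  and counit_right: "tlift tHH (\<lambda>a b. sH (\<epsilon>H b) a) (\<Delta>H x) = x"
  and cocommutative: "tlift tHH (\<lambda>a b. tHH b a) (\<Delta>H x) = \<Delta>H x"
  and \<Delta>H_mult: "\<Delta>H (x * y) = tmap2 tHH tHH tHH (*) (*) (\<Delta>H x) (\<Delta>H y)"
  and \<Delta>H_one: "\<Delta>H 1 = tHH 1 1"
  and \<epsilon>H_mult: "\<epsilon>H (x * y) = \<epsilon>H x * \<epsilon>H y"
  and \<epsilon>H_one: "\<epsilon>H 1 = 1"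

text \<open>The coefficient of \<open>z\<^sup>n\<close> in \<open>(e\<^bsup>zT\<^esup> \<otimes> id) \<Delta>H\<close>.\<close>

definition hol_coproduct ::
  "('k::field_char_0 \<Rightarrow> 'hh::ab_group_add \<Rightarrow> 'hh) \<Rightarrow> ('h \<Rightarrow> 'h \<Rightarrow> 'hh) \<Rightarrow> ('h \<Rightarrow> 'hh) \<Rightarrow> ('h \<Rightarrow> 'h) \<Rightarrow>
   'h \<Rightarrow> int \<Rightarrow> 'hh" where
  "hol_coproduct sHH tHH \<Delta>H TH x n =
     (if n < 0 then 0
      else sHH (1 / fact (nat n)) (tmap tHH tHH (TH ^^ nat n) id (\<Delta>H x)))"

definition leg12 :: "('hh \<Rightarrow> 'h::comm_ring_1 \<Rightarrow> 'hhh) \<Rightarrow> 'hh \<Rightarrow> 'hhh" where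
  "leg12 tHHH x = tHHH x 1"

definition leg13 ::
  "('h::comm_ring_1 \<Rightarrow> 'h \<Rightarrow> 'hh::ab_group_add) \<Rightarrow> ('hh \<Rightarrow> 'h \<Rightarrow> 'hhh::ab_group_add) \<Rightarrow> 'hh \<Rightarrow> 'hhh" where
  "leg13 tHH tHHH = tlift tHH (\<lambda>a b. tHHH (tHH a 1) b)"

definition leg23 ::
  "('h::comm_ring_1 \<Rightarrow> 'h \<Rightarrow> 'hh::ab_group_add) \<Rightarrow> ('hh \<Rightarrow> 'h \<Rightarrow> 'hhh::ab_group_add) \<Rightarrow> 'hh \<Rightarrow> 'hhh" where
  "leg23 tHH tHHH = tlift tHH (\<lambda>a b. tHHH (tHH 1 a) b)"

definition mult2 ::
  "('h::comm_ring_1 \<Rightarrow> 'h \<Rightarrow> 'hh::ab_group_add) \<Rightarrow> 'hh \<Rightarrow> 'hh \<Rightarrow> 'hh" where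
  "mult2 tHH = tmap2 tHH tHH tHH (*) (*)"

definition mult3 ::
  "('h::comm_ring_1 \<Rightarrow> 'h \<Rightarrow> 'hh::ab_group_add) \<Rightarrow> ('hh \<Rightarrow> 'h \<Rightarrow> 'hhh::ab_group_add) \<Rightarrow>
   'hhh \<Rightarrow> 'hhh \<Rightarrow> 'hhh" where
  "mult3 tHH tHHH = tmap2 tHHH tHHH tHHH (mult2 tHH) (*)"

text \<open>
  The hexagon relations compare, for \<open>m \<ge> 0\<close>, the coefficients of \<open>w\<^sup>m z\<^sup>n\<close>.
\<close>

locale spectral_bialgebra = cc_bialgebra sH sHH sHHH tHH tHHH \<Delta>H \<epsilon>H
  for sH :: "'k::field_char_0 \<Rightarrow> 'h::comm_ring_1 \<Rightarrow> 'h"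
  and sHH :: "'k \<Rightarrow> 'hh::ab_group_add \<Rightarrow> 'hh"
  and sHHH :: "'k \<Rightarrow> 'hhh::ab_group_add \<Rightarrow> 'hhh"
  and tHH :: "'h \<Rightarrow> 'h \<Rightarrow> 'hh"
  and tHHH :: "'hh \<Rightarrow> 'h \<Rightarrow> 'hhh"
  and \<Delta>H :: "'h \<Rightarrow> 'hh"
  and \<epsilon>H :: "'h \<Rightarrow> 'k" +
  fixes TH :: "'h \<Rightarrow> 'h"
  and R :: "int \<Rightarrow> 'hh"
  assumes linear_TH: "Vector_Spaces.linear sH sH TH"
  and derivation_TH: "TH (x * y) = TH x * y + x * TH y"
  and coderivation_TH: "\<Delta>H (TH x) = tmap tHH tHH TH id (\<Delta>H x) + tmap tHH tHH id TH (\<Delta>H x)"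
  and locally_nilpotent_TH: "\<exists>n. (TH ^^ n) x = 0"
  and laurent_R: "laurent_inf R"
  and invertible_R:
    "\<exists>R'. laurent_inf R' \<and> (\<forall>n. conv2 (mult2 tHH) R R' n = (if n = 0 then tHH 1 1 else 0))"
  and hexagon_left:
    "cop_left tHH tHHH (\<lambda>x. hol_coproduct sHH tHH \<Delta>H TH x (int m)) (R n) =
       conv2 (mult3 tHH tHHH) (\<lambda>p. leg13 tHH tHHH (taylor_coeff sHH (- 1) m R p))
         (\<lambda>q. leg23 tHH tHHH (R q)) n"
  and hexagon_right:
    "cop_right tHH tHHH (\<lambda>x. hol_coproduct sHH tHH \<Delta>H TH x (int m)) (R n) =
       conv2 (mult3 tHH tHHH) (\<lambda>p. leg12 tHHH (taylor_coeff sHH 1 m R p))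
         (\<lambda>q. leg13 tHH tHHH (R q)) n"


section \<open>Vertex bialgebras in the braided category of \<open>H\<close>-modules\<close>

text \<open>
  \<open>(r\<^sub>1 \<otimes> r\<^sub>2, b\<^sub>1 \<otimes> b\<^sub>2, b'\<^sub>1 \<otimes> b'\<^sub>2) \<mapsto> b\<^sub>1 (r\<^sub>2 b'\<^sub>1) \<otimes> (r\<^sub>1 b\<^sub>2) b'\<^sub>2\<close>, the product of two elements of
  \<open>B \<otimes> B\<close> with the braiding applied to the middle two factors.
\<close>

definition braided_mult ::
  "('h \<Rightarrow> 'h \<Rightarrow> 'hh::ab_group_add) \<Rightarrow> ('b::ring \<Rightarrow> 'b \<Rightarrow> 'bb::ab_group_add) \<Rightarrow> ('h \<Rightarrow> 'b \<Rightarrow> 'b) \<Rightarrow>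
   'hh \<Rightarrow> 'bb \<Rightarrow> 'bb \<Rightarrow> 'bb" where
  "braided_mult tHH tBB act r x y =
     tlift tHH (\<lambda>r1 r2. tlift tBB (\<lambda>b1 b2. tlift tBB (\<lambda>c1 c2.
       tBB (b1 * act r2 c1) (act r1 b2 * c2)) y) x) r"

locale braided_vertex_bialgebra =
  H: spectral_bialgebra sH sHH sHHH tHH tHHH \<Delta>H \<epsilon>H TH R +
  B: nonlocal_vertex_coalgebra sB sBB sBBB tBB tBBB \<Delta>B TB \<epsilon>B +
  B: associative_algebra sB "(*)"
  for sH :: "'k::field_char_0 \<Rightarrow> 'h::comm_ring_1 \<Rightarrow> 'h"
  and sHH :: "'k \<Rightarrow> 'hh::ab_group_add \<Rightarrow> 'hh"
  and sHHH :: "'k \<Rightarrow> 'hhh::ab_group_add \<Rightarrow> 'hhh"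
  and tHH :: "'h \<Rightarrow> 'h \<Rightarrow> 'hh"
  and tHHH :: "'hh \<Rightarrow> 'h \<Rightarrow> 'hhh"
  and \<Delta>H :: "'h \<Rightarrow> 'hh"
  and \<epsilon>H :: "'h \<Rightarrow> 'k"
  and TH :: "'h \<Rightarrow> 'h"
  and R :: "int \<Rightarrow> 'hh"
  and sB :: "'k \<Rightarrow> 'b::ring \<Rightarrow> 'b"
  and sBB :: "'k \<Rightarrow> 'bb::ab_group_add \<Rightarrow> 'bb"
  and sBBB :: "'k \<Rightarrow> 'bbb::ab_group_add \<Rightarrow> 'bbb"
  and tBB :: "'b \<Rightarrow> 'b \<Rightarrow> 'bb"
  and tBBB :: "'bb \<Rightarrow> 'b \<Rightarrow> 'bbb"
  and \<Delta>B :: "'b \<Rightarrow> int \<Rightarrow> 'bb"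
  and TB :: "'b \<Rightarrow> 'b"
  and \<epsilon>B :: "'b \<Rightarrow> 'k" +
  fixes act :: "'h \<Rightarrow> 'b \<Rightarrow> 'b"
  assumes bilinear_act: "bilinear_map sH sB sB act"
  and act_one: "act 1 b = b"
  and act_mult: "act (h * h') b = act h (act h' b)"
  and act_product: "act h (b * b') = tlift tHH (\<lambda>h1 h2. act h1 b * act h2 b') (\<Delta>H h)"
  and act_coproduct:
    "\<Delta>B (act h b) n =
       conv2 (tmap2 tHH tBB tBB act act) (hol_coproduct sHH tHH \<Delta>H TH h) (\<Delta>B b) n"
  and act_covacuum: "\<epsilon>B (act h b) = \<epsilon>H h * \<epsilon>B b"
  and TB_product: "TB (b * b') = TB b * b' + b * TB b'"
  and TB_act: "TB (act h b) = act (TH h) b + act h (TB b)"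
  and coproduct_product:
    "\<Delta>B (b * b') n = conv3 (braided_mult tHH tBB act) R (\<Delta>B b) (\<Delta>B b') n"


section \<open>The smash product of \<open>B\<close> and \<open>H\<close>\<close>

text \<open>Below, \<open>tA\<close> presents \<open>A = B \<otimes> H\<close> and \<open>tAA\<close> presents \<open>A \<otimes> A\<close>.\<close>

definition smash_mult ::
  "('h::comm_ring_1 \<Rightarrow> 'h \<Rightarrow> 'hh::ab_group_add) \<Rightarrow> ('h \<Rightarrow> 'hh) \<Rightarrow> ('h \<Rightarrow> 'b::ring \<Rightarrow> 'b) \<Rightarrow>
   ('b \<Rightarrow> 'h \<Rightarrow> 'a::ab_group_add) \<Rightarrow> 'a \<Rightarrow> 'a \<Rightarrow> 'a" where
  "smash_mult tHH \<Delta>H act tA x y =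
     tlift tA (\<lambda>b h. tlift tA (\<lambda>b' h'. tlift tHH (\<lambda>h1 h2. tA (b * act h1 b') (h2 * h')) (\<Delta>H h)) y) x"

text \<open>
  \<open>(r\<^sub>1 \<otimes> r\<^sub>2, b\<^sub>1 \<otimes> b\<^sub>2, h\<^sub>1 \<otimes> h\<^sub>2) \<mapsto> (b\<^sub>1 \<otimes> r\<^sub>2 h\<^sub>1) \<otimes> (r\<^sub>1 b\<^sub>2 \<otimes> h\<^sub>2)\<close>
\<close>

definition twist ::
  "('h::comm_ring_1 \<Rightarrow> 'h \<Rightarrow> 'hh::ab_group_add) \<Rightarrow> ('b \<Rightarrow> 'b \<Rightarrow> 'bb::ab_group_add) \<Rightarrow>
   ('h \<Rightarrow> 'b \<Rightarrow> 'b) \<Rightarrow> ('b \<Rightarrow> 'h \<Rightarrow> 'a) \<Rightarrow> ('a \<Rightarrow> 'a \<Rightarrow> 'aa::ab_group_add) \<Rightarrow>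
   'hh \<Rightarrow> 'bb \<Rightarrow> 'hh \<Rightarrow> 'aa" where
  "twist tHH tBB act tA tAA r x y =
     tlift tHH (\<lambda>r1 r2. tlift tBB (\<lambda>b1 b2. tlift tHH (\<lambda>h1 h2.
       tAA (tA b1 (r2 * h1)) (tA (act r1 b2) h2)) y) x) r"

definition smash_coproduct ::
  "('k::field_char_0 \<Rightarrow> 'hh::ab_group_add \<Rightarrow> 'hh) \<Rightarrow> ('h::comm_ring_1 \<Rightarrow> 'h \<Rightarrow> 'hh) \<Rightarrow>
   ('h \<Rightarrow> 'hh) \<Rightarrow> ('h \<Rightarrow> 'h) \<Rightarrow> (int \<Rightarrow> 'hh) \<Rightarrow>
   ('b \<Rightarrow> 'b \<Rightarrow> 'bb::ab_group_add) \<Rightarrow> ('b \<Rightarrow> int \<Rightarrow> 'bb) \<Rightarrow> ('h \<Rightarrow> 'b \<Rightarrow> 'b) \<Rightarrow>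
   ('b \<Rightarrow> 'h \<Rightarrow> 'a::ab_group_add) \<Rightarrow> ('a \<Rightarrow> 'a \<Rightarrow> 'aa::ab_group_add) \<Rightarrow> 'a \<Rightarrow> int \<Rightarrow> 'aa" where
  "smash_coproduct sHH tHH \<Delta>H TH R tBB \<Delta>B act tA tAA x n =
     tlift tA (\<lambda>b h. conv3 (twist tHH tBB act tA tAA) R (\<Delta>B b) (hol_coproduct sHH tHH \<Delta>H TH h) n) x"

definition smash_translation ::
  "('b \<Rightarrow> 'b) \<Rightarrow> ('h \<Rightarrow> 'h) \<Rightarrow> ('b \<Rightarrow> 'h \<Rightarrow> 'a::ab_group_add) \<Rightarrow> 'a \<Rightarrow> 'a" where
  "smash_translation TB TH tA x = tmap tA tA TB id x + tmap tA tA id TH x"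

definition smash_covacuum ::
  "('b \<Rightarrow> 'k::field) \<Rightarrow> ('h \<Rightarrow> 'k) \<Rightarrow> ('b \<Rightarrow> 'h \<Rightarrow> 'a::ab_group_add) \<Rightarrow> 'a \<Rightarrow> 'k" where
  "smash_covacuum \<epsilon>B \<epsilon>H tA = tlift tA (\<lambda>b h. \<epsilon>B b * \<epsilon>H h)"

end

theory Submission
  imports
    Defs
    "HOL-Computational_Algebra.Formal_Power_Series"
    "HOL-Library.Product_Plus"
    "HOL-Library.Product_Order"
begin

text \<open>
  Write \<open>A = B \<otimes> H\<close>.  The algebra \<open>H \<otimes> H\<close> acts on \<open>A\<close> by operators \<open>L\<close> (the module structure of \<open>B\<close>)
  and \<open>M\<close> (multiplication of \<open>H\<close>), and since \<open>H\<close> is commutative all of these commute.  The coproduct of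
  \<open>A\<close> is \<open>\<Delta>(z) = \<rho>(R(z)) \<Delta>\<^sub>0(z)\<close>, where \<open>\<Delta>\<^sub>0\<close> is the coproduct of \<open>B\<close> times that of \<open>H\<close> and
  \<open>\<rho>(r\<^sub>1 \<otimes> r\<^sub>2) = M r\<^sub>2 \<otimes> L r\<^sub>1\<close>.  By \<open>H\<close>-linearity \<open>\<Delta>(z)\<close> intertwines \<open>L\<close> and \<open>M\<close> with their
  coproducts, so the hexagon relations turn both sides of weak coassociativity into
  \<open>\<rho>\<^sub>1\<^sub>2(R(z)) \<rho>\<^sub>1\<^sub>3(R(z + w)) \<rho>\<^sub>2\<^sub>3(R(w))\<close> applied to the iterated \<open>\<Delta>\<^sub>0\<close>, whose weak coassociativity is
  that of \<open>B\<close> and \<open>H\<close>.  Left multiplication by \<open>b \<otimes> h\<close> is \<open>b\<close> composed with the diagonal action of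
  \<open>h\<close>; the latter is compatible with \<open>\<Delta>(z)\<close> because \<open>H\<close> is cocommutative, the former because of the two
  hexagon relations.  Since the counits of \<open>R\<close> are \<open>1\<close> and \<open>(T \<otimes> 1) R = - d/dz R\<close>, the twist changes
  neither the covacuum nor the translation axioms.
\<close>

section \<open>Convolutions of series with bounded support\<close>

text \<open>Weak coassociativity asks for one series of bounded support whose two expansions are the
  two iterated coproducts. It is exhibited as a product, over three exponents, of series in
  \<open>z\<close>, in \<open>w\<close> and in \<open>z + w\<close>. Expansion is multiplicative by
  Vandermonde's identity, so each factor can be expanded alone; for a factor that depends on a
  single one of these variables, only the dependence on the third produces binomial coefficients,
  and they are those in which the hexagon relations are stated. Rotating the exponents makes the
  second expansion an instance of the first, with \<open>z = u - w\<close> as third variable.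

  Applying counits to a hexagon at \<open>w = 0\<close> shows that the counits of \<open>R\<close>
  are idempotent; being invertible they are 1. The relation with \<open>d/dz\<close> is the
  coefficient of \<open>w\<close> in a hexagon, with a counit on one leg.

  For left multiplication by \<open>b\<close>, the right hexagon splits the twist applied to the
  product \<open>b a\<close>. One part merges with the braiding of the coproduct of
  \<open>b\<close>, by the left hexagon read backwards, into the twist of the first factor; the
  other part is the twist of the second factor.\<close>

text \<open>
  Series are functions on one of the index groups \<open>int\<close>, \<open>int \<times> int\<close>, \<open>int \<times> int \<times> int\<close>, with the componentwise
  order.  If intervals are finite, then the coefficients of a product of two series with supports
  bounded above are finite sums.
\<close>

class locally_finite_group = ordered_ab_group_add + lattice +
  assumes finite_interval: "finite {a..b}"

instance int :: locally_finite_group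
  by standard simp

instance prod :: (ordered_ab_group_add, ordered_ab_group_add) ordered_ab_group_add
  by standard (auto simp: less_eq_prod_def)

instance prod :: (locally_finite_group, locally_finite_group) locally_finite_group
proof
  fix a b :: "'a \<times> 'b"
  have "{a..b} \<subseteq> {fst a..fst b} \<times> {snd a..snd b}"
    by (auto simp: less_eq_prod_def)
  then show "finite {a..b}"
    by (rule finite_subset) (simp add: finite_interval)
qed

definition upper_bounded :: "('i::locally_finite_group \<Rightarrow> 'v::zero) \<Rightarrow> bool" where
  "upper_bounded F \<longleftrightarrow> (\<exists>N. \<forall>i. F i \<noteq> 0 \<longrightarrow> i \<le> N)"

lemma upper_bounded_int_iff: "upper_bounded F \<longleftrightarrow> laurent_inf F" for F :: "int \<Rightarrow> 'v::zero"
  unfolding upper_bounded_def laurent_inf_def by (metis linorder_not_le)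

lemma upper_boundedE:
  assumes "upper_bounded F"
  obtains N where "\<And>i. F i \<noteq> 0 \<Longrightarrow> i \<le> N"
  using assms unfolding upper_bounded_def by blast

lemma upper_bounded_add:
  fixes F G :: "'i::locally_finite_group \<Rightarrow> 'v::monoid_add"
  assumes "upper_bounded F" "upper_bounded G"
  shows "upper_bounded (\<lambda>i. F i + G i)"
proof -
  obtain M N where *: "\<And>i. F i \<noteq> 0 \<Longrightarrow> i \<le> M" "\<And>i. G i \<noteq> 0 \<Longrightarrow> i \<le> N"
    using assms by (meson upper_boundedE)
  have "i \<le> sup M N" if "F i + G i \<noteq> 0" for i
  proof (cases "F i = 0")
    case True
    then show ?thesis using that *(2)[of i] by (simp add: le_supI2)
  next
    case False
    then show ?thesis using *(1)[of i] by (simp add: le_supI1)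
  qed
  then show ?thesis unfolding upper_bounded_def by blast
qed

lemma upper_bounded_mono:
  assumes "upper_bounded F" "\<And>i. G i \<noteq> 0 \<Longrightarrow> F i \<noteq> 0"
  shows "upper_bounded G"
  using assms unfolding upper_bounded_def by blast

definition biadditive ::
  "('a::ab_group_add \<Rightarrow> 'b::ab_group_add \<Rightarrow> 'c::ab_group_add) \<Rightarrow> bool" where
  "biadditive f \<longleftrightarrow>
     (\<forall>x y z. f (x + y) z = f x z + f y z) \<and> (\<forall>x y z. f x (y + z) = f x y + f x z)"

lemma biadditiveD:
  assumes "biadditive f"
  shows "f (x + y) u = f x u + f y u" "f x (u + v) = f x u + f x v" "f 0 u = 0" "f x 0 = 0"
proof -
  show *: "f (x + y) u = f x u + f y u" "f x (u + v) = f x u + f x v" for x y u v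
    using assms by (auto simp: biadditive_def)
  show "f 0 u = 0" "f x 0 = 0"
    using *(1)[of 0 0 u] *(2)[of x 0 0] by simp_all
qed

lemma bilinear_map_biadditive: "bilinear_map sA sB sC f \<Longrightarrow> biadditive f"
  by (simp add: biadditive_def bilinear_mapD(1,2))

lemma biadditive_sum:
  assumes "biadditive f"
  shows "f (sum g S) u = (\<Sum>i\<in>S. f (g i) u)" "f x (sum k S) = (\<Sum>i\<in>S. f x (k i))"
  by (induction S rule: infinite_finite_induct) (simp_all add: biadditiveD[OF assms])

text \<open>\<open>conv2\<close> over any index group: the same products occur for one exponent, for
  pairs and for triples. Restricting the index set to nonzero entries keeps it finite for series
  bounded above.\<close>

definition conv ::
  "('a::zero \<Rightarrow> 'b::zero \<Rightarrow> 'c::ab_group_add) \<Rightarrow>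
   ('i::ab_group_add \<Rightarrow> 'a) \<Rightarrow> ('i \<Rightarrow> 'b) \<Rightarrow> 'i \<Rightarrow> 'c" where
  "conv f F G n = (\<Sum>(i, j)\<in>{(i, j). i + j = n \<and> F i \<noteq> 0 \<and> G j \<noteq> 0}. f (F i) (G j))"

definition tconv ::
  "('a::zero \<Rightarrow> 'b::zero \<Rightarrow> 'c::zero \<Rightarrow> 'd::ab_group_add) \<Rightarrow>
   ('i::ab_group_add \<Rightarrow> 'a) \<Rightarrow> ('i \<Rightarrow> 'b) \<Rightarrow> ('i \<Rightarrow> 'c) \<Rightarrow> 'i \<Rightarrow> 'd" where
  "tconv f F G K n =
     (\<Sum>(i, j, l)\<in>{(i, j, l). i + j + l = n \<and> F i \<noteq> 0 \<and> G j \<noteq> 0 \<and> K l \<noteq> 0}. f (F i) (G j) (K l))"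

lemma conv2_eq_conv: "conv2 = conv"
  by (intro ext) (simp add: conv_def conv2_def)

lemma conv3_eq_tconv: "conv3 = tconv"
  by (intro ext) (simp add: tconv_def conv3_def)

text \<open>Replaces the index set, which depends on the supports, by any finite window containing
  it, so that several series can share one window.\<close>

lemma conv_eq_sum:
  assumes f: "biadditive f" and S: "finite S" "\<And>i. F i \<noteq> 0 \<Longrightarrow> G (n - i) \<noteq> 0 \<Longrightarrow> i \<in> S"
  shows "conv f F G n = (\<Sum>i\<in>S. f (F i) (G (n - i)))"
proof -
  have "conv f F G n = (\<Sum>i\<in>{i. F i \<noteq> 0 \<and> G (n - i) \<noteq> 0}. f (F i) (G (n - i)))"
    unfolding conv_def
    by (rule sum.reindex_bij_witness[where i = "\<lambda>i. (i, n - i)" and j = fst]) auto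
  also have "\<dots> = (\<Sum>i\<in>S. f (F i) (G (n - i)))"
    using S by (intro sum.mono_neutral_left) (auto simp: biadditiveD[OF f])
  finally show ?thesis .
qed

lemma conv_eq_sum_interval:
  fixes F :: "'i::locally_finite_group \<Rightarrow> 'a::ab_group_add"
  assumes f: "biadditive f" and "\<And>i. F i \<noteq> 0 \<Longrightarrow> i \<le> M" "\<And>i. G i \<noteq> 0 \<Longrightarrow> i \<le> N"
  shows "conv f F G n = (\<Sum>i\<in>{n - N..M}. f (F i) (G (n - i)))"
proof (rule conv_eq_sum[OF f finite_interval])
  fix i assume "F i \<noteq> 0" "G (n - i) \<noteq> 0"
  then show "i \<in> {n - N..M}"
    using assms(2)[of i] assms(3)[of "n - i"] by (auto simp: algebra_simps)
qed

lemma conv_eq_sum_bounded: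
  fixes F :: "'i::locally_finite_group \<Rightarrow> 'a::ab_group_add"
  assumes f: "biadditive f" and F: "upper_bounded F" and G: "upper_bounded G"
  obtains S where "finite S" "\<And>i. F i \<noteq> 0 \<Longrightarrow> G (n - i) \<noteq> 0 \<Longrightarrow> i \<in> S"
    "conv f F G n = (\<Sum>i\<in>S. f (F i) (G (n - i)))"
proof -
  obtain M N where *: "\<And>i. F i \<noteq> 0 \<Longrightarrow> i \<le> M" "\<And>i. G i \<noteq> 0 \<Longrightarrow> i \<le> N"
    using F G by (meson upper_boundedE)
  have "i \<in> {n - N..M}" if "F i \<noteq> 0" "G (n - i) \<noteq> 0" for i
    using *(1)[of i] *(2)[of "n - i"] that by (auto simp: algebra_simps)
  then show ?thesis
    using that[OF finite_interval, of "n - N" M] conv_eq_sum_interval[OF f *] by blast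
qed

lemma conv_nonzeroE:
  assumes "conv f F G n \<noteq> 0"
  obtains i j where "F i \<noteq> 0" "G j \<noteq> 0" "n = i + j"
proof -
  have "{(i, j). i + j = n \<and> F i \<noteq> 0 \<and> G j \<noteq> 0} \<noteq> {}"
  proof
    assume "{(i, j). i + j = n \<and> F i \<noteq> 0 \<and> G j \<noteq> 0} = {}"
    with assms show False unfolding conv_def by (metis sum.empty)
  qed
  with that show ?thesis by blast
qed

lemma upper_bounded_conv:
  fixes F :: "'i::locally_finite_group \<Rightarrow> 'a::zero"
  assumes "upper_bounded F" "upper_bounded G"
  shows "upper_bounded (conv f F G)"
proof -
  obtain M N where *: "\<And>i. F i \<noteq> 0 \<Longrightarrow> i \<le> M" "\<And>i. G i \<noteq> 0 \<Longrightarrow> i \<le> N"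
    using assms by (meson upper_boundedE)
  have "n \<le> M + N" if "conv f F G n \<noteq> 0" for n
    using that by (rule conv_nonzeroE) (auto intro: add_mono *)
  then show ?thesis unfolding upper_bounded_def by blast
qed

lemma tconv_eq_sum:
  assumes h: "\<And>a b c. a = 0 \<or> b = 0 \<or> c = 0 \<Longrightarrow> h a b c = 0"
    and S: "finite S" "finite T"
      "\<And>i j. F i \<noteq> 0 \<Longrightarrow> G j \<noteq> 0 \<Longrightarrow> K (n - i - j) \<noteq> 0 \<Longrightarrow> i \<in> S \<and> j \<in> T"
  shows "tconv h F G K n = (\<Sum>i\<in>S. \<Sum>j\<in>T. h (F i) (G j) (K (n - i - j)))"
proof -
  have "tconv h F G K n =
      (\<Sum>(i, j)\<in>{(i, j). F i \<noteq> 0 \<and> G j \<noteq> 0 \<and> K (n - i - j) \<noteq> 0}. h (F i) (G j) (K (n - i - j)))"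
    unfolding tconv_def
    by (rule sum.reindex_bij_witness[where i = "\<lambda>(i, j). (i, j, n - i - j)"
          and j = "\<lambda>(i, j, l). (i, j)"]) (auto simp: algebra_simps)
  also have "\<dots> = (\<Sum>(i, j)\<in>S \<times> T. h (F i) (G j) (K (n - i - j)))"
    using S by (intro sum.mono_neutral_left) (auto intro!: h)
  finally show ?thesis by (simp add: sum.cartesian_product)
qed

lemma tconv_swap_left: "tconv h F G K = tconv (\<lambda>b a c. h a b c) G F K"
  unfolding tconv_def
  by (intro ext sum.reindex_bij_witness[where i = "\<lambda>(j, i, l). (i, j, l)"
        and j = "\<lambda>(i, j, l). (j, i, l)"]) (auto simp: algebra_simps)

lemma tconv_swap_right: "tconv h F G K = tconv (\<lambda>a c b. h a b c) F K G"
  unfolding tconv_def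
  by (intro ext sum.reindex_bij_witness[where i = "\<lambda>(j, i, l). (j, l, i)"
        and j = "\<lambda>(i, j, l). (i, l, j)"]) (auto simp: algebra_simps)

lemma conv_commute: "conv f F G = conv (\<lambda>x y. f y x) G F"
  unfolding conv_def
  by (intro ext sum.reindex_bij_witness[where i = "\<lambda>(j, i). (i, j)" and j = "\<lambda>(i, j). (j, i)"])
    (auto simp: algebra_simps)

text \<open>Both nestings of a product reduce to one triple sum. Associativity and exchange of
  series then follow from identities between trilinear maps of the coefficients.\<close>

lemma conv_conv_right:
  fixes F :: "'i::locally_finite_group \<Rightarrow> 'a::ab_group_add"
  assumes f: "biadditive f" and g: "biadditive g"
    and F: "upper_bounded F" and G: "upper_bounded G" and K: "upper_bounded K"
  shows "conv f F (conv g G K) = tconv (\<lambda>a b c. f a (g b c)) F G K"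
proof
  fix n
  obtain L M N where *: "\<And>i. F i \<noteq> 0 \<Longrightarrow> i \<le> L" "\<And>i. G i \<noteq> 0 \<Longrightarrow> i \<le> M" "\<And>i. K i \<noteq> 0 \<Longrightarrow> i \<le> N"
    using F G K by (meson upper_boundedE)
  have 1: "i \<in> {n - (M + N)..L} \<and> j \<in> {n - L - N..M}"
    if "F i \<noteq> 0" "G j \<noteq> 0" "K (n - i - j) \<noteq> 0" for i j
  proof -
    have b: "i \<le> L" "j \<le> M" "n - i - j \<le> N"
      using * that by blast+
    have "n - i - j + j \<le> N + M" using b by (intro add_mono)
    moreover have "n - i - j + i \<le> N + L" using b by (intro add_mono)
    ultimately show ?thesis using b by (simp add: algebra_simps)
  qed
  have 2: "conv g G K (n - i) = (\<Sum>j\<in>{n - L - N..M}. g (G j) (K (n - i - j)))" if "F i \<noteq> 0" for i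
    by (rule conv_eq_sum[OF g finite_interval]) (use 1 that in blast)
  have "conv f F (conv g G K) n = (\<Sum>i\<in>{n - (M + N)..L}. f (F i) (conv g G K (n - i)))"
  proof (rule conv_eq_sum_interval[OF f *(1)])
    show "i \<le> M + N" if "conv g G K i \<noteq> 0" for i
      using that by (rule conv_nonzeroE) (auto intro: add_mono *)
  qed
  also have "\<dots> = (\<Sum>i\<in>{n - (M + N)..L}. \<Sum>j\<in>{n - L - N..M}. f (F i) (g (G j) (K (n - i - j))))"
  proof (rule sum.cong[OF refl])
    fix i
    show "f (F i) (conv g G K (n - i)) =
        (\<Sum>j\<in>{n - L - N..M}. f (F i) (g (G j) (K (n - i - j))))"
      by (cases "F i = 0") (simp_all add: 2 biadditiveD[OF f] biadditive_sum[OF f])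
  qed
  also have "\<dots> = tconv (\<lambda>a b c. f a (g b c)) F G K n"
    by (rule tconv_eq_sum[symmetric])
      (use 1 finite_interval in \<open>auto simp: biadditiveD[OF f] biadditiveD[OF g]\<close>)
  finally show "conv f F (conv g G K) n = tconv (\<lambda>a b c. f a (g b c)) F G K n" .
qed

lemma conv_conv_left:
  fixes F :: "'i::locally_finite_group \<Rightarrow> 'a::ab_group_add"
  assumes f: "biadditive f" and g: "biadditive g"
    and F: "upper_bounded F" and G: "upper_bounded G" and K: "upper_bounded K"
  shows "conv f (conv g F G) K = tconv (\<lambda>a b c. f (g a b) c) F G K"
proof -
  have f': "biadditive (\<lambda>x y. f y x)" using f by (simp add: biadditive_def)
  show ?thesis
    unfolding conv_commute[of f] conv_conv_right[OF f' g K F G]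
    by (subst tconv_swap_left, subst tconv_swap_right) simp
qed

lemma conv_assoc:
  fixes F :: "'i::locally_finite_group \<Rightarrow> 'a::ab_group_add"
  assumes "biadditive f" "biadditive g" "biadditive f'" "biadditive g'"
    and "upper_bounded F" "upper_bounded G" "upper_bounded K"
    and "\<And>a b c. f (g a b) c = f' a (g' b c)"
  shows "conv f (conv g F G) K = conv f' F (conv g' G K)"
  using assms by (simp add: conv_conv_left conv_conv_right)

lemma conv_left_commute:
  fixes F :: "'i::locally_finite_group \<Rightarrow> 'a::ab_group_add"
  assumes "biadditive f" "biadditive g" "biadditive f'" "biadditive g'"
    and "upper_bounded F" "upper_bounded G" "upper_bounded K"
    and "\<And>a b c. f a (g b c) = g' b (f' a c)"
  shows "conv f F (conv g G K) = conv g' G (conv f' F K)"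
  using assms by (simp add: conv_conv_right tconv_swap_left[of _ F G K])

text \<open>An additive map may kill nonzero coefficients, so the two sides sum over different
  supports; the window of the larger support serves for both.\<close>

lemma conv_map:
  fixes F :: "'i::locally_finite_group \<Rightarrow> 'a::ab_group_add" and G :: "'i \<Rightarrow> 'b::ab_group_add"
  assumes f: "biadditive f" and \<phi>: "\<And>x y. \<phi> (x + y) = \<phi> x + \<phi> y" and \<psi>: "\<And>x y. \<psi> (x + y) = \<psi> x + \<psi> y"
    and F: "upper_bounded F" and G: "upper_bounded G"
  shows "conv f (\<lambda>i. \<phi> (F i)) (\<lambda>i. \<psi> (G i)) = conv (\<lambda>a b. f (\<phi> a) (\<psi> b)) F G"
proof
  fix n
  have 0: "\<phi> 0 = 0" "\<psi> 0 = 0" using \<phi>[of 0 0] \<psi>[of 0 0] by simp_all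
  have "biadditive (\<lambda>a b. f (\<phi> a) (\<psi> b))"
    by (simp add: biadditive_def biadditiveD[OF f] \<phi> \<psi>)
  from conv_eq_sum_bounded[OF this F G, of n]
  obtain S where S: "finite S" "\<And>i. F i \<noteq> 0 \<Longrightarrow> G (n - i) \<noteq> 0 \<Longrightarrow> i \<in> S"
    "conv (\<lambda>a b. f (\<phi> a) (\<psi> b)) F G n = (\<Sum>i\<in>S. f (\<phi> (F i)) (\<psi> (G (n - i))))"
    by blast
  show "conv f (\<lambda>i. \<phi> (F i)) (\<lambda>i. \<psi> (G i)) n = conv (\<lambda>a b. f (\<phi> a) (\<psi> b)) F G n"
    unfolding S(3) by (rule conv_eq_sum[OF f S(1)]) (use S(2) 0 in metis)
qed

text \<open>Both sides sum over the same index set, which depends only on \<open>F\<close> and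
  \<open>G\<close>; if it is infinite, both are 0.\<close>

lemma additive_conv:
  fixes F :: "'i::ab_group_add \<Rightarrow> 'a::zero"
  assumes \<phi>: "\<And>x y. \<phi> (x + y) = \<phi> x + \<phi> y"
  shows "\<phi> (conv f F G n) = conv (\<lambda>a b. \<phi> (f a b)) F G n"
proof -
  have 0: "\<phi> 0 = 0" using \<phi>[of 0 0] by simp
  have "\<phi> (sum g S) = (\<Sum>i\<in>S. \<phi> (g i))" for g :: "'i \<times> 'i \<Rightarrow> _" and S
    by (induction S rule: infinite_finite_induct) (simp_all add: 0 \<phi>)
  then show ?thesis by (simp add: conv_def case_prod_unfold)
qed

lemma conv_add_left:
  fixes F :: "'i::locally_finite_group \<Rightarrow> 'a::ab_group_add"
  assumes f: "biadditive f" and F: "upper_bounded F" "upper_bounded F'" and G: "upper_bounded G"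
  shows "conv f (\<lambda>i. F i + F' i) G n = conv f F G n + conv f F' G n"
proof -
  obtain L M N where *: "\<And>i. F i \<noteq> 0 \<Longrightarrow> i \<le> L" "\<And>i. F' i \<noteq> 0 \<Longrightarrow> i \<le> M" "\<And>i. G i \<noteq> 0 \<Longrightarrow> i \<le> N"
    using F G by (meson upper_boundedE)
  have F: "i \<le> sup L M" if "F i \<noteq> 0" for i using *(1)[OF that] by (rule le_supI1)
  have F': "i \<le> sup L M" if "F' i \<noteq> 0" for i using *(2)[OF that] by (rule le_supI2)
  have FF': "i \<le> sup L M" if "F i + F' i \<noteq> 0" for i using that F[of i] F'[of i] by fastforce
  have "conv f (\<lambda>i. F i + F' i) G n = (\<Sum>i\<in>{n - N..sup L M}. f (F i + F' i) (G (n - i)))"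
    by (rule conv_eq_sum_interval[OF f FF' *(3)])
  also have "\<dots> = (\<Sum>i\<in>{n - N..sup L M}. f (F i) (G (n - i))) +
      (\<Sum>i\<in>{n - N..sup L M}. f (F' i) (G (n - i)))"
    by (simp add: biadditiveD[OF f] sum.distrib)
  also have "\<dots> = conv f F G n + conv f F' G n"
    by (simp add: conv_eq_sum_interval[OF f F *(3)] conv_eq_sum_interval[OF f F' *(3)])
  finally show ?thesis .
qed

lemma conv_add_right:
  fixes F :: "'i::locally_finite_group \<Rightarrow> 'a::ab_group_add"
  assumes f: "biadditive f" and "upper_bounded F" "upper_bounded G" "upper_bounded G'"
  shows "conv f F (\<lambda>i. G i + G' i) n = conv f F G n + conv f F G' n"
proof -
  have "biadditive (\<lambda>x y. f y x)" using f by (simp add: biadditive_def)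
  then show ?thesis using assms by (simp add: conv_commute[of f] conv_add_left)
qed

lemma conv_delta_left:
  assumes "biadditive f"
  shows "conv f (\<lambda>i. if i = 0 then a else 0) G n = f a (G n)"
  by (subst conv_eq_sum[OF assms, of "{0}"]) (auto split: if_splits)

lemma conv_delta_right:
  assumes "biadditive f"
  shows "conv f F (\<lambda>i. if i = 0 then a else 0) n = f (F n) a"
  by (subst conv_eq_sum[OF assms, of "{n}"]) (auto split: if_splits)

text \<open>Slices a triple product along its first series. Each slice has a fixed coefficient
  \<open>F i\<close>, so identities known for a fixed first argument can be applied inside.\<close>

lemma tconv_outer_sum:
  fixes F :: "int \<Rightarrow> 'a::ab_group_add" and G :: "int \<Rightarrow> 'b::ab_group_add" and K :: "int \<Rightarrow> 'c::ab_group_add"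
  assumes h: "\<And>a. biadditive (h a)" "\<And>b c. h 0 b c = 0"
    and F: "\<And>i. F i \<noteq> 0 \<Longrightarrow> i \<le> M" and G: "\<And>i. G i \<noteq> 0 \<Longrightarrow> i \<le> N" and K: "\<And>i. K i \<noteq> 0 \<Longrightarrow> i \<le> P"
    and S: "finite S" "{n - N - P..M} \<subseteq> S"
  shows "tconv h F G K n = (\<Sum>i\<in>S. conv (h (F i)) G K (n - i))"
proof -
  have 1: "i \<in> S \<and> j \<in> {n - M - P..N}" if "F i \<noteq> 0" "G j \<noteq> 0" "K (n - i - j) \<noteq> 0" for i j
    using F[OF that(1)] G[OF that(2)] K[OF that(3)] S(2) by auto
  have "tconv h F G K n = (\<Sum>i\<in>S. \<Sum>j\<in>{n - M - P..N}. h (F i) (G j) (K (n - i - j)))"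
    by (rule tconv_eq_sum) (use h(2) biadditiveD(3,4)[OF h(1)] S(1) 1 in auto)
  also have "\<dots> = (\<Sum>i\<in>S. conv (h (F i)) G K (n - i))"
  proof (rule sum.cong[OF refl])
    fix i
    show "(\<Sum>j\<in>{n - M - P..N}. h (F i) (G j) (K (n - i - j))) = conv (h (F i)) G K (n - i)"
    proof (cases "F i = 0")
      case True
      then show ?thesis by (simp add: h(2) conv_def case_prod_unfold)
    next
      case False
      show ?thesis by (rule conv_eq_sum[OF h(1), symmetric]) (use 1 False in auto)
    qed
  qed
  finally show ?thesis .
qed

text \<open>An identity between products in which \<open>a\<close> is a constant is lifted to a
  series \<open>F\<close> in place of \<open>a\<close>, although \<open>E\<close> is multiplied from
  outside. This is used with \<open>F\<close> the coproduct of an element of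
  \<open>B\<close>.\<close>

lemma conv_tconv:
  fixes E :: "int \<Rightarrow> 'e::ab_group_add" and F :: "int \<Rightarrow> 'a::ab_group_add"
    and G :: "int \<Rightarrow> 'b::ab_group_add" and K :: "int \<Rightarrow> 'c::ab_group_add"
    and G' :: "int \<Rightarrow> 'b'::ab_group_add" and K' :: "int \<Rightarrow> 'c'::ab_group_add"
  assumes f: "biadditive f" and h: "\<And>a. biadditive (h a)" "\<And>b c. h 0 b c = 0"
    and h': "\<And>a. biadditive (h' a)" "\<And>b c. h' 0 b c = 0"
    and E: "upper_bounded E" and F: "upper_bounded F" and G: "upper_bounded G" and K: "upper_bounded K"
    and G': "upper_bounded G'" and K': "upper_bounded K'"
    and eq: "\<And>a. conv f E (conv (h a) G K) = conv (h' a) G' K'"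
  shows "conv f E (tconv h F G K) = tconv h' F G' K'"
proof
  fix n
  obtain L where L: "\<And>i. E i \<noteq> 0 \<Longrightarrow> i \<le> L" using E by (rule upper_boundedE) blast
  obtain M where M: "\<And>i. F i \<noteq> 0 \<Longrightarrow> i \<le> M" using F by (rule upper_boundedE) blast
  obtain N where N: "\<And>i. G i \<noteq> 0 \<Longrightarrow> i \<le> N" using G by (rule upper_boundedE) blast
  obtain P where P: "\<And>i. K i \<noteq> 0 \<Longrightarrow> i \<le> P" using K by (rule upper_boundedE) blast
  obtain N' where N': "\<And>i. G' i \<noteq> 0 \<Longrightarrow> i \<le> N'" using G' by (rule upper_boundedE) blast
  obtain P' where P': "\<And>i. K' i \<noteq> 0 \<Longrightarrow> i \<le> P'" using K' by (rule upper_boundedE) blast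
  \<comment> \<open>\<open>S\<close> must serve both sides: on the left the index
    \<open>n - j\<close> can drop to \<open>n - L\<close>, on the right it is \<open>n\<close>
    itself with the bounds of \<open>G'\<close> and \<open>K'\<close>.\<close>
  define S where "S = {min (n - L - N - P) (n - N' - P')..M}"
  define J where "J = {n - M - N - P..L}"
  have fin: "finite S" "finite J" by (simp_all add: S_def J_def)
  note outer = tconv_outer_sum[where h = h and F = F and G = G and K = K, OF h M N P fin(1)]
  have nz: "m \<le> M + N + P" if "tconv h F G K m \<noteq> 0" for m
  proof (rule ccontr)
    assume "\<not> m \<le> M + N + P"
    \<comment> \<open>Beyond this bound the required window is empty, so the empty index set is
      admissible.\<close>
    then have "tconv h F G K m = 0"
      using tconv_outer_sum[where h = h and F = F and G = G and K = K, OF h M N P finite.emptyI, of m]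
      by simp
    with that show False by simp
  qed
  have nz2: "m \<le> N + P" if "conv (h a) G K m \<noteq> 0" for m a
    using that by (rule conv_nonzeroE) (use N P in fastforce)
  have "conv f E (tconv h F G K) n = (\<Sum>j\<in>J. f (E j) (tconv h F G K (n - j)))"
  proof (rule conv_eq_sum[OF f fin(2)])
    fix j assume "E j \<noteq> 0" "tconv h F G K (n - j) \<noteq> 0"
    then show "j \<in> J" using L[of j] nz[of "n - j"] by (simp add: J_def)
  qed
  also have "\<dots> = (\<Sum>j\<in>J. \<Sum>i\<in>S. f (E j) (conv (h (F i)) G K (n - j - i)))"
  proof (rule sum.cong[OF refl])
    fix j assume "j \<in> J"
    then have "tconv h F G K (n - j) = (\<Sum>i\<in>S. conv (h (F i)) G K (n - j - i))"
      by (intro outer) (auto simp: S_def J_def)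
    then show "f (E j) (tconv h F G K (n - j)) = (\<Sum>i\<in>S. f (E j) (conv (h (F i)) G K (n - j - i)))"
      by (simp add: biadditive_sum(2)[OF f])
  qed
  also have "\<dots> = (\<Sum>i\<in>S. \<Sum>j\<in>J. f (E j) (conv (h (F i)) G K (n - i - j)))"
    by (subst sum.swap) (simp add: algebra_simps)
  also have "\<dots> = (\<Sum>i\<in>S. conv f E (conv (h (F i)) G K) (n - i))"
  proof (intro sum.cong refl conv_eq_sum[OF f fin(2), symmetric])
    fix i j assume "i \<in> S" "E j \<noteq> 0" "conv (h (F i)) G K (n - i - j) \<noteq> 0"
    then show "j \<in> J" using L[of j] nz2[of "F i" "n - i - j"] by (simp add: J_def S_def)
  qed
  also have "\<dots> = (\<Sum>i\<in>S. conv (h' (F i)) G' K' (n - i))"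
    by (simp only: eq)
  also have "\<dots> = tconv h' F G' K' n"
    by (rule tconv_outer_sum[where h = h' and F = F and G = G' and K = K', OF h' M N' P' fin(1), symmetric])
      (auto simp: S_def)
  finally show "conv f E (tconv h F G K) n = tconv h' F G' K' n" .
qed

text \<open>The counterpart of \<open>conv_tconv\<close> with no series multiplied from
  outside.\<close>

lemma tconv_cong:
  fixes F :: "int \<Rightarrow> 'a::ab_group_add"
    and G :: "int \<Rightarrow> 'b::ab_group_add" and K :: "int \<Rightarrow> 'c::ab_group_add"
    and G' :: "int \<Rightarrow> 'b'::ab_group_add" and K' :: "int \<Rightarrow> 'c'::ab_group_add"
  assumes h: "\<And>a. biadditive (h a)" "\<And>b c. h 0 b c = 0"
    and h': "\<And>a. biadditive (h' a)" "\<And>b c. h' 0 b c = 0"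
    and F: "upper_bounded F" and G: "upper_bounded G" and K: "upper_bounded K"
    and G': "upper_bounded G'" and K': "upper_bounded K'"
    and eq: "\<And>a. conv (h a) G K = conv (h' a) G' K'"
  shows "tconv h F G K = tconv h' F G' K'"
proof
  fix n
  obtain M where M: "\<And>i. F i \<noteq> 0 \<Longrightarrow> i \<le> M" using F by (rule upper_boundedE) blast
  obtain N where N: "\<And>i. G i \<noteq> 0 \<Longrightarrow> i \<le> N" using G by (rule upper_boundedE) blast
  obtain P where P: "\<And>i. K i \<noteq> 0 \<Longrightarrow> i \<le> P" using K by (rule upper_boundedE) blast
  obtain N' where N': "\<And>i. G' i \<noteq> 0 \<Longrightarrow> i \<le> N'" using G' by (rule upper_boundedE) blast
  obtain P' where P': "\<And>i. K' i \<noteq> 0 \<Longrightarrow> i \<le> P'" using K' by (rule upper_boundedE) blast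
  let ?S = "{min (n - N - P) (n - N' - P')..M}"
  have "tconv h F G K n = (\<Sum>i\<in>?S. conv (h (F i)) G K (n - i))"
    by (rule tconv_outer_sum[where h = h and F = F and G = G and K = K, OF h M N P]) auto
  also have "\<dots> = tconv h' F G' K' n"
    unfolding eq
    by (rule tconv_outer_sum[where h = h' and F = F and G = G' and K = K', OF h' M N' P', symmetric]) auto
  finally show "tconv h F G K n = tconv h' F G' K' n" .
qed

section \<open>Linear maps on tensor products\<close>

lemma linear_add: "Vector_Spaces.linear s1 s2 f \<Longrightarrow> f (x + y) = f x + f y"
  and linear_scale: "Vector_Spaces.linear s1 s2 f \<Longrightarrow> f (s1 c x) = s2 c (f x)"
  by (simp_all add: linear_iff)

lemma linear_zero:
  assumes "Vector_Spaces.linear s1 s2 f"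
  shows "f 0 = 0"
  using linear_add[OF assms, of 0 0] by simp

lemma linear_vector_space:
  "Vector_Spaces.linear s1 s2 f \<Longrightarrow> vector_space s1"
  "Vector_Spaces.linear s1 s2 f \<Longrightarrow> vector_space s2"
  by (simp_all add: linear_iff)

lemma linear_ident: "vector_space s \<Longrightarrow> Vector_Spaces.linear s s (\<lambda>x. x)"
  by (simp add: linear_iff)

lemma linear_plus:
  assumes "Vector_Spaces.linear s1 s2 f" "Vector_Spaces.linear s1 s2 g"
  shows "Vector_Spaces.linear s1 s2 (\<lambda>x. f x + g x)"
proof -
  interpret vector_space s2 by (rule linear_vector_space(2)[OF assms(1)])
  show ?thesis
    using assms by (simp add: linear_iff scale_right_distrib)
qed

lemma linear_scaled:
  assumes "Vector_Spaces.linear s1 s2 f"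
  shows "Vector_Spaces.linear s1 s2 (\<lambda>x. s2 c (f x))"
proof -
  interpret vector_space s2 by (rule linear_vector_space(2)[OF assms(1)])
  show ?thesis
    using assms by (simp add: linear_iff scale_right_distrib mult.commute)
qed

lemma linear_sum_fun:
  assumes "vector_space s1" "vector_space s2" "\<And>i. i \<in> S \<Longrightarrow> Vector_Spaces.linear s1 s2 (f i)"
  shows "Vector_Spaces.linear s1 s2 (\<lambda>x. \<Sum>i\<in>S. f i x)"
proof -
  interpret vector_space s2 by (rule assms)
  show ?thesis
    using assms by (simp add: linear_iff sum.distrib scale_sum_right)
qed

lemma linear_comp:
  assumes "Vector_Spaces.linear s2 s3 g" "Vector_Spaces.linear s1 s2 f"
  shows "Vector_Spaces.linear s1 s3 (\<lambda>x. g (f x))"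
  using assms by (simp add: linear_iff)

lemma bilinear_mapI:
  assumes "\<And>a. Vector_Spaces.linear sB sC (\<lambda>b. f a b)" "\<And>b. Vector_Spaces.linear sA sC (\<lambda>a. f a b)"
  shows "bilinear_map sA sB sC f"
  using assms by (simp add: bilinear_map_def)

lemma linear_bilinear_left:
  assumes "bilinear_map sA sB sC f" "Vector_Spaces.linear s sA g"
  shows "Vector_Spaces.linear s sC (\<lambda>x. f (g x) c)"
  using assms by (simp add: linear_iff bilinear_mapD[OF assms(1)])

lemma linear_bilinear_right:
  assumes "bilinear_map sA sB sC f" "Vector_Spaces.linear s sB g"
  shows "Vector_Spaces.linear s sC (\<lambda>x. f c (g x))"
  using assms by (simp add: linear_iff bilinear_mapD[OF assms(1)])

lemma bilinear_scale:
  assumes "vector_space s"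
  shows "bilinear_map (*) s s s"
proof -
  interpret vector_space s by fact
  interpret F: vector_space "(*) :: 'a \<Rightarrow> 'a \<Rightarrow> 'a"
    by unfold_locales (simp_all add: algebra_simps)
  show ?thesis
    by (simp add: bilinear_map_def linear_iff vector_space_axioms F.vector_space_axioms
        scale_left_distrib scale_right_distrib mult.commute)
qed

context tensor_product
begin

text \<open>Scalars can be absorbed into the left factor and \<open>0\<close> is the pure tensor
  \<open>t 0 0\<close>, so pure tensors and sums are the only cases.\<close>

lemma tensor_induct [case_names tensor add]:
  assumes "\<And>a b. P (t a b)" and add: "\<And>x y. P x \<Longrightarrow> P y \<Longrightarrow> P (x + y)"
  shows "P x"
proof -
  obtain ps where x: "x = (\<Sum>(a, b)\<leftarrow>ps. t a b)"
    using tensor_sum_list by blast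
  have "t 0 0 = 0" using biadditiveD(3)[OF bilinear_map_biadditive[OF bilinear_t]] .
  then have "P 0" using assms(1)[of 0 0] by simp
  then show ?thesis
    unfolding x by (induction ps) (auto intro!: assms)
qed

lemma linear_tlift_param:
  assumes f: "\<And>v. bilinear_map sA sB sC (f v)"
    and lin: "\<And>a b. Vector_Spaces.linear sV sC (\<lambda>v. f v a b)"
  shows "Vector_Spaces.linear sV sC (\<lambda>v. tlift t (f v) x)"
proof (induction x rule: tensor_induct)
  case (tensor a b)
  then show ?case using lin by (simp add: tlift_tensor[OF f])
next
  case (add x y)
  then show ?case by (simp add: linear_add[OF linear_tlift[OF f]] linear_plus)
qed

lemma linear_eqI:
  assumes "Vector_Spaces.linear sT s f" "Vector_Spaces.linear sT s g" "\<And>a b. f (t a b) = g (t a b)"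
  shows "f x = g x"
  by (induction x rule: tensor_induct)
    (simp_all add: assms(3) linear_add[OF assms(1)] linear_add[OF assms(2)])

text \<open>Collapses the nested Sweedler sums of the definitions: a sum whose summand is a linear
  map evaluated at the pure tensor is that map.\<close>

lemma linear_eq_tlift:
  assumes F: "Vector_Spaces.linear sT s F"
  shows "tlift t (\<lambda>a b. F (t a b)) x = F x"
proof -
  have bil: "bilinear_map sA sB s (\<lambda>a b. F (t a b))"
    by (intro bilinear_mapI linear_comp[OF F] linear_bilinear_left[OF bilinear_t]
        linear_bilinear_right[OF bilinear_t] linear_ident A.vector_space_axioms B.vector_space_axioms)
  show ?thesis
    by (rule linear_eqI[OF linear_tlift[OF bil] F]) (rule tlift_tensor[OF bil])
qed

end

lemma bilinear_tensor_comp: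
  assumes "tensor_product sC sD sT t"
    and "Vector_Spaces.linear sA sC f" "Vector_Spaces.linear sB sD g"
  shows "bilinear_map sA sB sT (\<lambda>a b. t (f a) (g b))"
proof -
  interpret tensor_product sC sD sT t by fact
  show ?thesis
    by (intro bilinear_mapI linear_bilinear_left[OF bilinear_t]
        linear_bilinear_right[OF bilinear_t] assms)
qed

lemma tmap_tensor:
  assumes "tensor_product sA sB sS s" "tensor_product sC sD sT t"
    and "Vector_Spaces.linear sA sC f" "Vector_Spaces.linear sB sD g"
  shows "tmap s t f g (s a b) = t (f a) (g b)"
  unfolding tmap_def
  by (rule tensor_product.tlift_tensor[OF assms(1) bilinear_tensor_comp[OF assms(2-4)]])

lemma linear_tmap:
  assumes "tensor_product sA sB sS s" "tensor_product sC sD sT t"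
    and "Vector_Spaces.linear sA sC f" "Vector_Spaces.linear sB sD g"
  shows "Vector_Spaces.linear sS sT (tmap s t f g)"
  unfolding tmap_def
  by (rule tensor_product.linear_tlift[OF assms(1) bilinear_tensor_comp[OF assms(2-4)]])

context
  fixes sA :: "'k::field \<Rightarrow> 'a::ab_group_add \<Rightarrow> 'a" and sB :: "'k \<Rightarrow> 'b::ab_group_add \<Rightarrow> 'b"
    and sC :: "'k \<Rightarrow> 'c::ab_group_add \<Rightarrow> 'c" and sD :: "'k \<Rightarrow> 'd::ab_group_add \<Rightarrow> 'd"
    and sE :: "'k \<Rightarrow> 'e::ab_group_add \<Rightarrow> 'e" and sF :: "'k \<Rightarrow> 'f::ab_group_add \<Rightarrow> 'f"
    and sS :: "'k \<Rightarrow> 's::ab_group_add \<Rightarrow> 's" and sT :: "'k \<Rightarrow> 't::ab_group_add \<Rightarrow> 't"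
    and sU :: "'k \<Rightarrow> 'u::ab_group_add \<Rightarrow> 'u" and s t u f g
  assumes S: "tensor_product sA sB sS s" and T: "tensor_product sC sD sT t"
    and U: "tensor_product sE sF sU u"
    and f: "bilinear_map sA sC sE f" and g: "bilinear_map sB sD sF g"
begin

interpretation S: tensor_product sA sB sS s by (rule S)
interpretation T: tensor_product sC sD sT t by (rule T)

lemmas fg_linear = linear_bilinear_left[OF f] linear_bilinear_right[OF f]
  linear_bilinear_left[OF g] linear_bilinear_right[OF g] linear_ident bilinear_mapD(5,6)[OF f]
  bilinear_mapD(5,6)[OF g]

lemma bilinear_tmap2_inner: "bilinear_map sC sD sU (\<lambda>c d. u (f a c) (g b d))"
  by (intro bilinear_tensor_comp[OF U] fg_linear)

lemma bilinear_tmap2_outer: "bilinear_map sA sB sU (\<lambda>a b. tlift t (\<lambda>c d. u (f a c) (g b d)) y)"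
  by (intro bilinear_mapI T.linear_tlift_param bilinear_tmap2_inner
      linear_bilinear_left[OF tensor_product.bilinear_t[OF U]]
      linear_bilinear_right[OF tensor_product.bilinear_t[OF U]] fg_linear)

lemma tmap2_tensor: "tmap2 s t u f g (s a b) (t c d) = u (f a c) (g b d)"
  unfolding tmap2_def
  by (subst S.tlift_tensor[OF bilinear_tmap2_outer], rule T.tlift_tensor[OF bilinear_tmap2_inner])

lemma bilinear_tmap2: "bilinear_map sS sT sU (tmap2 s t u f g)"
  unfolding tmap2_def
  by (intro bilinear_mapI S.linear_tlift bilinear_tmap2_outer S.linear_tlift_param T.linear_tlift
      bilinear_tmap2_inner)

end

context tensor_powers
begin

lemma V_space: "vector_space sV" "vector_space sV2" "vector_space sV3"
  using V2.A.vector_space_axioms V2.T.vector_space_axioms V3.T.vector_space_axioms .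

lemma bilinear_assoc: "bilinear_map sV sV2 sV3 (\<lambda>a. tlift t2 (\<lambda>c d. t3 (t2 a c) d))"
  by (intro bilinear_mapI V2.linear_tlift V2.linear_tlift_param linear_bilinear_left[OF V3.bilinear_t]
      linear_bilinear_right[OF V3.bilinear_t] linear_bilinear_left[OF V2.bilinear_t]
      linear_bilinear_right[OF V2.bilinear_t] linear_ident V_space)

text \<open>The isomorphism from \<open>V \<otimes> (V \<otimes> V)\<close> to
  \<open>(V \<otimes> V) \<otimes> V\<close>, curried because only the left bracketing is presented
  by a type.\<close>

definition reassoc :: "'v \<Rightarrow> 'v2 \<Rightarrow> 'v3" where
  "reassoc a = tlift t2 (\<lambda>c d. t3 (t2 a c) d)"

lemma bilinear_reassoc: "bilinear_map sV sV2 sV3 reassoc"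
  using bilinear_assoc by (simp add: reassoc_def[abs_def])

lemma reassoc_tensor: "reassoc a (t2 b c) = t3 (t2 a b) c"
  unfolding reassoc_def
  by (rule V2.tlift_tensor[where sC = sV3])
    (intro bilinear_mapI linear_bilinear_left[OF V3.bilinear_t]
      linear_bilinear_right[OF V3.bilinear_t] linear_bilinear_left[OF V2.bilinear_t]
      linear_bilinear_right[OF V2.bilinear_t] linear_ident V_space)

lemma cop_right_eq: "cop_right t2 t3 D = tlift t2 (\<lambda>a b. reassoc a (D b))"
  by (simp add: cop_right_def reassoc_def)

lemma
  assumes "Vector_Spaces.linear sV sV2 D"
  shows linear_cop_left: "Vector_Spaces.linear sV2 sV3 (cop_left t2 t3 D)"
    and cop_left_tensor: "cop_left t2 t3 D (t2 a b) = t3 (D a) b"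
    and linear_cop_right: "Vector_Spaces.linear sV2 sV3 (cop_right t2 t3 D)"
    and cop_right_tensor: "cop_right t2 t3 D (t2 a b) = reassoc a (D b)"
proof -
  have l: "bilinear_map sV sV sV3 (\<lambda>a b. t3 (D a) b)"
    by (intro bilinear_tensor_comp[OF V3.tensor_product_axioms] assms linear_ident V_space)
  have r: "bilinear_map sV sV sV3 (\<lambda>a b. reassoc a (D b))"
    by (intro bilinear_mapI linear_bilinear_left[OF bilinear_reassoc]
      linear_bilinear_right[OF bilinear_reassoc] assms linear_ident V_space)
  show "Vector_Spaces.linear sV2 sV3 (cop_left t2 t3 D)" "cop_left t2 t3 D (t2 a b) = t3 (D a) b"
    unfolding cop_left_def using l by (rule V2.linear_tlift V2.tlift_tensor)+
  show "Vector_Spaces.linear sV2 sV3 (cop_right t2 t3 D)"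
    "cop_right t2 t3 D (t2 a b) = reassoc a (D b)"
    unfolding cop_right_eq using r by (rule V2.linear_tlift V2.tlift_tensor)+
qed

lemma tensor3_induct [case_names tensor add]:
  assumes "\<And>a b c. P (t3 (t2 a b) c)" and "\<And>x y. P x \<Longrightarrow> P y \<Longrightarrow> P (x + y)"
  shows "P x"
proof (induction x rule: V3.tensor_induct)
  case (tensor x c)
  show ?case
  proof (induction x rule: V2.tensor_induct)
    case (add x y)
    then show ?case
      using assms(2) by (simp add: bilinear_mapD(1)[OF V3.bilinear_t])
  qed (rule assms)
qed (rule assms)

end

lemma linear_id: "vector_space s \<Longrightarrow> Vector_Spaces.linear s s id"
  by (simp add: linear_iff)

lemma conv_bilinear:
  fixes s1 :: "'k::field \<Rightarrow> 'a::ab_group_add \<Rightarrow> 'a"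
    and s2 :: "'k \<Rightarrow> 'b::ab_group_add \<Rightarrow> 'b" and s3 :: "'k \<Rightarrow> 'c::ab_group_add \<Rightarrow> 'c"
    and sX :: "'k \<Rightarrow> 'x::ab_group_add \<Rightarrow> 'x" and sY :: "'k \<Rightarrow> 'y::ab_group_add \<Rightarrow> 'y"
    and F :: "int \<Rightarrow> 'x \<Rightarrow> 'a" and G :: "int \<Rightarrow> 'y \<Rightarrow> 'b"
  assumes f: "bilinear_map s1 s2 s3 f"
    and F: "\<And>i. Vector_Spaces.linear sX s1 (F i)" "\<And>x. upper_bounded (\<lambda>i. F i x)"
    and G: "\<And>i. Vector_Spaces.linear sY s2 (G i)" "\<And>y. upper_bounded (\<lambda>i. G i y)"
  shows "bilinear_map sX sY s3 (\<lambda>x y. conv f (\<lambda>i. F i x) (\<lambda>j. G j y) n)"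
proof -
  note fa = bilinear_map_biadditive[OF f]
  have scale1: "conv f (\<lambda>i. s1 c (H i)) K n = s3 c (conv f H K n)"
    if "upper_bounded H" "upper_bounded K" for c and H :: "int \<Rightarrow> 'a" and K
  proof -
    interpret s1: vector_space s1 by (rule bilinear_mapD[OF f])
    interpret s3: vector_space s3 by (rule bilinear_mapD[OF f])
    have "conv f (\<lambda>i. s1 c (H i)) K n = conv (\<lambda>a b. f (s1 c a) b) H K n"
      by (rule conv_map[where \<psi> = "\<lambda>x. x", THEN fun_cong])
        (simp_all add: fa s1.scale_right_distrib that)
    also have "\<dots> = s3 c (conv f H K n)"
      using additive_conv[of "s3 c" f H K n]
      by (simp add: s3.scale_right_distrib bilinear_mapD(3)[OF f])
    finally show ?thesis .
  qed
  have scale2: "conv f H (\<lambda>i. s2 c (K i)) n = s3 c (conv f H K n)"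
    if "upper_bounded H" "upper_bounded K" for c and H :: "int \<Rightarrow> 'a" and K
  proof -
    interpret s2: vector_space s2 by (rule bilinear_mapD[OF f])
    interpret s3: vector_space s3 by (rule bilinear_mapD[OF f])
    have "conv f H (\<lambda>i. s2 c (K i)) n = conv (\<lambda>a b. f a (s2 c b)) H K n"
      by (rule conv_map[where \<phi> = "\<lambda>x. x", THEN fun_cong])
        (simp_all add: fa s2.scale_right_distrib that)
    also have "\<dots> = s3 c (conv f H K n)"
      using additive_conv[of "s3 c" f H K n]
      by (simp add: s3.scale_right_distrib bilinear_mapD(4)[OF f])
    finally show ?thesis .
  qed
  show ?thesis
    unfolding bilinear_map_def linear_iff
    using F(2) G(2) linear_vector_space[OF F(1)] linear_vector_space[OF G(1)] bilinear_mapD(7)[OF f]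
    by (simp add: linear_add[OF F(1)] linear_add[OF G(1)] linear_scale[OF F(1)] linear_scale[OF G(1)]
        conv_add_left[OF fa] conv_add_right[OF fa] scale1 scale2)
qed

text \<open>The bound may depend on \<open>x\<close>, and a finite sum of pure tensors has a common
  one.\<close>

lemma upper_bounded_int_tensor_induct:
  assumes "tensor_product sA sB sT t"
    and "\<And>n. Vector_Spaces.linear sT s (F n)" "\<And>a b. upper_bounded (\<lambda>n::int. F n (t a b))"
  shows "upper_bounded (\<lambda>n. F n x)"
proof -
  interpret tensor_product sA sB sT t by fact
  show ?thesis
    by (induction x rule: tensor_induct)
      (simp_all add: assms(3) linear_add[OF assms(2)] upper_bounded_add)
qed

lemma conv_linear_right:
  fixes s1 :: "'k::field \<Rightarrow> 'a::ab_group_add \<Rightarrow> 'a"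
    and s2 :: "'k \<Rightarrow> 'b::ab_group_add \<Rightarrow> 'b" and s3 :: "'k \<Rightarrow> 'c::ab_group_add \<Rightarrow> 'c"
    and sY :: "'k \<Rightarrow> 'y::ab_group_add \<Rightarrow> 'y" and F :: "int \<Rightarrow> 'a" and G :: "int \<Rightarrow> 'y \<Rightarrow> 'b"
  assumes f: "bilinear_map s1 s2 s3 f" and F: "upper_bounded F"
    and G: "\<And>i. Vector_Spaces.linear sY s2 (G i)" "\<And>y. upper_bounded (\<lambda>i. G i y)"
  shows "Vector_Spaces.linear sY s3 (\<lambda>y. conv f F (\<lambda>j. G j y) n)"
proof -
  interpret s1: vector_space s1 by (rule bilinear_mapD[OF f])
  \<comment> \<open>The fixed series is scaled by a parameter \<open>c\<close>, in which it is
    linear, so that \<open>conv_bilinear\<close> applies; \<open>c = 1\<close> gives it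
    back.\<close>
  have "bilinear_map (*) sY s3 (\<lambda>c y. conv f (\<lambda>i. s1 c (F i)) (\<lambda>j. G j y) n)"
  proof (rule conv_bilinear[OF f _ _ G])
    show "Vector_Spaces.linear (*) s1 (\<lambda>c. s1 c (F i))" for i
      using bilinear_scale[OF s1.vector_space_axioms] by (simp add: bilinear_map_def)
    show "upper_bounded (\<lambda>i. s1 c (F i))" for c
      by (rule upper_bounded_mono[OF F]) auto
  qed
  then have "\<forall>c. Vector_Spaces.linear sY s3 (\<lambda>y. conv f (\<lambda>i. s1 c (F i)) (\<lambda>j. G j y) n)"
    by (simp add: bilinear_map_def)
  from spec[OF this, of 1] show ?thesis by simp
qed

lemma bilinear_flip: "bilinear_map s1 s2 s3 f \<Longrightarrow> bilinear_map s2 s1 s3 (\<lambda>x y. f y x)"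
  by (simp add: bilinear_map_def)

lemma conv_linear_left:
  fixes s1 :: "'k::field \<Rightarrow> 'a::ab_group_add \<Rightarrow> 'a"
    and s2 :: "'k \<Rightarrow> 'b::ab_group_add \<Rightarrow> 'b" and s3 :: "'k \<Rightarrow> 'c::ab_group_add \<Rightarrow> 'c"
    and sY :: "'k \<Rightarrow> 'y::ab_group_add \<Rightarrow> 'y" and F :: "int \<Rightarrow> 'y \<Rightarrow> 'a" and G :: "int \<Rightarrow> 'b"
  assumes f: "bilinear_map s1 s2 s3 f"
    and F: "\<And>i. Vector_Spaces.linear sY s1 (F i)" "\<And>y. upper_bounded (\<lambda>i. F i y)"
    and G: "upper_bounded G"
  shows "Vector_Spaces.linear sY s3 (\<lambda>y. conv f (\<lambda>j. F j y) G n)"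
  unfolding conv_commute[of f] by (rule conv_linear_right[OF bilinear_flip[OF f] G F])

section \<open>Termwise derivatives and images of series\<close>

definition series_deriv :: "('k::field \<Rightarrow> 'v \<Rightarrow> 'v) \<Rightarrow> (int \<Rightarrow> 'v) \<Rightarrow> int \<Rightarrow> 'v" where
  "series_deriv s F n = s (of_int (n + 1)) (F (n + 1))"

lemma upper_bounded_series_deriv:
  assumes "vector_space s" "upper_bounded F"
  shows "upper_bounded (series_deriv s F)"
proof -
  interpret vector_space s by fact
  obtain N where N: "\<And>i. F i \<noteq> 0 \<Longrightarrow> i \<le> N" using assms(2) by (rule upper_boundedE) blast
  have "n \<le> N" if "series_deriv s F n \<noteq> 0" for n
    using that N[of "n + 1"] by (auto simp: series_deriv_def)
  then show ?thesis unfolding upper_bounded_def by blast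
qed

text \<open>In each summand the factor \<open>n + 1\<close> splits as
  \<open>i + (n + 1 - i)\<close>. The first part differentiates \<open>F\<close> after a shift of
  the index, the second differentiates \<open>G\<close>.\<close>

lemma series_deriv_conv:
  fixes F :: "int \<Rightarrow> 'a::ab_group_add" and G :: "int \<Rightarrow> 'b::ab_group_add"
  assumes f: "bilinear_map s1 s2 s3 f" and F: "upper_bounded F" and G: "upper_bounded G"
  shows "series_deriv s3 (conv f F G) n =
    conv f (series_deriv s1 F) G n + conv f F (series_deriv s2 G) n"
proof -
  interpret s3: vector_space s3 by (rule bilinear_mapD[OF f])
  note fa = bilinear_map_biadditive[OF f]
  obtain M where M: "\<And>i. F i \<noteq> 0 \<Longrightarrow> i \<le> M" using F by (rule upper_boundedE) blast
  obtain N where N: "\<And>i. G i \<noteq> 0 \<Longrightarrow> i \<le> N" using G by (rule upper_boundedE) blast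
  let ?S = "{n - N..M}"
  interpret s1: vector_space s1 by (rule bilinear_mapD[OF f])
  interpret s2: vector_space s2 by (rule bilinear_mapD[OF f])
  have "conv f F G (n + 1) = (\<Sum>i\<in>?S. f (F i) (G (n + 1 - i)))"
    by (rule conv_eq_sum[OF fa]) (use M N[of "n + 1 - i" for i] in fastforce)+
  then have "series_deriv s3 (conv f F G) n =
      (\<Sum>i\<in>?S. s3 (of_int i) (f (F i) (G (n + 1 - i))) + s3 (of_int (n - i + 1)) (f (F i) (G (n + 1 - i))))"
    by (simp add: series_deriv_def s3.scale_sum_right s3.scale_left_distrib[symmetric]
        flip: of_int_add del: of_int_add of_int_diff)
  also have "\<dots> = (\<Sum>i\<in>?S. s3 (of_int i) (f (F i) (G (n + 1 - i)))) +
      (\<Sum>i\<in>?S. f (F i) (series_deriv s2 G (n - i)))"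
  proof -
    have "n - i + 1 = n + 1 - i" for i by simp
    then show ?thesis
      by (simp only: sum.distrib series_deriv_def bilinear_mapD(4)[OF f])
  qed
  also have "(\<Sum>i\<in>?S. f (F i) (series_deriv s2 G (n - i))) = conv f F (series_deriv s2 G) n"
  proof (rule conv_eq_sum[OF fa, symmetric])
    fix i assume "F i \<noteq> 0" "series_deriv s2 G (n - i) \<noteq> 0"
    moreover from this have "G (n - i + 1) \<noteq> 0" by (auto simp: series_deriv_def)
    ultimately show "i \<in> ?S" using M[of i] N[of "n - i + 1"] by auto
  qed simp
  also have "(\<Sum>i\<in>?S. s3 (of_int i) (f (F i) (G (n + 1 - i)))) =
      (\<Sum>i\<in>{n - N - 1..M - 1}. f (series_deriv s1 F i) (G (n - i)))"
    by (rule sum.reindex_bij_witness[where i = "\<lambda>i. i + 1" and j = "\<lambda>i. i - 1"])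
      (auto simp: series_deriv_def bilinear_mapD(3)[OF f] algebra_simps)
  also have "\<dots> = conv f (series_deriv s1 F) G n"
  proof (rule conv_eq_sum[OF fa, symmetric])
    fix i assume "series_deriv s1 F i \<noteq> 0" "G (n - i) \<noteq> 0"
    moreover from this have "F (i + 1) \<noteq> 0" by (auto simp: series_deriv_def)
    ultimately show "i \<in> {n - N - 1..M - 1}" using M[of "i + 1"] N[of "n - i"] by auto
  qed simp
  finally show ?thesis .
qed

lemma bounded_linear_image:
  assumes "Vector_Spaces.linear s s' f" "upper_bounded F"
  shows "upper_bounded (\<lambda>n. f (F n))"
  by (rule upper_bounded_mono[OF assms(2)]) (use linear_zero[OF assms(1)] in auto)

lemma bounded_bilinear_left:
  assumes "bilinear_map s1 s2 s3 f" "upper_bounded F"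
  shows "upper_bounded (\<lambda>n. f (F n) x)"
  by (rule upper_bounded_mono[OF assms(2)])
    (use biadditiveD(3)[OF bilinear_map_biadditive[OF assms(1)]] in auto)

lemma bounded_bilinear_right:
  assumes "bilinear_map s1 s2 s3 f" "upper_bounded F"
  shows "upper_bounded (\<lambda>n. f x (F n))"
  by (rule upper_bounded_mono[OF assms(2)])
    (use biadditiveD(4)[OF bilinear_map_biadditive[OF assms(1)]] in auto)

lemma bilinear_counit:
  assumes "Vector_Spaces.linear s (*) e"
  shows "bilinear_map s s s (\<lambda>a b. s (e a) b)" "bilinear_map s s s (\<lambda>a b. s (e b) a)"
proof -
  have vs: "vector_space s" by (rule linear_vector_space[OF assms])
  show "bilinear_map s s s (\<lambda>a b. s (e a) b)"
    by (intro bilinear_mapI linear_bilinear_left[OF bilinear_scale[OF vs]]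
        linear_bilinear_right[OF bilinear_scale[OF vs]] linear_ident vs assms)
  then show "bilinear_map s s s (\<lambda>a b. s (e b) a)"
    by (simp add: bilinear_map_def)
qed

section \<open>Expansions of series in two variables\<close>

text \<open>
  The coefficient of \<open>z\<^sup>m w\<^sup>n\<close> is stored at the index \<open>(n, m + n)\<close>.  The expansions of
  \<open>\<Sum> c i j l z\<^sup>i w\<^sup>j (z + w)\<^sup>l\<close> have no bound on \<open>m\<close>, but they are bounded above in these coordinates.
\<close>

definition two_var :: "(int \<Rightarrow> int \<Rightarrow> 'v) \<Rightarrow> int \<times> int \<Rightarrow> 'v" where
  "two_var U = (\<lambda>(n, d). U (d - n) n)"

lemma two_var_apply: "two_var U (n, d) = U (d - n) n"
  by (simp add: two_var_def)

lemma two_var_cong: "(\<And>m n. U m n = V m n) \<Longrightarrow> two_var U = two_var V"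
  by (simp add: two_var_def)

lemma upper_bounded_pairE:
  fixes A :: "int \<times> int \<Rightarrow> 'v::zero"
  assumes "upper_bounded A"
  obtains a b where "\<And>i e. A (i, e) \<noteq> 0 \<Longrightarrow> i \<le> a \<and> e \<le> b"
proof -
  obtain N where "\<And>x. A x \<noteq> 0 \<Longrightarrow> x \<le> N"
    using assms by (rule upper_boundedE) blast
  then have "A (i, e) \<noteq> 0 \<Longrightarrow> i \<le> fst N \<and> e \<le> snd N" for i e
    by (metis fst_conv snd_conv less_eq_prod_def)
  then show ?thesis using that by blast
qed

text \<open>Here \<open>\<phi> m\<close> is the coefficient of \<open>z^m\<close> in an inner
  coproduct, applied to the coefficients of a series in \<open>w\<close>. If the inner coproduct
  turns \<open>f\<close> into a product of series in \<open>z\<close>, the whole becomes a product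
  in two variables.\<close>

lemma two_var_conv:
  fixes F :: "int \<Rightarrow> 'a::ab_group_add" and G :: "int \<Rightarrow> 'b::ab_group_add"
    and \<phi> :: "int \<Rightarrow> 'c::ab_group_add \<Rightarrow> 'd::ab_group_add"
  assumes f: "biadditive f" and g: "biadditive g" and F: "upper_bounded F" and G: "upper_bounded G"
    and \<phi>: "\<And>m x y. \<phi> m (x + y) = \<phi> m x + \<phi> m y"
    and \<phi>1: "\<And>m. \<phi>1 m 0 = 0" and \<phi>2: "\<And>m. \<phi>2 m 0 = 0"
    and \<phi>f: "\<And>m a b. \<phi> m (f a b) = conv g (\<lambda>p. \<phi>1 p a) (\<lambda>q. \<phi>2 q b) m"
    and A: "upper_bounded (two_var (\<lambda>m n. \<phi>1 m (F n)))"
    and B: "upper_bounded (two_var (\<lambda>m n. \<phi>2 m (G n)))"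
  shows "two_var (\<lambda>m n. \<phi> m (conv f F G n)) =
    conv g (two_var (\<lambda>m n. \<phi>1 m (F n))) (two_var (\<lambda>m n. \<phi>2 m (G n)))" (is "_ = conv g ?A ?B")
proof
  fix x :: "int \<times> int"
  obtain n d where x: "x = (n, d)" by fastforce
  obtain M N where MN: "\<And>i. F i \<noteq> 0 \<Longrightarrow> i \<le> M" "\<And>i. G i \<noteq> 0 \<Longrightarrow> i \<le> N"
    using F G by (meson upper_boundedE)
  obtain a b where ab: "\<And>i e. ?A (i, e) \<noteq> 0 \<Longrightarrow> i \<le> a \<and> e \<le> b"
    using A by (rule upper_bounded_pairE) blast
  obtain a' b' where ab': "\<And>i e. ?B (i, e) \<noteq> 0 \<Longrightarrow> i \<le> a' \<and> e \<le> b'"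
    using B by (rule upper_bounded_pairE) blast
  have \<phi>_sum: "\<phi> m (sum h S) = (\<Sum>i\<in>S. \<phi> m (h i))" for m S and h :: "int \<Rightarrow> 'c"
  proof -
    have "\<phi> m 0 = 0" using \<phi>[of m 0 0] by simp
    then show ?thesis by (induction S rule: infinite_finite_induct) (simp_all add: \<phi>)
  qed
  have "two_var (\<lambda>m n. \<phi> m (conv f F G n)) x = \<phi> (d - n) (\<Sum>i\<in>{n - N..M}. f (F i) (G (n - i)))"
    by (simp add: x two_var_apply conv_eq_sum_interval[OF f MN])
  also have "\<dots> = (\<Sum>i\<in>{n - N..M}. \<Sum>p\<in>{d - b' - i..b - i}.
      g (\<phi>1 p (F i)) (\<phi>2 (d - n - p) (G (n - i))))"
    unfolding \<phi>_sum \<phi>f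
  proof (intro sum.cong refl conv_eq_sum[OF g])
    fix i p
    assume "\<phi>1 p (F i) \<noteq> 0" "\<phi>2 (d - n - p) (G (n - i)) \<noteq> 0"
    then show "p \<in> {d - b' - i..b - i}"
      using ab[of i "p + i"] ab'[of "n - i" "d - p - i"] by (simp add: two_var_apply algebra_simps)
  qed simp
  \<comment> \<open>\<open>e = p + i\<close> is the total degree of the left factor, its second
    coordinate.\<close>
  also have "\<dots> = (\<Sum>i\<in>{n - N..M}. \<Sum>e\<in>{d - b'..b}. g (?A (i, e)) (?B (n - i, d - e)))"
  proof (rule sum.cong[OF refl])
    fix i
    show "(\<Sum>p\<in>{d - b' - i..b - i}. g (\<phi>1 p (F i)) (\<phi>2 (d - n - p) (G (n - i)))) =
        (\<Sum>e\<in>{d - b'..b}. g (?A (i, e)) (?B (n - i, d - e)))"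
      by (rule sum.reindex_bij_witness[where i = "\<lambda>e. e - i" and j = "\<lambda>p. p + i"])
        (auto simp: two_var_apply algebra_simps)
  qed
  also have "\<dots> = (\<Sum>y\<in>{n - N..M} \<times> {d - b'..b}. g (?A y) (?B (x - y)))"
    by (simp add: sum.cartesian_product x case_prod_unfold minus_prod_def)
  also have "\<dots> = conv g ?A ?B x"
  proof (rule conv_eq_sum[OF g, symmetric])
    fix y assume nz: "?A y \<noteq> 0" "?B (x - y) \<noteq> 0"
    obtain i e where y: "y = (i, e)" by fastforce
    have "F i \<noteq> 0" "G (n - i) \<noteq> 0"
      using nz \<phi>1 \<phi>2 by (auto simp: y x two_var_apply)
    with MN have "i \<le> M" "n - i \<le> N" by blast+
    with nz show "y \<in> {n - N..M} \<times> {d - b'..b}"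
      unfolding y x by (auto dest!: ab ab')
  qed simp
  finally show "two_var (\<lambda>m n. \<phi> m (conv f F G n)) x = conv g ?A ?B x" .
qed

text \<open>The left factor is a series in \<open>z\<close> alone, so the product is taken in the
  first exponent with the second one fixed.\<close>

lemma conv_two_var_const_left:
  fixes R :: "int \<Rightarrow> 'a::ab_group_add" and V :: "int \<Rightarrow> int \<Rightarrow> 'b::ab_group_add"
  assumes g: "biadditive g" and R: "upper_bounded R" and V: "upper_bounded (two_var V)"
  shows "conv g (two_var (\<lambda>m n. if n = 0 then R m else 0)) (two_var V) =
    two_var (\<lambda>m n. conv g R (\<lambda>q. V q n) m)"
proof
  fix x :: "int \<times> int"
  obtain n d where x: "x = (n, d)" by fastforce
  obtain M where M: "\<And>i. R i \<noteq> 0 \<Longrightarrow> i \<le> M"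
    using R by (rule upper_boundedE) blast
  obtain a b where ab: "\<And>i e. two_var V (i, e) \<noteq> 0 \<Longrightarrow> i \<le> a \<and> e \<le> b"
    using V by (rule upper_bounded_pairE) blast
  let ?A = "two_var (\<lambda>m n. if n = 0 then R m else 0)"
  have "conv g ?A (two_var V) x = (\<Sum>y\<in>{0} \<times> {d - b..M}. g (?A y) (two_var V (x - y)))"
  proof (rule conv_eq_sum[OF g])
    fix y assume nz: "?A y \<noteq> 0" "two_var V (x - y) \<noteq> 0"
    obtain i e where y: "y = (i, e)" by fastforce
    show "y \<in> {0} \<times> {d - b..M}"
      using nz M[of "e - i"] ab[of "n - i" "d - e"] by (auto simp: y x two_var_apply split: if_splits)
  qed simp
  also have "\<dots> = (\<Sum>e\<in>{d - b..M}. g (?A (0, e)) (two_var V (n, d - e)))"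
    by (rule sum.reindex_bij_witness[where i = "\<lambda>e. (0, e)" and j = snd]) (auto simp: x)
  also have "\<dots> = (\<Sum>p\<in>{d - b..M}. g (R p) (V (d - n - p) n))"
    by (simp add: two_var_apply algebra_simps)
  also have "\<dots> = conv g R (\<lambda>q. V q n) (d - n)"
  proof (rule conv_eq_sum[OF g, symmetric])
    fix p assume "R p \<noteq> 0" "V (d - n - p) n \<noteq> 0"
    then show "p \<in> {d - b..M}"
      using M[of p] ab[of n "d - p"] by (simp add: two_var_apply algebra_simps)
  qed simp
  finally show "conv g ?A (two_var V) x = two_var (\<lambda>m n. conv g R (\<lambda>q. V q n) m) x"
    by (simp add: x two_var_apply)
qed

lemma conv_two_var_const_right:
  fixes R :: "int \<Rightarrow> 'b::ab_group_add" and V :: "int \<Rightarrow> int \<Rightarrow> 'a::ab_group_add"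
  assumes g: "biadditive g" and R: "upper_bounded R" and V: "upper_bounded (two_var V)"
  shows "conv g (two_var V) (two_var (\<lambda>m n. if m = 0 then R n else 0)) =
    two_var (\<lambda>m n. conv g (V m) R n)"
proof
  fix x :: "int \<times> int"
  obtain n d where x: "x = (n, d)" by fastforce
  obtain M where M: "\<And>i. R i \<noteq> 0 \<Longrightarrow> i \<le> M"
    using R by (rule upper_boundedE) blast
  obtain a b where ab: "\<And>i e. two_var V (i, e) \<noteq> 0 \<Longrightarrow> i \<le> a \<and> e \<le> b"
    using V by (rule upper_bounded_pairE) blast
  let ?B = "two_var (\<lambda>m n. if m = 0 then R n else 0)"
  \<comment> \<open>A factor in \<open>w\<close> alone leaves the exponent \<open>d - n\<close> of
    \<open>z\<close> unchanged, so the relevant pairs lie on a diagonal.\<close>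
  let ?h = "\<lambda>i. (i, d - n + i)"
  have "conv g (two_var V) ?B x = (\<Sum>y\<in>?h ` {n - M..a}. g (two_var V y) (?B (x - y)))"
  proof (rule conv_eq_sum[OF g])
    fix y assume nz: "two_var V y \<noteq> 0" "?B (x - y) \<noteq> 0"
    obtain i e where y: "y = (i, e)" by fastforce
    have "i \<le> a" using nz ab y by blast
    moreover have "d - e = n - i" "R (n - i) \<noteq> 0"
      using nz by (auto simp: y x two_var_apply split: if_splits)
    ultimately show "y \<in> ?h ` {n - M..a}"
      using M[of "n - i"] by (auto simp: y)
  qed simp
  also have "\<dots> = (\<Sum>i\<in>{n - M..a}. g (V (d - n) i) (R (n - i)))"
    by (subst sum.reindex) (auto simp: inj_on_def two_var_apply x)
  also have "\<dots> = conv g (V (d - n)) R n"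
  proof (rule conv_eq_sum[OF g, symmetric])
    fix i assume "V (d - n) i \<noteq> 0" "R (n - i) \<noteq> 0"
    then show "i \<in> {n - M..a}"
      using M[of "n - i"] ab[of i "d - n + i"] by (simp add: two_var_apply algebra_simps)
  qed simp
  finally show "conv g (two_var V) ?B x = two_var (\<lambda>m n. conv g (V m) R n) x"
    by (simp add: x two_var_apply)
qed

text \<open>
  \<open>taylor_expand s c C\<close> expands \<open>\<Sum> C (i, j, l) z\<^sup>i w\<^sup>j (w + c z)\<^sup>l\<close> in nonnegative powers of \<open>z\<close>.  Both
  expansions in the definition of weak coassociativity are of this form, the second one after a
  rotation of the three indices and with \<open>c = - 1\<close>.
\<close>

fun taylor_support :: "int \<times> int \<Rightarrow> int \<times> int \<times> int \<Rightarrow> bool" where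
  "taylor_support (n, d) (i, j, l) \<longleftrightarrow> i + n \<le> d \<and> i + j + l = d"

text \<open>The coefficient of \<open>z^(d - n) w^n\<close> in the monomial with exponents
  \<open>i\<close>, \<open>j\<close>, \<open>l\<close>: the power \<open>w + c z\<close> has to
  supply \<open>z^(d - n - i)\<close>.\<close>

fun taylor_kernel :: "'k::field_char_0 \<Rightarrow> int \<times> int \<Rightarrow> int \<times> int \<times> int \<Rightarrow> 'k" where
  "taylor_kernel c (n, d) (i, j, l) =
     (if taylor_support (n, d) (i, j, l)
      then c ^ nat (d - n - i) * (of_int l gchoose nat (d - n - i)) else 0)"

definition taylor_expand ::
  "('k::field_char_0 \<Rightarrow> 'v::ab_group_add \<Rightarrow> 'v) \<Rightarrow> 'k \<Rightarrow> (int \<times> int \<times> int \<Rightarrow> 'v) \<Rightarrow> int \<times> int \<Rightarrow> 'v"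
  where "taylor_expand s c C y = (\<Sum>x | C x \<noteq> 0 \<and> taylor_support y x. s (taylor_kernel c y x) (C x))"

lemma taylor_kernel_nonzeroD:
  assumes "taylor_kernel c (n, d) (i, j, l) \<noteq> 0"
  shows "i + n \<le> d" "i + j + l = d"
  using assms by (auto split: if_splits)

lemma taylor_kernel_support: "taylor_kernel c y x \<noteq> 0 \<Longrightarrow> taylor_support y x"
  by (cases y; cases x) (auto split: if_splits)

lemma taylor_expand_eq_sum:
  assumes "vector_space s" "finite S" "\<And>x. C x \<noteq> 0 \<Longrightarrow> taylor_support y x \<Longrightarrow> x \<in> S"
  shows "taylor_expand s c C y = (\<Sum>x\<in>S. s (taylor_kernel c y x) (C x))"
proof -
  interpret vector_space s by fact
  have "s (taylor_kernel c y x) (C x) = 0" if "\<not> (C x \<noteq> 0 \<and> taylor_support y x)" for x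
    using that taylor_kernel_support[of c y x] by auto
  then show ?thesis unfolding taylor_expand_def
    using assms(2,3) by (intro sum.mono_neutral_left) auto
qed

lemma upper_bounded_tripleE:
  fixes C :: "int \<times> int \<times> int \<Rightarrow> 'v::zero"
  assumes "upper_bounded C"
  obtains N where "N \<ge> 0" "\<And>i j l. C (i, j, l) \<noteq> 0 \<Longrightarrow> i \<le> N \<and> j \<le> N \<and> l \<le> N"
proof -
  obtain M where "\<And>x. C x \<noteq> 0 \<Longrightarrow> x \<le> M"
    using assms by (rule upper_boundedE) blast
  moreover obtain a b c where "M = (a, b, c)" using prod_cases3 by blast
  ultimately have "C (i, j, l) \<noteq> 0 \<Longrightarrow> i \<le> a \<and> j \<le> b \<and> l \<le> c" for i j l
    by (metis fst_conv snd_conv less_eq_prod_def)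
  then show ?thesis
    by (intro that[of "max 0 (max a (max b c))"]) (auto simp: le_max_iff_disj)
qed

lemma taylor_expand_nonzeroE:
  assumes "taylor_expand s c C (n, d) \<noteq> 0"
  obtains i j l where "C (i, j, l) \<noteq> 0" "i + n \<le> d" "i + j + l = d"
proof -
  have "{x. C x \<noteq> 0 \<and> taylor_support (n, d) x} \<noteq> {}"
    using assms unfolding taylor_expand_def by (metis sum.empty)
  then obtain x where "C x \<noteq> 0" "taylor_support (n, d) x" by blast
  then show ?thesis using that by (cases x) auto
qed

lemma upper_bounded_taylor_expand:
  assumes "upper_bounded C"
  shows "upper_bounded (taylor_expand s c C)"
proof -
  obtain N where N: "\<And>i j l. C (i, j, l) \<noteq> 0 \<Longrightarrow> i \<le> N \<and> j \<le> N \<and> l \<le> N"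
    using assms by (rule upper_bounded_tripleE) blast
  \<comment> \<open>On the support \<open>n \<le> d - i = j + l\<close> and
    \<open>d = i + j + l\<close>.\<close>
  have "(n, d) \<le> (2 * N, 3 * N)" if nz: "taylor_expand s c C (n, d) \<noteq> 0" for n d
    using nz by (rule taylor_expand_nonzeroE) (drule N, simp)
  then show ?thesis unfolding upper_bounded_def by (metis surj_pair)
qed

text \<open>The product of the powers \<open>l\<close> and \<open>l'\<close> of
  \<open>w + c z\<close> is the power \<open>l + l'\<close>; coefficientwise this is Vandermonde's
  identity, and it makes the expansion multiplicative.\<close>

lemma sum_taylor_kernel:
  fixes c :: "'k::field_char_0"
  assumes "finite Y"
    and "\<And>y1. taylor_kernel c y1 x1 \<noteq> 0 \<Longrightarrow> taylor_kernel c (y - y1) x2 \<noteq> 0 \<Longrightarrow> y1 \<in> Y"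
  shows "(\<Sum>y1\<in>Y. taylor_kernel c y1 x1 * taylor_kernel c (y - y1) x2) = taylor_kernel c y (x1 + x2)"
proof -
  obtain n d where y: "y = (n, d)" by fastforce
  obtain i j l where x1: "x1 = (i, j, l)" by (rule prod_cases3)
  obtain i' j' l' where x2: "x2 = (i', j', l')" by (rule prod_cases3)
  let ?t = "\<lambda>y1. taylor_kernel c y1 x1 * taylor_kernel c (y - y1) x2"
  show ?thesis
  proof (cases "i + i' + n \<le> d \<and> i + j + l + i' + j' + l' = d")
    case False
    have "?t y1 = 0" for y1
    proof (rule ccontr)
      obtain n1 d1 where y1: "y1 = (n1, d1)" by fastforce
      assume "?t y1 \<noteq> 0"
      then have "taylor_kernel c (n1, d1) (i, j, l) \<noteq> 0"
        "taylor_kernel c (n - n1, d - d1) (i', j', l') \<noteq> 0"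
        by (simp_all add: y y1 x1 x2)
      then show False using taylor_kernel_nonzeroD False by smt
    qed
    moreover have "taylor_kernel c y (x1 + x2) = 0"
      using False by (auto simp: y x1 x2)
    ultimately show ?thesis by (simp only: sum.neutral_const)
  next
    case True
    define q where "q = nat (d - n - i - i')"
    \<comment> \<open>\<open>h k\<close> is the index at which the first factor supplies
      \<open>z^k\<close> from its power of \<open>w + c z\<close>: its total degree is
      \<open>i + j + l\<close>, its exponent of \<open>z\<close> is \<open>i + k\<close>, and
      \<open>j + l - k\<close> remains for \<open>w\<close>.\<close>
    define h where "h k = (j + l - int k, i + j + l)" for k :: nat
    have inj: "inj_on h {0..q}" by (auto simp: inj_on_def h_def)
    have nz: "y1 \<in> h ` {0..q}" if "?t y1 \<noteq> 0" for y1
    proof -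
      obtain n1 d1 where y1: "y1 = (n1, d1)" by fastforce
      have "taylor_kernel c (n1, d1) (i, j, l) \<noteq> 0"
        "taylor_kernel c (n - n1, d - d1) (i', j', l') \<noteq> 0"
        using that by (simp_all add: y y1 x1 x2)
      from taylor_kernel_nonzeroD[OF this(1)] taylor_kernel_nonzeroD[OF this(2)]
      have "d1 = i + j + l" "n1 \<le> j + l" "i' + n - n1 \<le> d - d1" by auto
      then have "y1 = h (nat (j + l - n1))" "nat (j + l - n1) \<le> q"
        using True by (auto simp: h_def y1 q_def)
      then show ?thesis by auto
    qed
    have "(\<Sum>y1\<in>Y. ?t y1) = (\<Sum>y1\<in>Y \<union> h ` {0..q}. ?t y1)"
      using assms(1,2) by (intro sum.mono_neutral_left) auto
    also have "\<dots> = (\<Sum>y1\<in>h ` {0..q}. ?t y1)"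
      using assms(1) nz by (intro sum.mono_neutral_right) blast+
    also have "\<dots> = (\<Sum>k\<in>{0..q}. ?t (h k))"
      by (rule sum.reindex[OF inj, unfolded o_def])
    also have "\<dots> = (\<Sum>k\<in>{0..q}. c ^ q * ((of_int l gchoose k) * (of_int l' gchoose (q - k))))"
    proof (rule sum.cong[OF refl])
      fix k assume k: "k \<in> {0..q}"
      have k': "int k \<le> d - n - i - i'" using k conjunct1[OF True] by (simp add: q_def le_nat_iff)
      have "nat (i + j + l - (j + l - int k) - i) = k" by simp
      moreover have "nat ((d - (i + j + l)) - (n - (j + l - int k)) - i') = q - k"
        using k conjunct1[OF True] by (simp add: q_def le_nat_iff)
      moreover have "i' + (n - (j + l - int k)) \<le> d - (i + j + l)"
        using k' by simp
      ultimately have "?t (h k) =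
          (c ^ k * (of_int l gchoose k)) * (c ^ (q - k) * (of_int l' gchoose (q - k)))"
        using True by (simp add: h_def y x1 x2)
      also have "c ^ k * c ^ (q - k) = c ^ q"
        using k by (simp flip: power_add)
      then have "(c ^ k * (of_int l gchoose k)) * (c ^ (q - k) * (of_int l' gchoose (q - k))) =
          c ^ q * ((of_int l gchoose k) * (of_int l' gchoose (q - k)))"
        by (simp add: algebra_simps)
      finally show "?t (h k) = c ^ q * ((of_int l gchoose k) * (of_int l' gchoose (q - k)))" .
    qed
    also have "\<dots> = c ^ q * ((of_int l + of_int l') gchoose q)"
      by (simp add: gbinomial_Vandermonde flip: sum_distrib_left)
    also have "\<dots> = taylor_kernel c y (x1 + x2)"
      using True by (simp add: y x1 x2 q_def diff_diff_eq algebra_simps)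
    finally show ?thesis .
  qed
qed

text \<open>Once every sum has been put on a finite window, the sums are interchanged and
  \<open>sum_taylor_kernel\<close> separates the kernels of the two factors.\<close>

lemma taylor_expand_conv:
  assumes f: "bilinear_map s1 s2 s3 f" and C: "upper_bounded C" and D: "upper_bounded D"
  shows "taylor_expand s3 c (conv f C D) = conv f (taylor_expand s1 c C) (taylor_expand s2 c D)"
proof
  fix y :: "int \<times> int"
  obtain n d where y: "y = (n, d)" by fastforce
  note vs = bilinear_mapD(5-7)[OF f]
  interpret s3: vector_space s3 by (rule vs)
  note fa = bilinear_map_biadditive[OF f]
  obtain N1 where N1: "\<And>i j l. C (i, j, l) \<noteq> 0 \<Longrightarrow> i \<le> N1 \<and> j \<le> N1 \<and> l \<le> N1"
    using C by (rule upper_bounded_tripleE) blast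
  obtain N2 where N2: "N2 \<ge> 0" "\<And>i j l. D (i, j, l) \<noteq> 0 \<Longrightarrow> i \<le> N2 \<and> j \<le> N2 \<and> l \<le> N2"
    using D by (rule upper_bounded_tripleE) blast
  define N where "N = max N1 N2"
  have N: "C (i, j, l) \<noteq> 0 \<Longrightarrow> i \<le> N \<and> j \<le> N \<and> l \<le> N"
    "D (i, j, l) \<noteq> 0 \<Longrightarrow> i \<le> N \<and> j \<le> N \<and> l \<le> N" for i j l
    using N1[of i j l] N2(2)[of i j l] by (auto simp: N_def)
  \<comment> \<open>Six exponents, each at most \<open>N\<close>, add up to \<open>d\<close>, so
    each is at least \<open>d - 5 * N\<close>. The same bound follows from \<open>Y\<close>: three
    exponents at most \<open>N\<close> add up to at least \<open>d - 3 * N\<close>.\<close>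
  define P where "P = {d - 5 * N..N} \<times> {d - 5 * N..N} \<times> {d - 5 * N..N}"
  define Y where "Y = {n - 2 * N..2 * N} \<times> {d - 3 * N..3 * N}"
  have fin: "finite P" "finite Y" by (simp_all add: P_def Y_def)
  define Q where "Q = (\<lambda>(x1, x2). x1 + x2) ` (P \<times> P)"
  have finQ: "finite Q" using fin by (simp add: Q_def)
  define K where "K = taylor_kernel c"
  define E where "E = taylor_support"
  have K: "E (n, d) (i, j, l) \<Longrightarrow> i + n \<le> d \<and> i + j + l = d" for n d i j l
    by (simp add: E_def)
  have KE: "K y x \<noteq> 0 \<Longrightarrow> E y x" for x y
    unfolding K_def E_def by (rule taylor_kernel_support)
  have inP: "x1 \<in> P \<and> x2 \<in> P" if "C x1 \<noteq> 0" "D x2 \<noteq> 0" "E y (x1 + x2)" for x1 x2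
  proof -
    obtain i j l i' j' l' where x: "x1 = (i, j, l)" "x2 = (i', j', l')" by (metis prod_cases3)
    have "i + i' + (j + j') + (l + l') = d"
      using that(3) K[of n d "i + i'" "j + j'" "l + l'"] by (simp add: x y)
    moreover have "i \<le> N \<and> j \<le> N \<and> l \<le> N" "i' \<le> N \<and> j' \<le> N \<and> l' \<le> N"
      using that N by (auto simp: x)
    ultimately show ?thesis by (auto simp: x P_def)
  qed
  have inP1: "x1 \<in> P" if "C x1 \<noteq> 0" "y1 \<in> Y" "E y1 x1" for x1 y1
  proof -
    obtain i j l n1 d1 where x: "x1 = (i, j, l)" "y1 = (n1, d1)" by (metis prod_cases3 surj_pair)
    then show ?thesis
      using that K[of n1 d1 i j l] N(1)[of i j l] by (auto simp: P_def Y_def)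
  qed
  have inP2: "x1 \<in> P" if "D x1 \<noteq> 0" "y1 \<in> Y" "E (y - y1) x1" for x1 y1
  proof -
    obtain i j l n1 d1 where x: "x1 = (i, j, l)" "y1 = (n1, d1)" by (metis prod_cases3 surj_pair)
    then show ?thesis
      using that K[of "n - n1" "d - d1" i j l] N(2)[of i j l] by (auto simp: P_def Y_def y)
  qed
  have inY: "y1 \<in> Y" if "C x1 \<noteq> 0" "D x2 \<noteq> 0" "E y1 x1" "E (y - y1) x2" for x1 x2 y1
  proof -
    obtain i j l i' j' l' where x: "x1 = (i, j, l)" "x2 = (i', j', l')" by (metis prod_cases3)
    obtain n1 d1 where y1: "y1 = (n1, d1)" by fastforce
    show ?thesis
      using that K[of n1 d1 i j l] K[of "n - n1" "d - d1" i' j' l'] N(1)[of i j l] N(2)[of i' j' l']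
      by (auto simp: x y1 y Y_def)
  qed
  have "taylor_expand s3 c (conv f C D) y = (\<Sum>x\<in>Q. s3 (K y x) (conv f C D x))"
    unfolding K_def
  proof (rule taylor_expand_eq_sum[OF vs(3) finQ])
    fix x assume nz: "conv f C D x \<noteq> 0" "taylor_support y x"
    from nz(1) obtain x1 x2 where x: "C x1 \<noteq> 0" "D x2 \<noteq> 0" "x = x1 + x2"
      by (rule conv_nonzeroE)
    then have "x1 \<in> P \<and> x2 \<in> P" using nz(2) inP by (simp add: E_def)
    then show "x \<in> Q" using x by (auto simp: Q_def)
  qed
  also have "\<dots> = (\<Sum>x\<in>Q. \<Sum>x1\<in>P. s3 (K y x) (f (C x1) (D (x - x1))))"
  proof (rule sum.cong[OF refl])
    fix x
    show "s3 (K y x) (conv f C D x) = (\<Sum>x1\<in>P. s3 (K y x) (f (C x1) (D (x - x1))))"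
    proof (cases "K y x = 0")
      case False
      have "conv f C D x = (\<Sum>x1\<in>P. f (C x1) (D (x - x1)))"
      proof (rule conv_eq_sum[OF fa fin(1)])
        fix x1 assume "C x1 \<noteq> 0" "D (x - x1) \<noteq> 0"
        then show "x1 \<in> P" using inP[of x1 "x - x1"] False KE by simp
      qed
      then show ?thesis by (simp add: s3.scale_sum_right)
    qed simp
  qed
  also have "\<dots> = (\<Sum>x1\<in>P. \<Sum>x\<in>Q. s3 (K y x) (f (C x1) (D (x - x1))))"
    by (rule sum.swap)
  also have "\<dots> = (\<Sum>x1\<in>P. \<Sum>x2\<in>P. s3 (K y (x1 + x2)) (f (C x1) (D x2)))"
  proof (rule sum.cong[OF refl])
    fix x1 assume x1: "x1 \<in> P"
    let ?u = "\<lambda>x. s3 (K y x) (f (C x1) (D (x - x1)))"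
    have "(\<Sum>x\<in>Q. ?u x) = (\<Sum>x\<in>(\<lambda>x2. x1 + x2) ` P. ?u x)"
    proof (rule sum.mono_neutral_right[OF finQ])
      show "(\<lambda>x2. x1 + x2) ` P \<subseteq> Q" using x1 by (auto simp: Q_def)
      show "\<forall>x\<in>Q - (\<lambda>x2. x1 + x2) ` P. ?u x = 0"
      proof
        fix x assume "x \<in> Q - (\<lambda>x2. x1 + x2) ` P"
        then have "x - x1 \<notin> P" by (metis DiffD2 add_diff_cancel_left' diff_add_cancel image_eqI add.commute)
        then show "?u x = 0"
          using inP[of x1 "x - x1"] KE[of y x]
          by (cases "K y x = 0"; cases "C x1 = 0"; cases "D (x - x1) = 0"; simp add: biadditiveD[OF fa])
      qed
    qed
    also have "\<dots> = (\<Sum>x2\<in>P. s3 (K y (x1 + x2)) (f (C x1) (D x2)))"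
      by (subst sum.reindex) auto
    finally show "(\<Sum>x\<in>Q. ?u x) = (\<Sum>x2\<in>P. s3 (K y (x1 + x2)) (f (C x1) (D x2)))" .
  qed
  \<comment> \<open>Vandermonde's identity, applied only where both coefficients are nonzero;
    elsewhere both sides vanish.\<close>
  also have "\<dots> = (\<Sum>x1\<in>P. \<Sum>x2\<in>P. \<Sum>y1\<in>Y. s3 (K y1 x1 * K (y - y1) x2) (f (C x1) (D x2)))"
  proof (intro sum.cong refl)
    fix x1 x2
    show "s3 (K y (x1 + x2)) (f (C x1) (D x2)) =
        (\<Sum>y1\<in>Y. s3 (K y1 x1 * K (y - y1) x2) (f (C x1) (D x2)))"
    proof (cases "C x1 = 0 \<or> D x2 = 0")
      case False
      then have "K y (x1 + x2) = (\<Sum>y1\<in>Y. K y1 x1 * K (y - y1) x2)"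
        unfolding K_def
        by (intro sum_taylor_kernel[symmetric] fin) (auto intro: inY KE[unfolded K_def])
      then show ?thesis by (simp add: s3.scale_sum_left)
    qed (auto simp: biadditiveD[OF fa])
  qed
  also have "\<dots> = (\<Sum>y1\<in>Y. \<Sum>x1\<in>P. \<Sum>x2\<in>P. s3 (K y1 x1 * K (y - y1) x2) (f (C x1) (D x2)))"
    by (subst (2) sum.swap, subst sum.swap) (rule refl)
  also have "\<dots> = (\<Sum>y1\<in>Y. f (taylor_expand s1 c C y1) (taylor_expand s2 c D (y - y1)))"
  proof (rule sum.cong[OF refl])
    fix y1 assume y1: "y1 \<in> Y"
    have e: "taylor_expand s1 c C y1 = (\<Sum>x1\<in>P. s1 (K y1 x1) (C x1))"
      "taylor_expand s2 c D (y - y1) = (\<Sum>x2\<in>P. s2 (K (y - y1) x2) (D x2))"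
      unfolding K_def
      by (intro taylor_expand_eq_sum vs fin; use inP1[OF _ y1] inP2[OF _ y1] in \<open>simp add: E_def\<close>)+
    show "(\<Sum>x1\<in>P. \<Sum>x2\<in>P. s3 (K y1 x1 * K (y - y1) x2) (f (C x1) (D x2))) =
        f (taylor_expand s1 c C y1) (taylor_expand s2 c D (y - y1))"
      unfolding e biadditive_sum(1)[OF fa] biadditive_sum(2)[OF fa]
      by (subst sum.swap) (simp add: bilinear_mapD(3,4)[OF f] mult.commute)
  qed
  also have "\<dots> = conv f (taylor_expand s1 c C) (taylor_expand s2 c D) y"
  proof (rule conv_eq_sum[OF fa fin(2), symmetric])
    fix y1 assume nz: "taylor_expand s1 c C y1 \<noteq> 0" "taylor_expand s2 c D (y - y1) \<noteq> 0"
    obtain n1 d1 where y1: "y1 = (n1, d1)" by fastforce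
    obtain i j l where 1: "C (i, j, l) \<noteq> 0" "i + n1 \<le> d1" "i + j + l = d1"
      using nz(1) unfolding y1 by (rule taylor_expand_nonzeroE)
    have "taylor_expand s2 c D (n - n1, d - d1) \<noteq> 0" using nz(2) by (simp add: y y1)
    then obtain i' j' l' where 2: "D (i', j', l') \<noteq> 0" "i' + (n - n1) \<le> d - d1" "i' + j' + l' = d - d1"
      by (rule taylor_expand_nonzeroE)
    show "y1 \<in> Y"
      using 1 2 N(1)[OF 1(1)] N(2)[OF 2(1)] by (auto simp: y1 Y_def)
  qed
  finally show "taylor_expand s3 c (conv f C D) y =
      conv f (taylor_expand s1 c C) (taylor_expand s2 c D) y" .
qed

section \<open>The two expansions of weak coassociativity\<close>

lemma expand_z_w_eq: "expand_z_w s c m n = taylor_expand s 1 (\<lambda>(i, j, l). c i j l) (n, m + n)"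
  unfolding expand_z_w_def taylor_expand_def by (rule sum.cong) auto

text \<open>Now \<open>w\<close>, \<open>u\<close> and \<open>z = u - w\<close> take the roles of
  \<open>z\<close>, \<open>w\<close> and \<open>w + c z\<close>, which accounts for the order
  \<open>(j, l, i)\<close> and for \<open>c = - 1\<close>.\<close>

lemma expand_w_u_eq: "expand_w_u s c n p = taylor_expand s (- 1) (\<lambda>(j, l, i). c i j l) (p, n + p)"
  unfolding expand_w_u_def taylor_expand_def
  by (rule sum.reindex_bij_witness[where i = "\<lambda>(j, l, i). (i, j, l)" and j = "\<lambda>(i, j, l). (j, l, i)"])
    (auto simp: algebra_simps)

lemma bounded_support_iff:
  "bounded_support c \<longleftrightarrow> upper_bounded (\<lambda>(i, j, l). c i j l)" for c :: "int \<Rightarrow> int \<Rightarrow> int \<Rightarrow> 'v::zero"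
proof
  assume "upper_bounded (\<lambda>(i, j, l). c i j l)"
  then show "bounded_support c"
    unfolding bounded_support_def by (rule upper_bounded_tripleE) (metis case_prod_conv)
next
  assume "bounded_support c"
  then obtain N where "\<And>i j l. c i j l \<noteq> 0 \<Longrightarrow> i \<le> N \<and> j \<le> N \<and> l \<le> N"
    unfolding bounded_support_def by blast
  then show "upper_bounded (\<lambda>(i, j, l). c i j l)"
    unfolding upper_bounded_def by (intro exI[of _ "(N, N, N)"]) auto
qed

definition rotate_index :: "(int \<times> int \<times> int \<Rightarrow> 'v) \<Rightarrow> int \<times> int \<times> int \<Rightarrow> 'v" where
  "rotate_index C = (\<lambda>(j, l, i). C (i, j, l))"

text \<open>Rotation is an automorphism of the index group, so it respects products.\<close>

lemma rotate_index_conv: "rotate_index (conv f C D) = conv f (rotate_index C) (rotate_index D)"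
proof
  fix x :: "int \<times> int \<times> int"
  show "rotate_index (conv f C D) x = conv f (rotate_index C) (rotate_index D) x"
    unfolding rotate_index_def conv_def case_prod_unfold
    by (rule sum.reindex_bij_witness[
          where j = "\<lambda>((i, j, l), (i', j', l')). ((j, l, i), (j', l', i'))"
            and i = "\<lambda>((j, l, i), (j', l', i')). ((i, j, l), (i', j', l'))"]) auto
qed

lemma upper_bounded_rotate_index:
  assumes "upper_bounded C"
  shows "upper_bounded (rotate_index C)"
proof -
  obtain N where "\<And>i j l. C (i, j, l) \<noteq> 0 \<Longrightarrow> i \<le> N \<and> j \<le> N \<and> l \<le> N"
    using assms by (rule upper_bounded_tripleE) blast
  then show ?thesis
    unfolding upper_bounded_def by (intro exI[of _ "(N, N, N)"]) (auto simp: rotate_index_def)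
qed

text \<open>The three embeddings view a series in one variable as a series in \<open>z\<close>, in
  \<open>w\<close> or in \<open>z + w\<close>. They are the factors from which the common series are
  built.\<close>

definition on_first :: "(int \<Rightarrow> 'v::zero) \<Rightarrow> int \<times> int \<times> int \<Rightarrow> 'v" where
  "on_first F = (\<lambda>(i, j, l). if j = 0 \<and> l = 0 then F i else 0)"

definition on_second :: "(int \<Rightarrow> 'v::zero) \<Rightarrow> int \<times> int \<times> int \<Rightarrow> 'v" where
  "on_second F = (\<lambda>(i, j, l). if i = 0 \<and> l = 0 then F j else 0)"

definition on_third :: "(int \<Rightarrow> 'v::zero) \<Rightarrow> int \<times> int \<times> int \<Rightarrow> 'v" where
  "on_third F = (\<lambda>(i, j, l). if i = 0 \<and> j = 0 then F l else 0)"

lemma rotate_index_on: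
  "rotate_index (on_first F) = on_third F" "rotate_index (on_second F) = on_first F"
  "rotate_index (on_third F) = on_second F"
  by (auto simp: rotate_index_def on_first_def on_second_def on_third_def)

lemma upper_bounded_on:
  fixes F :: "int \<Rightarrow> 'v::zero"
  assumes "upper_bounded F"
  shows "upper_bounded (on_first F)" "upper_bounded (on_second F)" "upper_bounded (on_third F)"
proof -
  obtain N where N: "\<And>i. F i \<noteq> 0 \<Longrightarrow> i \<le> N" using assms by (rule upper_boundedE) blast
  show "upper_bounded (on_first F)" unfolding upper_bounded_def
    by (rule exI[of _ "(N, 0, 0)"]) (auto simp: on_first_def N split: if_splits)
  show "upper_bounded (on_second F)" unfolding upper_bounded_def
    by (rule exI[of _ "(0, N, 0)"]) (auto simp: on_second_def N split: if_splits)
  show "upper_bounded (on_third F)" unfolding upper_bounded_def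
    by (rule exI[of _ "(0, 0, N)"]) (auto simp: on_third_def N split: if_splits)
qed

lemma taylor_expand_single:
  assumes "vector_space s" "\<And>x. C x \<noteq> 0 \<Longrightarrow> taylor_support y x \<Longrightarrow> x = x0"
  shows "taylor_expand s c C y = s (taylor_kernel c y x0) (C x0)"
  using taylor_expand_eq_sum[OF assms(1), of "{x0}" C y c] assms(2) by auto

lemma taylor_expand_on_first:
  assumes "vector_space s"
  shows "taylor_expand s c (on_first F) = two_var (\<lambda>m n. if n = 0 then F m else 0)"
proof
  interpret vector_space s by fact
  fix y :: "int \<times> int"
  obtain n d where y: "y = (n, d)" by fastforce
  have "taylor_expand s c (on_first F) y = s (taylor_kernel c y (d, 0, 0)) (on_first F (d, 0, 0))"
    by (rule taylor_expand_single[OF assms]) (auto simp: on_first_def y split: if_splits)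
  also have "\<dots> = two_var (\<lambda>m n. if n = 0 then F m else 0) y"
    by (auto simp: y two_var_apply on_first_def gbinomial_0_left)
  finally show "taylor_expand s c (on_first F) y = two_var (\<lambda>m n. if n = 0 then F m else 0) y" .
qed

lemma taylor_expand_on_second:
  assumes "vector_space s"
  shows "taylor_expand s c (on_second F) = two_var (\<lambda>m n. if m = 0 then F n else 0)"
proof
  interpret vector_space s by fact
  fix y :: "int \<times> int"
  obtain n d where y: "y = (n, d)" by fastforce
  have "taylor_expand s c (on_second F) y = s (taylor_kernel c y (0, d, 0)) (on_second F (0, d, 0))"
    by (rule taylor_expand_single[OF assms]) (auto simp: on_second_def y split: if_splits)
  also have "\<dots> = two_var (\<lambda>m n. if m = 0 then F n else 0) y"
    by (auto simp: y two_var_apply on_second_def gbinomial_0_left)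
  finally show "taylor_expand s c (on_second F) y = two_var (\<lambda>m n. if m = 0 then F n else 0) y" .
qed

text \<open>A series in the third variable is the case with binomial coefficients, and it yields the
  \<open>taylor_coeff\<close> of the hexagon relations. Negative powers of \<open>z\<close> do not
  occur.\<close>

lemma taylor_expand_on_third:
  assumes "vector_space s"
  shows "taylor_expand s c (on_third F) =
    two_var (\<lambda>m n. if m < 0 then 0 else taylor_coeff s c (nat m) F n)"
proof
  interpret vector_space s by fact
  fix y :: "int \<times> int"
  obtain n d where y: "y = (n, d)" by fastforce
  have "taylor_expand s c (on_third F) y = s (taylor_kernel c y (0, 0, d)) (on_third F (0, 0, d))"
    by (rule taylor_expand_single[OF assms]) (auto simp: on_third_def y split: if_splits)
  also have "\<dots> = two_var (\<lambda>m n. if m < 0 then 0 else taylor_coeff s c (nat m) F n) y"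
    by (auto simp: y two_var_apply on_third_def taylor_coeff_def)
  finally show "taylor_expand s c (on_third F) y =
    two_var (\<lambda>m n. if m < 0 then 0 else taylor_coeff s c (nat m) F n) y" .
qed

lemma taylor_expand_add:
  assumes "vector_space s" and C: "upper_bounded C" and D: "upper_bounded D"
  shows "taylor_expand s c (\<lambda>x. C x + D x) y = taylor_expand s c C y + taylor_expand s c D y"
proof -
  interpret vector_space s by fact
  have fin: "finite {x. F x \<noteq> 0 \<and> taylor_support y x}" if F: "upper_bounded F" for F :: "int \<times> int \<times> int \<Rightarrow> 'b"
  proof -
    obtain n d where y: "y = (n, d)" by fastforce
    obtain N where N: "\<And>i j l. F (i, j, l) \<noteq> 0 \<Longrightarrow> i \<le> N \<and> j \<le> N \<and> l \<le> N"
      using F by (rule upper_bounded_tripleE) blast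
    have "{x. F x \<noteq> 0 \<and> taylor_support y x} \<subseteq> {d - 2 * N..N} \<times> {d - 2 * N..N} \<times> {d - 2 * N..N}"
      by (auto simp: y dest!: N)
    then show ?thesis by (rule finite_subset) simp
  qed
  let ?S = "{x. C x \<noteq> 0 \<and> taylor_support y x} \<union> {x. D x \<noteq> 0 \<and> taylor_support y x}"
  have S: "finite ?S" using fin[OF C] fin[OF D] by simp
  have e: "taylor_expand s c F y = (\<Sum>x\<in>?S. s (taylor_kernel c y x) (F x))"
    if "\<And>x. F x \<noteq> 0 \<Longrightarrow> C x \<noteq> 0 \<or> D x \<noteq> 0" for F
    by (rule taylor_expand_eq_sum[OF assms(1) S]) (use that in blast)
  have "taylor_expand s c (\<lambda>x. C x + D x) y = (\<Sum>x\<in>?S. s (taylor_kernel c y x) (C x + D x))"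
    by (rule e) auto
  moreover have "taylor_expand s c C y = (\<Sum>x\<in>?S. s (taylor_kernel c y x) (C x))"
    "taylor_expand s c D y = (\<Sum>x\<in>?S. s (taylor_kernel c y x) (D x))"
    by (rule e, simp)+
  ultimately show ?thesis
    by (simp only: scale_right_distrib sum.distrib)
qed

lemma upper_bounded_taylor_coeff:
  assumes "vector_space s" "upper_bounded F"
  shows "upper_bounded (taylor_coeff s c m F)"
proof -
  interpret vector_space s by fact
  obtain N where N: "\<And>i. F i \<noteq> 0 \<Longrightarrow> i \<le> N" using assms(2) by (rule upper_boundedE) blast
  have "p \<le> N" if "taylor_coeff s c m F p \<noteq> 0" for p
    using that N[of "p + int m"] by (auto simp: taylor_coeff_def)
  then show ?thesis unfolding upper_bounded_def by blast
qed

section \<open>Divided powers and the coproduct of \<open>H\<close>\<close>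

text \<open>The coefficient of \<open>z^n\<close> in the exponential of \<open>z T\<close>.
  Extending it by 0 to negative \<open>n\<close> lets it enter \<open>conv\<close> as a series over
  \<open>int\<close>.\<close>

definition divided_power ::
  "('k::field_char_0 \<Rightarrow> 'v::ab_group_add \<Rightarrow> 'v) \<Rightarrow> ('v \<Rightarrow> 'v) \<Rightarrow> int \<Rightarrow> 'v \<Rightarrow> 'v" where
  "divided_power s T n x = (if n < 0 then 0 else s (1 / fact (nat n)) ((T ^^ nat n) x))"

lemma linear_funpow:
  assumes "Vector_Spaces.linear s s T"
  shows "Vector_Spaces.linear s s (T ^^ n)"
proof (induction n)
  case 0
  show ?case using assms by (simp add: linear_iff)
next
  case (Suc n)
  then show ?case using assms by (simp add: linear_iff)
qed

lemma linear_divided_power: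
  assumes "Vector_Spaces.linear s s T"
  shows "Vector_Spaces.linear s s (divided_power s T n)"
proof -
  interpret vector_space s by (rule linear_vector_space[OF assms])
  show ?thesis
    using linear_funpow[OF assms, of "nat n"]
    by (simp add: linear_iff divided_power_def scale_right_distrib mult.commute)
qed

context
  fixes s :: "'k::field_char_0 \<Rightarrow> 'v::ab_group_add \<Rightarrow> 'v" and T
  assumes T: "Vector_Spaces.linear s s T"
begin

interpretation vector_space s by (rule linear_vector_space[OF T])

lemma divided_power_zero [simp]: "divided_power s T 0 x = x"
  by (simp add: divided_power_def)

lemma divided_power_neg [simp]: "n < 0 \<Longrightarrow> divided_power s T n x = 0"
  by (simp add: divided_power_def)

lemma divided_power_apply:
  "divided_power s T n (T x) = s (of_int (n + 1)) (divided_power s T (n + 1) x)"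
proof (cases "n < 0")
  case True
  \<comment> \<open>At \<open>n = -1\<close> the power on the right is \<open>x\<close> itself, but
    its factor \<open>n + 1\<close> is 0.\<close>
  then show ?thesis by (cases "n = -1") (simp_all add: divided_power_def)
next
  case False
  then obtain k where n: "n = int k" by (metis nat_eq_iff2 not_less)
  have "(1 / fact k :: 'k) = of_int (int k + 1) * (1 / fact (Suc k))"
    using of_nat_neq_0[of k, where 'a = 'k] by (simp add: add.commute)
  then show ?thesis
    by (simp add: n divided_power_def funpow_Suc_right nat_add_distrib del: fact_Suc funpow.simps)
qed

lemma apply_divided_power:
  "T (divided_power s T n x) = s (of_int (n + 1)) (divided_power s T (n + 1) x)"
proof -
  have "T ((T ^^ k) x) = (T ^^ k) (T x)" for k
    by (induction k) simp_all
  then have "T (divided_power s T n x) = divided_power s T n (T x)"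
    by (simp add: divided_power_def linear_scale[OF T] linear_zero[OF T])
  then show ?thesis by (simp add: divided_power_apply)
qed

text \<open>The exponentials of \<open>z T\<close> and \<open>w T\<close> multiply to that of
  \<open>(z + w) T\<close>; the binomial coefficient is the one in
  \<open>taylor_coeff\<close>.\<close>

lemma divided_power_divided_power:
  assumes "m \<ge> 0"
  shows "divided_power s T m (divided_power s T n x) =
    s (of_int (n + m) gchoose nat m) (divided_power s T (n + m) x)"
proof (cases "n < 0")
  case True
  show ?thesis
  proof (cases "n + m < 0")
    case False
    \<comment> \<open>With \<open>n < 0 \<le> n + m\<close> the binomial coefficient has an upper
      entry smaller than its lower one.\<close>
    with True assms have "of_int (n + m) gchoose nat m = (0::'k)"
      using binomial_gbinomial[of "nat (n + m)" "nat m", where 'a = 'k]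
      by (simp add: binomial_eq_0)
    then show ?thesis using True linear_zero[OF linear_divided_power[OF T]] by simp
  qed (use True linear_zero[OF linear_divided_power[OF T]] in simp)
next
  case False
  obtain k where m: "m = int k" using assms nonneg_int_cases by blast
  obtain l where n: "n = int l" using False by (metis nat_eq_iff2 not_less)
  have "(of_int (n + m) gchoose nat m) = (fact (l + k) / (fact k * fact l) :: 'k)"
    using binomial_gbinomial[of "l + k" k, where 'a = 'k] binomial_fact[of k "l + k", where 'a = 'k]
    by (simp add: m n)
  moreover have "nat (int l + int k) = l + k" by simp
  ultimately show ?thesis
    by (simp add: m n divided_power_def linear_scale[OF linear_funpow[OF T]] add.commute
        flip: funpow_add[unfolded o_def, THEN fun_cong])
qed

lemma upper_bounded_divided_power:
  assumes "\<exists>n. (T ^^ n) x = 0"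
  shows "upper_bounded (\<lambda>n. divided_power s T n x)"
proof -
  obtain k where k: "(T ^^ k) x = 0" using assms by blast
  have "divided_power s T n x = 0" if "n > int k" for n
  proof -
    have "nat n = (nat n - k) + k" using that by simp
    then have "(T ^^ nat n) x = (T ^^ (nat n - k)) ((T ^^ k) x)"
      by (metis comp_apply funpow_add)
    then have "(T ^^ nat n) x = 0" using k linear_zero[OF linear_funpow[OF T]] by simp
    then show ?thesis by (simp add: divided_power_def)
  qed
  then show ?thesis unfolding upper_bounded_int_iff laurent_inf_def by blast
qed

end

text \<open>The exponential of a derivation is multiplicative. After multiplication by
  \<open>k + 1\<close> the inductive step is the splitting \<open>k + 1 = i + (k + 1 - i)\<close>,
  and \<open>k + 1\<close> cancels in characteristic zero.\<close>

lemma divided_power_Leibniz: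
  fixes s1 :: "'k::field_char_0 \<Rightarrow> 'a::ab_group_add \<Rightarrow> 'a"
    and s2 :: "'k \<Rightarrow> 'b::ab_group_add \<Rightarrow> 'b" and s3 :: "'k \<Rightarrow> 'c::ab_group_add \<Rightarrow> 'c"
  assumes f: "bilinear_map s1 s2 s3 f"
    and T: "Vector_Spaces.linear s1 s1 T1" "Vector_Spaces.linear s2 s2 T2"
      "Vector_Spaces.linear s3 s3 T3"
    and der: "\<And>a b. T3 (f a b) = f (T1 a) b + f a (T2 b)"
  shows "divided_power s3 T3 n (f a b) =
    conv f (\<lambda>i. divided_power s1 T1 i a) (\<lambda>j. divided_power s2 T2 j b) n"
proof -
  interpret s3: vector_space s3 by (rule bilinear_mapD[OF f])
  note fa = bilinear_map_biadditive[OF f]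
  let ?a = "\<lambda>i. divided_power s1 T1 i a" and ?b = "\<lambda>i. divided_power s2 T2 i b"
  \<comment> \<open>The range \<open>0..m\<close> is padded by a zero term at each end, which leaves
    room for the shift of the index by one.\<close>
  have conv_eq: "conv f ?a ?b m = (\<Sum>i\<in>{-1..m + 1}. f (?a i) (?b (m - i)))" for m
    by (rule conv_eq_sum[OF fa]) (auto simp: divided_power_def split: if_splits)
  have neg: "conv f ?a ?b m = 0" if "m < 0" for m
    unfolding conv_eq using that by (intro sum.neutral) (auto simp: divided_power_def biadditiveD[OF fa])
  have nat: "divided_power s3 T3 (int k) (f a b) = conv f ?a ?b (int k)" for k
  proof (induction k)
    case 0
    have "conv f ?a ?b 0 = (\<Sum>i\<in>{0}. f (?a i) (?b (0 - i)))"
      by (rule conv_eq_sum[OF fa]) (auto simp: divided_power_def split: if_splits)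
    then show ?case by (simp add: divided_power_zero[OF T(1)] divided_power_zero[OF T(2)] divided_power_zero[OF T(3)])
  next
    case (Suc k)
    define t where "t i = f (?a i) (?b (int k + 1 - i))" for i
    have "s3 (of_int (int k + 1)) (divided_power s3 T3 (int k + 1) (f a b)) =
        T3 (\<Sum>i\<in>{-1..int k + 1}. f (?a i) (?b (int k - i)))"
      by (simp add: apply_divided_power[OF T(3), symmetric] Suc conv_eq del: of_int_add)
    also have "\<dots> = (\<Sum>i\<in>{-1..int k + 1}. f (T1 (?a i)) (?b (int k - i)) + f (?a i) (T2 (?b (int k - i))))"
    proof -
      have "T3 (sum g S) = (\<Sum>i\<in>S. T3 (g i))" for g :: "int \<Rightarrow> 'c" and S
        by (induction S rule: infinite_finite_induct)
          (simp_all add: linear_add[OF T(3)] linear_zero[OF T(3)])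
      then show ?thesis by (simp add: der)
    qed
    also have "\<dots> = (\<Sum>i\<in>{-1..int k + 1}. s3 (of_int (i + 1)) (t (i + 1))) +
        (\<Sum>i\<in>{-1..int k + 1}. s3 (of_int (int k + 1 - i)) (t i))"
      by (simp add: apply_divided_power[OF T(1)] apply_divided_power[OF T(2)] bilinear_mapD(3,4)[OF f]
          t_def sum.distrib algebra_simps del: of_int_add of_int_diff)
    also have "(\<Sum>i\<in>{-1..int k + 1}. s3 (of_int (i + 1)) (t (i + 1))) =
        (\<Sum>i\<in>{0..int k + 2}. s3 (of_int i) (t i))"
      by (rule sum.reindex_bij_witness[where i = "\<lambda>i. i - 1" and j = "\<lambda>i. i + 1"]) auto
    also have "\<dots> = (\<Sum>i\<in>{-1..int k + 2}. s3 (of_int i) (t i))"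
      by (rule sum.mono_neutral_left) (auto simp: t_def biadditiveD[OF fa] divided_power_def)
    also have "(\<Sum>i\<in>{-1..int k + 1}. s3 (of_int (int k + 1 - i)) (t i)) =
        (\<Sum>i\<in>{-1..int k + 2}. s3 (of_int (int k + 1 - i)) (t i))"
      by (rule sum.mono_neutral_left) (auto simp: t_def biadditiveD[OF fa] divided_power_def)
    also have "(\<Sum>i\<in>{-1..int k + 2}. s3 (of_int i) (t i)) + \<dots> =
        (\<Sum>i\<in>{-1..int k + 2}. s3 (of_int (int k + 1)) (t i))"
      unfolding sum.distrib[symmetric] s3.scale_left_distrib[symmetric] of_int_add[symmetric] by simp
    also have "\<dots> = s3 (of_int (int k + 1)) (conv f ?a ?b (int k + 1))"
      by (simp add: conv_eq t_def s3.scale_sum_right add.assoc)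
    finally have *: "s3 (of_int (int k + 1)) (divided_power s3 T3 (int k + 1) (f a b)) =
      s3 (of_int (int k + 1)) (conv f ?a ?b (int k + 1))" .
    have "(of_int (int k + 1) :: 'k) \<noteq> 0"
      using of_nat_neq_0[of k, where 'a = 'k] by (simp add: add.commute)
    with * have "divided_power s3 T3 (int k + 1) (f a b) = conv f ?a ?b (int k + 1)"
      using s3.scale_left_imp_eq by blast
    then show ?case by (simp add: add.commute)
  qed
  show ?thesis
  proof (cases "n < 0")
    case False
    then show ?thesis using nat[of "nat n"] by simp
  qed (simp add: neg divided_power_neg[OF T(3)])
qed

context spectral_bialgebra
begin

abbreviation "DH \<equiv> hol_coproduct sHH tHH \<Delta>H TH"
abbreviation "TH_power \<equiv> divided_power sH TH"

lemmas HH_tensor = V2.tensor_product_axioms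
lemmas HHH_tensor = V3.tensor_product_axioms
lemmas linear_TH_power = linear_divided_power[OF linear_TH]
lemmas bounded_TH_power = upper_bounded_divided_power[OF linear_TH locally_nilpotent_TH]

definition shift_left :: "int \<Rightarrow> 'hh \<Rightarrow> 'hh" where
  "shift_left n = tmap tHH tHH (TH_power n) id"

lemma linear_shift_left: "Vector_Spaces.linear sHH sHH (shift_left n)"
  unfolding shift_left_def by (intro linear_tmap[OF HH_tensor HH_tensor] linear_TH_power linear_id V_space)

lemma shift_left_tensor: "shift_left n (tHH a b) = tHH (TH_power n a) b"
  unfolding shift_left_def
  by (simp add: tmap_tensor[OF HH_tensor HH_tensor linear_TH_power linear_id[OF V_space(1)]])

lemma bounded_shift_left: "upper_bounded (\<lambda>n. shift_left n x)"
proof (rule upper_bounded_int_tensor_induct[OF HH_tensor linear_shift_left])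
  fix a b
  show "upper_bounded (\<lambda>n. shift_left n (tHH a b))"
    unfolding shift_left_tensor
    by (rule upper_bounded_mono[OF bounded_TH_power[of a]])
      (use biadditiveD(3)[OF bilinear_map_biadditive[OF V2.bilinear_t]] in fastforce)
qed

lemma DH_eq: "DH x n = shift_left n (\<Delta>H x)"
proof -
  have "(if n < 0 then 0 else sHH (1 / fact (nat n)) (tmap tHH tHH (TH ^^ nat n) id y)) = shift_left n y"
    for y
  proof (cases "n < 0")
    case True
    have "shift_left n y = 0"
      using True
      by (induction y rule: V2.tensor_induct)
        (simp_all add: shift_left_tensor divided_power_def linear_add[OF linear_shift_left]
          biadditiveD(3)[OF bilinear_map_biadditive[OF V2.bilinear_t]])
    then show ?thesis using True by simp
  next
    case False
    have lin: "Vector_Spaces.linear sHH sHH (tmap tHH tHH (TH ^^ nat n) id)"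
      by (intro linear_tmap[OF HH_tensor HH_tensor] linear_funpow linear_TH linear_id V_space)
    have "sHH (1 / fact (nat n)) (tmap tHH tHH (TH ^^ nat n) id y) = shift_left n y"
      by (rule V2.linear_eqI[OF linear_scaled[OF lin] linear_shift_left])
        (use False in \<open>simp add: shift_left_tensor divided_power_def bilinear_mapD[OF V2.bilinear_t]
          tmap_tensor[OF HH_tensor HH_tensor linear_funpow[OF linear_TH] linear_id[OF V_space(1)]]\<close>)
    then show ?thesis using False by simp
  qed
  then show ?thesis by (simp add: hol_coproduct_def)
qed

lemma linear_DH: "Vector_Spaces.linear sH sHH (\<lambda>x. DH x n)"
  unfolding DH_eq by (rule linear_comp[OF linear_shift_left linear_\<Delta>H])

lemma bounded_DH: "upper_bounded (DH x)"
  using bounded_shift_left[of "\<Delta>H x"] by (simp add: DH_eq[abs_def])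

lemma shift_left_0: "shift_left 0 y = y"
  by (rule V2.linear_eqI[OF linear_shift_left linear_ident[OF V_space(2)]])
    (simp add: shift_left_tensor divided_power_zero[OF linear_TH])

lemma DH_0: "DH x 0 = \<Delta>H x"
  by (simp add: DH_eq shift_left_0)

lemma DH_neg: "n < 0 \<Longrightarrow> DH x n = 0"
  by (simp add: hol_coproduct_def)

lemma bilinear_mult2: "bilinear_map sHH sHH sHH (mult2 tHH)"
  unfolding mult2_def by (rule bilinear_tmap2[OF HH_tensor HH_tensor HH_tensor bilinear_mul bilinear_mul])

lemma mult2_tensor: "mult2 tHH (tHH a b) (tHH c d) = tHH (a * c) (b * d)"
  unfolding mult2_def by (rule tmap2_tensor[OF HH_tensor HH_tensor HH_tensor bilinear_mul bilinear_mul])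

lemma bilinear_mult3: "bilinear_map sHHH sHHH sHHH (mult3 tHH tHHH)"
  unfolding mult3_def by (rule bilinear_tmap2[OF HHH_tensor HHH_tensor HHH_tensor bilinear_mult2 bilinear_mul])

lemma mult3_tensor: "mult3 tHH tHHH (tHHH x b) (tHHH y d) = tHHH (mult2 tHH x y) (b * d)"
  unfolding mult3_def
  by (rule tmap2_tensor[OF HHH_tensor HHH_tensor HHH_tensor bilinear_mult2 bilinear_mul])

lemmas HH_add = bilinear_mapD(1,2)[OF V2.bilinear_t]
lemmas HHH_add = bilinear_mapD(1,2)[OF V3.bilinear_t]
lemmas mult2_add = bilinear_mapD(1,2)[OF bilinear_mult2]
lemmas mult3_add = bilinear_mapD(1,2)[OF bilinear_mult3]

lemma TH_power_mult: "TH_power n (x * y) = conv (*) (\<lambda>i. TH_power i x) (\<lambda>j. TH_power j y) n"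
  by (rule divided_power_Leibniz[OF bilinear_mul linear_TH linear_TH linear_TH derivation_TH])

text \<open>The exponential of the derivation \<open>TH\<close> is an algebra morphism on the left
  leg.\<close>

lemma shift_left_mult2:
  "shift_left n (mult2 tHH x y) = conv (mult2 tHH) (\<lambda>i. shift_left i x) (\<lambda>j. shift_left j y) n"
proof -
  note m2 = bilinear_map_biadditive[OF bilinear_mult2]
  note hh = bilinear_map_biadditive[OF V2.bilinear_t]
  show ?thesis
  proof (induct x rule: V2.tensor_induct, induct y rule: V2.tensor_induct)
    fix a b c d
    have "shift_left n (mult2 tHH (tHH a b) (tHH c d)) =
        conv (\<lambda>u v. tHH (u * v) (b * d)) (\<lambda>i. TH_power i a) (\<lambda>j. TH_power j c) n"
      by (simp add: mult2_tensor shift_left_tensor TH_power_mult) (rule additive_conv, rule HH_add)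
    also have "\<dots> = conv (\<lambda>u v. mult2 tHH (tHH u b) (tHH v d)) (\<lambda>i. TH_power i a) (\<lambda>j. TH_power j c) n"
      by (simp add: mult2_tensor)
    also have "\<dots> = conv (mult2 tHH) (\<lambda>i. tHH (TH_power i a) b) (\<lambda>j. tHH (TH_power j c) d) n"
      by (rule conv_map[symmetric, THEN fun_cong]) (simp_all add: m2 HH_add bounded_TH_power)
    finally show "shift_left n (mult2 tHH (tHH a b) (tHH c d)) =
       conv (mult2 tHH) (\<lambda>i. shift_left i (tHH a b)) (\<lambda>j. shift_left j (tHH c d)) n"
      by (simp add: shift_left_tensor)
  qed (simp_all add: mult2_add linear_add[OF linear_shift_left] conv_add_left[OF m2] conv_add_right[OF m2]
      bounded_shift_left)
qed

lemma DH_mult: "DH (x * y) n = conv (mult2 tHH) (DH x) (DH y) n"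
  using shift_left_mult2[of n "\<Delta>H x" "\<Delta>H y"]
  by (simp add: DH_eq[abs_def] \<Delta>H_mult mult2_def)

end

section \<open>The element \<open>R\<close>\<close>

context spectral_bialgebra
begin

text \<open>A counit on the left leg of the coderivation identity leaves \<open>TH x\<close> on both
  sides plus a term built from \<open>\<epsilon>H (TH a)\<close>, which must therefore vanish. A
  second counit turns that term into \<open>\<epsilon>H (TH x)\<close>.\<close>

lemma counit_TH: "\<epsilon>H (TH x) = 0"
proof -
  have bil: "bilinear_map sH sH sH (\<lambda>a b. sH (\<epsilon>H a) b)"
    by (intro bilinear_mapI linear_bilinear_left[OF bilinear_scale] linear_bilinear_right[OF bilinear_scale]
        linear_\<epsilon>H linear_ident V_space)
  let ?l = "tlift tHH (\<lambda>a b. sH (\<epsilon>H a) b)"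
  note lin = V2.linear_tlift[OF bil]
  note l = linear_tmap[OF HH_tensor HH_tensor linear_TH linear_id[OF V_space(1)]]
    linear_tmap[OF HH_tensor HH_tensor linear_id[OF V_space(1)] linear_TH]
  have 1: "?l (tmap tHH tHH id TH y) = TH (?l y)" for y
    by (rule V2.linear_eqI[OF linear_comp[OF lin l(2)] linear_comp[OF linear_TH lin]])
      (simp_all add: V2.tlift_tensor[OF bil]
        tmap_tensor[OF HH_tensor HH_tensor linear_id[OF V_space(1)] linear_TH] linear_scale[OF linear_TH])
  have 2: "\<epsilon>H (?l (tmap tHH tHH TH id y)) = \<epsilon>H (TH (tlift tHH (\<lambda>a b. sH (\<epsilon>H b) a) y))" for y
  proof -
    have bil': "bilinear_map sH sH sH (\<lambda>a b. sH (\<epsilon>H b) a)"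
      using bil by (simp add: bilinear_map_def)
    show ?thesis
      by (rule V2.linear_eqI[OF linear_comp[OF linear_\<epsilon>H linear_comp[OF lin l(1)]]
            linear_comp[OF linear_\<epsilon>H linear_comp[OF linear_TH V2.linear_tlift[OF bil']]]])
        (simp_all add: V2.tlift_tensor[OF bil]
          V2.tlift_tensor[OF bil'] tmap_tensor[OF HH_tensor HH_tensor linear_TH linear_id[OF V_space(1)]]
          linear_scale[OF linear_TH] linear_scale[OF linear_\<epsilon>H] mult.commute)
  qed
  have "TH x = ?l (\<Delta>H (TH x))" by (simp add: counit_left)
  also have "\<dots> = ?l (tmap tHH tHH TH id (\<Delta>H x)) + TH x"
    by (simp add: coderivation_TH linear_add[OF lin] 1 counit_left)
  finally have "?l (tmap tHH tHH TH id (\<Delta>H x)) = 0" by simp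
  with 2[of "\<Delta>H x"] show ?thesis by (simp add: counit_right linear_zero[OF linear_\<epsilon>H])
qed

lemma counit_TH_power: "\<epsilon>H (TH_power n x) = (if n = 0 then \<epsilon>H x else 0)"
proof -
  have "\<epsilon>H ((TH ^^ k) x) = (if k = 0 then \<epsilon>H x else 0)" for k
    by (cases k) (simp_all add: counit_TH)
  then show ?thesis
    by (simp add: divided_power_def linear_zero[OF linear_\<epsilon>H] linear_scale[OF linear_\<epsilon>H])
qed

definition counit1 :: "'hh \<Rightarrow> 'h" where "counit1 = tlift tHH (\<lambda>a b. sH (\<epsilon>H a) b)"
definition counit2 :: "'hh \<Rightarrow> 'h" where "counit2 = tlift tHH (\<lambda>a b. sH (\<epsilon>H b) a)"

lemma linear_counit1: "Vector_Spaces.linear sHH sH counit1"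
  and linear_counit2: "Vector_Spaces.linear sHH sH counit2"
  and counit1_tensor: "counit1 (tHH a b) = sH (\<epsilon>H a) b"
  and counit2_tensor: "counit2 (tHH a b) = sH (\<epsilon>H b) a"
proof -
  have 1: "bilinear_map sH sH sH (\<lambda>a b. sH (\<epsilon>H a) b)"
    by (intro bilinear_mapI linear_bilinear_left[OF bilinear_scale] linear_bilinear_right[OF bilinear_scale]
        linear_\<epsilon>H linear_ident V_space)
  then have 2: "bilinear_map sH sH sH (\<lambda>a b. sH (\<epsilon>H b) a)"
    by (simp add: bilinear_map_def)
  show "Vector_Spaces.linear sHH sH counit1" "counit1 (tHH a b) = sH (\<epsilon>H a) b"
    unfolding counit1_def using 1 by (rule V2.linear_tlift V2.tlift_tensor)+
  show "Vector_Spaces.linear sHH sH counit2" "counit2 (tHH a b) = sH (\<epsilon>H b) a"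
    unfolding counit2_def using 2 by (rule V2.linear_tlift V2.tlift_tensor)+
qed

lemmas counit_add = linear_add[OF linear_counit1] linear_add[OF linear_counit2]

lemma counit1_shift_left: "counit1 (shift_left n y) = (if n = 0 then counit1 y else 0)"
  by (induct y rule: V2.tensor_induct)
    (simp_all add: shift_left_tensor counit1_tensor counit_TH_power counit_add
      linear_add[OF linear_shift_left] scale_zero_left)

lemma counit2_shift_left: "counit2 (shift_left n y) = TH_power n (counit2 y)"
  by (induct y rule: V2.tensor_induct)
    (simp_all add: shift_left_tensor counit2_tensor counit_add linear_add[OF linear_shift_left]
      linear_scale[OF linear_TH_power] linear_add[OF linear_TH_power])

lemma counit1_DH: "counit1 (DH x n) = (if n = 0 then x else 0)"
  using counit_left[of x] by (simp add: DH_eq counit1_shift_left) (simp add: counit1_def)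

lemma counit2_DH: "counit2 (DH x n) = TH_power n x"
  using counit_right[of x] by (simp add: DH_eq counit2_shift_left) (simp add: counit2_def)

text \<open>Of the two terms of the coderivation identity, \<open>TH\<close> on the left leg
  differentiates the exponential and \<open>TH\<close> on the right leg commutes with it.\<close>

lemma DH_translation:
  "DH (TH x) n = sHH (of_int (n + 1)) (DH x (n + 1)) + tmap tHH tHH id TH (DH x n)"
proof -
  note l = linear_tmap[OF HH_tensor HH_tensor linear_TH linear_id[OF V_space(1)]]
    linear_tmap[OF HH_tensor HH_tensor linear_id[OF V_space(1)] linear_TH]
  note t = tmap_tensor[OF HH_tensor HH_tensor linear_TH linear_id[OF V_space(1)]]
    tmap_tensor[OF HH_tensor HH_tensor linear_id[OF V_space(1)] linear_TH]
  have 1: "shift_left n (tmap tHH tHH TH id y) = sHH (of_int (n + 1)) (shift_left (n + 1) y)" for y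
    by (rule V2.linear_eqI[OF linear_comp[OF linear_shift_left l(1)]
        linear_scaled[OF linear_shift_left]])
      (simp add: t shift_left_tensor divided_power_apply[OF linear_TH]
        bilinear_mapD[OF V2.bilinear_t] del: of_int_add)
  have 2: "shift_left n (tmap tHH tHH id TH y) = tmap tHH tHH id TH (shift_left n y)" for y
    by (rule V2.linear_eqI[OF linear_comp[OF linear_shift_left l(2)]
        linear_comp[OF l(2) linear_shift_left]]) (simp add: t shift_left_tensor)
  show ?thesis
    by (simp add: DH_eq coderivation_TH linear_add[OF linear_shift_left] 1 2)
qed

section \<open>Permutations of legs and the hexagons for the flipped \<open>R\<close>\<close>

definition flip :: "'hh \<Rightarrow> 'hh" where "flip = tlift tHH (\<lambda>a b. tHH b a)"

lemma linear_flip: "Vector_Spaces.linear sHH sHH flip"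
  and flip_tensor: "flip (tHH a b) = tHH b a"
proof -
  have "bilinear_map sH sH sHH (\<lambda>a b. tHH b a)"
    using V2.bilinear_t by (simp add: bilinear_map_def)
  then show "Vector_Spaces.linear sHH sHH flip" "flip (tHH a b) = tHH b a"
    unfolding flip_def by (rule V2.linear_tlift V2.tlift_tensor)+
qed

lemma flip_flip: "flip (flip x) = x"
  by (induct x rule: V2.tensor_induct) (simp_all add: flip_tensor linear_add[OF linear_flip])

text \<open>Sends \<open>a \<otimes> b \<otimes> c\<close> to
  \<open>c \<otimes> a \<otimes> b\<close>. Together with \<open>flip\<close> it transports the
  hexagon relations from \<open>R\<close> to its flip.\<close>

definition cycle :: "'hhh \<Rightarrow> 'hhh" where "cycle = tlift tHHH (\<lambda>x c. reassoc c x)"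

lemma linear_cycle: "Vector_Spaces.linear sHHH sHHH cycle"
  and cycle_tensor: "cycle (tHHH x c) = reassoc c x"
proof -
  have "bilinear_map sHH sH sHHH (\<lambda>x c. reassoc c x)"
    using bilinear_reassoc by (simp add: bilinear_map_def)
  then show "Vector_Spaces.linear sHHH sHHH cycle" "cycle (tHHH x c) = reassoc c x"
    unfolding cycle_def by (rule V3.linear_tlift V3.tlift_tensor)+
qed

lemmas cycle_simps = cycle_tensor reassoc_tensor linear_add[OF linear_cycle]

lemma cycle_mult3: "cycle (mult3 tHH tHHH x y) = mult3 tHH tHHH (cycle x) (cycle y)"
  by (induct x rule: tensor3_induct, induct y rule: tensor3_induct)
    (simp_all add: mult3_add mult3_tensor mult2_tensor cycle_simps)

lemma cycle_cycle_cycle: "cycle (cycle (cycle x)) = x"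
  by (induct x rule: tensor3_induct) (simp_all add: cycle_simps)

lemma cycle_cop_left:
  assumes "Vector_Spaces.linear sH sHH D"
  shows "cycle (cop_left tHH tHHH D r) = cop_right tHH tHHH D (flip r)"
  by (induct r rule: V2.tensor_induct)
    (simp_all add: flip_tensor linear_add[OF linear_flip] cop_left_tensor[OF assms]
      cop_right_tensor[OF assms] linear_add[OF linear_cop_left[OF assms]]
      linear_add[OF linear_cop_right[OF assms]] cycle_simps)

lemma bilinear_leg13: "bilinear_map sH sH sHHH (\<lambda>a b. tHHH (tHH a 1) b)"
  and bilinear_leg23: "bilinear_map sH sH sHHH (\<lambda>a b. tHHH (tHH 1 a) b)"
  by (intro bilinear_mapI linear_bilinear_left[OF V3.bilinear_t] linear_bilinear_right[OF V3.bilinear_t]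
      linear_bilinear_left[OF V2.bilinear_t] linear_bilinear_right[OF V2.bilinear_t] linear_ident V_space)+

abbreviation "l12 \<equiv> leg12 tHHH"
abbreviation "l13 \<equiv> leg13 tHH tHHH"
abbreviation "l23 \<equiv> leg23 tHH tHHH"

lemma linear_leg: "Vector_Spaces.linear sHH sHHH l12" "Vector_Spaces.linear sHH sHHH l13"
    "Vector_Spaces.linear sHH sHHH l23"
  and leg_tensor: "l12 (tHH a b) = tHHH (tHH a b) 1" "l13 (tHH a b) = tHHH (tHH a 1) b"
    "l23 (tHH a b) = tHHH (tHH 1 a) b"
  unfolding leg13_def leg23_def leg12_def[abs_def]
  by (rule linear_bilinear_left[OF V3.bilinear_t linear_ident[OF V_space(2)]]
      V2.linear_tlift[OF bilinear_leg13] V2.linear_tlift[OF bilinear_leg23])+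
    (simp_all add: V2.tlift_tensor[OF bilinear_leg13] V2.tlift_tensor[OF bilinear_leg23])

lemmas leg_add = linear_leg[THEN linear_add]

lemma cycle_leg:
  "cycle (cycle (l12 x)) = l13 (flip x)" "cycle (cycle (l13 x)) = l23 (flip x)"
  "cycle (l13 x) = l12 (flip x)" "cycle (l23 x) = l13 (flip x)"
  by (induct x rule: V2.tensor_induct)
    (simp_all add: cycle_simps leg_tensor leg_add flip_tensor linear_add[OF linear_flip])

text \<open>The element \<open>\<sigma> R\<close>, whose first leg acts on the left tensor factor.\<close>

definition R' :: "int \<Rightarrow> 'hh" where "R' n = flip (R n)"

lemma bounded_R: "upper_bounded R"
  using laurent_R by (simp add: upper_bounded_int_iff)

lemma bounded_R': "upper_bounded R'"
  using bounded_R by (rule upper_bounded_mono) (auto simp: R'_def linear_zero[OF linear_flip])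

lemma taylor_coeff_R': "taylor_coeff sHH c m R' p = flip (taylor_coeff sHH c m R p)"
  by (simp add: taylor_coeff_def R'_def linear_scale[OF linear_flip])

text \<open>This is the right hexagon of \<open>R\<close>, rotated twice. Flipping \<open>R\<close>
  interchanges the two hexagons, so the argument \<open>z + w\<close> now stands on the
  left.\<close>

lemma hexagon_left':
  "cop_left tHH tHHH (\<lambda>x. DH x (int m)) (R' n) =
    conv (\<lambda>a b. mult3 tHH tHHH (l13 a) (l23 b)) (taylor_coeff sHH 1 m R') R' n"
proof -
  let ?D = "\<lambda>x. DH x (int m)"
  note m3 = bilinear_map_biadditive[OF bilinear_mult3]
  have bt: "upper_bounded (taylor_coeff sHH c m R)" for c
    by (rule upper_bounded_taylor_coeff[OF V_space(2) bounded_R])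
  have "cop_left tHH tHHH ?D (R' n) = cycle (cycle (cop_right tHH tHHH ?D (R n)))"
    using cycle_cop_left[OF linear_DH, of "int m" "R' n"] cycle_cycle_cycle
    by (simp add: R'_def flip_flip) metis
  also have "\<dots> = conv (\<lambda>x y. cycle (cycle (mult3 tHH tHHH x y)))
      (\<lambda>p. l12 (taylor_coeff sHH 1 m R p)) (\<lambda>q. l13 (R q)) n"
    unfolding hexagon_right conv2_eq_conv
    by (rule additive_conv) (simp add: linear_add[OF linear_cycle])
  also have "\<dots> = conv (\<lambda>x y. mult3 tHH tHHH (cycle (cycle x)) (cycle (cycle y)))
      (\<lambda>p. l12 (taylor_coeff sHH 1 m R p)) (\<lambda>q. l13 (R q)) n"
    by (simp add: cycle_mult3)
  also have "\<dots> = conv (\<lambda>x y. mult3 tHH tHHH (cycle (cycle (l12 x))) (cycle (cycle (l13 y))))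
      (taylor_coeff sHH 1 m R) R n"
    by (rule conv_map[THEN fun_cong])
      (simp_all add: biadditive_def mult3_add linear_add[OF linear_cycle] leg_add bt bounded_R)
  also have "\<dots> = conv (\<lambda>a b. mult3 tHH tHHH (l13 (flip a)) (l23 (flip b))) (taylor_coeff sHH 1 m R) R n"
    by (simp add: cycle_leg(1,2))
  also have "\<dots> = conv (\<lambda>a b. mult3 tHH tHHH (l13 a) (l23 b))
      (\<lambda>p. flip (taylor_coeff sHH 1 m R p)) (\<lambda>q. flip (R q)) n"
    by (rule conv_map[THEN fun_cong, symmetric])
      (simp_all add: biadditive_def mult3_add linear_add[OF linear_flip] leg_add bt bounded_R)
  finally show ?thesis
    by (simp add: R'_def[abs_def] taylor_coeff_R'[unfolded R'_def[abs_def], abs_def])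
qed

text \<open>The left hexagon of \<open>R\<close>, rotated once; it brings along the argument
  \<open>z - w\<close>.\<close>

lemma hexagon_right':
  "cop_right tHH tHHH (\<lambda>x. DH x (int m)) (R' n) =
    conv (\<lambda>a b. mult3 tHH tHHH (l12 a) (l13 b)) (taylor_coeff sHH (- 1) m R') R' n"
proof -
  let ?D = "\<lambda>x. DH x (int m)"
  note m3 = bilinear_map_biadditive[OF bilinear_mult3]
  have bt: "upper_bounded (taylor_coeff sHH c m R)" for c
    by (rule upper_bounded_taylor_coeff[OF V_space(2) bounded_R])
  have "cop_right tHH tHHH ?D (R' n) = cycle (cop_left tHH tHHH ?D (R n))"
    by (simp add: R'_def cycle_cop_left[OF linear_DH])
  also have "\<dots> = conv (\<lambda>x y. cycle (mult3 tHH tHHH x y))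
      (\<lambda>p. l13 (taylor_coeff sHH (- 1) m R p)) (\<lambda>q. l23 (R q)) n"
    unfolding hexagon_left conv2_eq_conv
    by (rule additive_conv) (simp add: linear_add[OF linear_cycle])
  also have "\<dots> = conv (\<lambda>x y. mult3 tHH tHHH (cycle x) (cycle y))
      (\<lambda>p. l13 (taylor_coeff sHH (- 1) m R p)) (\<lambda>q. l23 (R q)) n"
    by (simp add: cycle_mult3)
  also have "\<dots> = conv (\<lambda>x y. mult3 tHH tHHH (cycle (l13 x)) (cycle (l23 y)))
      (taylor_coeff sHH (- 1) m R) R n"
    by (rule conv_map[THEN fun_cong])
      (simp_all add: biadditive_def mult3_add linear_add[OF linear_cycle] leg_add bt bounded_R)
  also have "\<dots> = conv (\<lambda>a b. mult3 tHH tHHH (l12 (flip a)) (l13 (flip b))) (taylor_coeff sHH (- 1) m R) R n"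
    by (simp add: cycle_leg)
  also have "\<dots> = conv (\<lambda>a b. mult3 tHH tHHH (l12 a) (l13 b))
      (\<lambda>p. flip (taylor_coeff sHH (- 1) m R p)) (\<lambda>q. flip (R q)) n"
    by (rule conv_map[THEN fun_cong, symmetric])
      (simp_all add: biadditive_def mult3_add linear_add[OF linear_flip] leg_add bt bounded_R)
  finally show ?thesis
    by (simp add: R'_def[abs_def] taylor_coeff_R'[unfolded R'_def[abs_def], abs_def])
qed

lemma taylor_coeff_0 [simp]: "taylor_coeff sHH c 0 F = F"
proof -
  interpret vector_space sHH by (rule V_space)
  show ?thesis by (simp add: taylor_coeff_def fun_eq_iff)
qed

lemma hexagon_left_0: "cop_left tHH tHHH \<Delta>H (R' n) = conv (\<lambda>a b. mult3 tHH tHHH (l13 a) (l23 b)) R' R' n"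
  using hexagon_left'[of 0 n] by (simp add: DH_0)

lemma hexagon_right_0: "cop_right tHH tHHH \<Delta>H (R' n) = conv (\<lambda>a b. mult3 tHH tHHH (l12 a) (l13 b)) R' R' n"
  using hexagon_right'[of 0 n] by (simp add: DH_0)

section \<open>Counits of \<open>R\<close>\<close>

lemma counit_mult2:
  "counit1 (mult2 tHH x y) = counit1 x * counit1 y" "counit2 (mult2 tHH x y) = counit2 x * counit2 y"
proof -
  have m: "sH c a * b = sH c (a * b)" "a * sH c b = sH c (a * b)" for a b c
    using bilinear_mapD(3,4)[OF bilinear_mul] by metis+
  show "counit1 (mult2 tHH x y) = counit1 x * counit1 y"
    by (induct x rule: V2.tensor_induct, induct y rule: V2.tensor_induct)
      (simp_all add: mult2_tensor counit1_tensor mult2_add counit_add m \<epsilon>H_mult algebra_simps)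
  show "counit2 (mult2 tHH x y) = counit2 x * counit2 y"
    by (induct x rule: V2.tensor_induct, induct y rule: V2.tensor_induct)
      (simp_all add: mult2_tensor counit2_tensor mult2_add counit_add m \<epsilon>H_mult algebra_simps)
qed

lemma biadditive_times: "biadditive ((*) :: 'h \<Rightarrow> 'h \<Rightarrow> 'h)"
  by (rule bilinear_map_biadditive[OF bilinear_mul])

text \<open>Multiplying \<open>F = F F\<close> by the inverse \<open>G\<close> gives
  \<open>1 = F\<close>.\<close>

lemma idempotent_unit_series:
  fixes F G :: "int \<Rightarrow> 'h"
  assumes F: "upper_bounded F" and G: "upper_bounded G"
    and idem: "F = conv (*) F F" and inv: "conv (*) F G = (\<lambda>n. if n = 0 then 1 else 0)"
  shows "F n = (if n = 0 then 1 else 0)"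
proof -
  note t = biadditive_times
  have "F = conv (*) F (conv (*) F G)"
    unfolding inv by (rule ext) (simp add: conv_delta_right[OF t])
  also have "\<dots> = conv (*) (conv (*) F F) G"
    by (rule conv_assoc[symmetric, OF t t t t F F G]) (simp add: mult.assoc)
  also have "\<dots> = (\<lambda>n. if n = 0 then 1 else 0)"
    using idem inv by simp
  finally show ?thesis by (rule fun_cong)
qed

text \<open>Counits on two legs of a hexagon at \<open>w = 0\<close> show that the counit of
  \<open>R'\<close> is idempotent. It is also the image of an invertible series under an algebra
  morphism, hence equal to 1.\<close>

lemma counit1_R': "counit1 (R' n) = (if n = 0 then 1 else 0)"
  and counit2_R': "counit2 (R' n) = (if n = 0 then 1 else 0)"
proof -
  have m: "sH c a * b = sH c (a * b)" "a * sH c b = sH c (a * b)" for a b c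
    using bilinear_mapD(3,4)[OF bilinear_mul] by metis+
  have lin: "Vector_Spaces.linear sHH (*) (\<lambda>x. \<epsilon>H (counit1 x))"
    by (rule linear_comp[OF linear_\<epsilon>H linear_counit1])
  have \<epsilon>_counit: "\<epsilon>H (counit1 (\<Delta>H a)) = \<epsilon>H a" for a
    using counit_left[of a] by (simp add: counit1_def)
  have flip: "counit1 (flip x) = counit2 x" "counit2 (flip x) = counit1 x" for x
    by (induct x rule: V2.tensor_induct)
      (simp_all add: flip_tensor counit1_tensor counit2_tensor counit_add linear_add[OF linear_flip])
  have s1: "sH 1 a = a" for a
    using vector_space.vector_space_assms(4)[OF V_space(1)] .
  obtain Ri where Ri: "upper_bounded Ri" "\<And>n. conv (mult2 tHH) R Ri n = (if n = 0 then tHH 1 1 else 0)"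
    using invertible_R unfolding conv2_eq_conv upper_bounded_int_iff[symmetric] by blast
  \<comment> \<open>An algebra morphism carries the inverse of \<open>R\<close> to an inverse of the
    image of \<open>R\<close>.\<close>
  have inv: "conv (*) (\<lambda>n. \<phi> (R n)) (\<lambda>n. \<phi> (Ri n)) = (\<lambda>n. if n = 0 then 1 else 0)"
    if \<phi>: "\<And>x y. \<phi> (x + y) = \<phi> x + \<phi> y" "\<And>x y. \<phi> (mult2 tHH x y) = \<phi> x * \<phi> y" "\<phi> (tHH 1 1) = 1"
    for \<phi> :: "'hh \<Rightarrow> 'h"
  proof -
    have "\<phi> 0 = 0" using \<phi>(1)[of 0 0] by simp
    have "conv (*) (\<lambda>n. \<phi> (R n)) (\<lambda>n. \<phi> (Ri n)) n = conv (\<lambda>a b. \<phi> a * \<phi> b) R Ri n" for n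
      by (rule conv_map[OF biadditive_times \<phi>(1) \<phi>(1) bounded_R Ri(1), THEN fun_cong])
    also have "\<dots> n = \<phi> (conv (mult2 tHH) R Ri n)" for n
      by (simp add: additive_conv[of \<phi>, OF \<phi>(1)] \<phi>(2))
    finally show ?thesis using \<phi>(3) \<open>\<phi> 0 = 0\<close> by (auto simp: Ri(2) fun_eq_iff)
  qed
  have bdd: "upper_bounded (\<lambda>n. \<phi> (F n))" if "upper_bounded F" "\<phi> 0 = 0" for F :: "int \<Rightarrow> 'hh" and \<phi> :: "'hh \<Rightarrow> 'h"
    by (rule upper_bounded_mono[OF that(1)]) (use that(2) in auto)

  \<comment> \<open>\<open>K1\<close> is the counit on the first two legs. On the coproduct side of
    the left hexagon it leaves \<open>counit1\<close>, on the other side the product of two copies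
    of \<open>counit1\<close>.\<close>
  define K1 where "K1 = tlift tHHH (\<lambda>x c. sH (\<epsilon>H (counit1 x)) c)"
  have bil1: "bilinear_map sHH sH sH (\<lambda>x c. sH (\<epsilon>H (counit1 x)) c)"
    by (intro bilinear_mapI linear_bilinear_left[OF bilinear_scale] linear_bilinear_right[OF bilinear_scale]
        lin linear_ident V_space)
  have K1: "K1 (tHHH x c) = sH (\<epsilon>H (counit1 x)) c" "K1 (u + v) = K1 u + K1 v" for x c u v
    using V3.tlift_tensor[OF bil1] linear_add[OF V3.linear_tlift[OF bil1]] by (simp_all add: K1_def)
  have K1_cop: "K1 (cop_left tHH tHHH \<Delta>H y) = counit1 y" for y
    by (induct y rule: V2.tensor_induct)
      (simp_all add: cop_left_tensor[OF linear_\<Delta>H] K1 \<epsilon>_counit counit1_tensor counit_add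
        linear_add[OF linear_cop_left[OF linear_\<Delta>H]])
  have K1_mult: "K1 (mult3 tHH tHHH (l13 u) (l23 v)) = counit1 u * counit1 v" for u v
    by (induct u rule: V2.tensor_induct, induct v rule: V2.tensor_induct)
      (simp_all add: K1 leg_tensor leg_add mult3_tensor mult2_tensor mult3_add counit1_tensor counit_add
        m linear_scale[OF linear_\<epsilon>H] \<epsilon>H_one s1 algebra_simps vector_space.vector_space_assms(3)[OF V_space(1)])
  have "(\<lambda>n. counit1 (R' n)) = conv (*) (\<lambda>n. counit1 (R' n)) (\<lambda>n. counit1 (R' n))"
  proof
    fix n
    have "counit1 (R' n) = conv (\<lambda>a b. counit1 a * counit1 b) R' R' n"
      unfolding K1_cop[symmetric] hexagon_left_0 additive_conv[of K1, OF K1(2)] K1_mult ..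
    also have "\<dots> = conv (*) (\<lambda>n. counit1 (R' n)) (\<lambda>n. counit1 (R' n)) n"
      by (rule conv_map[symmetric, THEN fun_cong]) (simp_all add: biadditive_times counit_add bounded_R')
    finally show "counit1 (R' n) = conv (*) (\<lambda>n. counit1 (R' n)) (\<lambda>n. counit1 (R' n)) n" .
  qed
  \<comment> \<open>The first counit of the flipped series is the second counit of \<open>R\<close>,
    so its inverse comes from \<open>counit2\<close> of the inverse of \<open>R\<close>.\<close>
  then show "counit1 (R' n) = (if n = 0 then 1 else 0)"
    by (rule idempotent_unit_series[rotated 2, where G = "\<lambda>n. counit2 (Ri n)"])
      (use inv[of counit2] in \<open>simp_all add: R'_def flip counit_add counit_mult2 counit2_tensor \<epsilon>H_one s1
        bdd bounded_R Ri linear_zero[OF linear_counit2]\<close>)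

  \<comment> \<open>The mirror image for the right hexagon: the counit on the last two legs.\<close>
  define K2 where "K2 = tlift tHHH (\<lambda>x c. sH (\<epsilon>H c) (counit2 x))"
  have bil2: "bilinear_map sHH sH sH (\<lambda>x c. sH (\<epsilon>H c) (counit2 x))"
    by (intro bilinear_mapI linear_bilinear_left[OF bilinear_scale] linear_bilinear_right[OF bilinear_scale]
        linear_counit2 linear_\<epsilon>H V_space)
  have K2: "K2 (tHHH x c) = sH (\<epsilon>H c) (counit2 x)" "K2 (u + v) = K2 u + K2 v" for x c u v
    using V3.tlift_tensor[OF bil2] linear_add[OF V3.linear_tlift[OF bil2]] by (simp_all add: K2_def)
  have K2_reassoc: "K2 (reassoc a w) = sH (\<epsilon>H (counit1 w)) a" for a w
    by (induct w rule: V2.tensor_induct)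
      (simp_all add: reassoc_tensor K2 counit1_tensor counit2_tensor counit_add linear_add[OF linear_\<epsilon>H]
        bilinear_mapD[OF bilinear_reassoc] linear_scale[OF linear_\<epsilon>H] mult.commute
        vector_space.vector_space_assms[OF V_space(1)])
  have K2_cop: "K2 (cop_right tHH tHHH \<Delta>H y) = counit2 y" for y
    by (induct y rule: V2.tensor_induct)
      (simp_all add: cop_right_tensor[OF linear_\<Delta>H] K2_reassoc K2(2) \<epsilon>_counit counit2_tensor counit_add
        linear_add[OF linear_cop_right[OF linear_\<Delta>H]])
  have K2_mult: "K2 (mult3 tHH tHHH (l12 u) (l13 v)) = counit2 u * counit2 v" for u v
    by (induct u rule: V2.tensor_induct, induct v rule: V2.tensor_induct)
      (simp_all add: K2 leg_tensor leg_add mult3_tensor mult2_tensor mult3_add counit2_tensor counit_add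
        m linear_scale[OF linear_\<epsilon>H] \<epsilon>H_one s1 algebra_simps vector_space.vector_space_assms(3)[OF V_space(1)])
  have "(\<lambda>n. counit2 (R' n)) = conv (*) (\<lambda>n. counit2 (R' n)) (\<lambda>n. counit2 (R' n))"
  proof
    fix n
    have "counit2 (R' n) = conv (\<lambda>a b. counit2 a * counit2 b) R' R' n"
      unfolding K2_cop[symmetric] hexagon_right_0 additive_conv[of K2, OF K2(2)] K2_mult ..
    also have "\<dots> = conv (*) (\<lambda>n. counit2 (R' n)) (\<lambda>n. counit2 (R' n)) n"
      by (rule conv_map[symmetric, THEN fun_cong]) (simp_all add: biadditive_times counit_add bounded_R')
    finally show "counit2 (R' n) = conv (*) (\<lambda>n. counit2 (R' n)) (\<lambda>n. counit2 (R' n)) n" .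
  qed
  then show "counit2 (R' n) = (if n = 0 then 1 else 0)"
    by (rule idempotent_unit_series[rotated 2, where G = "\<lambda>n. counit1 (Ri n)"])
      (use inv[of counit1] in \<open>simp_all add: R'_def flip counit_add counit_mult2 counit1_tensor \<epsilon>H_one s1
        bdd bounded_R Ri linear_zero[OF linear_counit1]\<close>)
qed

text \<open>In degree one the hexagon relation reads \<open>(1 \<otimes> T) \<sigma>R = - d/dz \<sigma>R\<close>.\<close>

lemma translation_R': "tmap tHH tHH id TH (R' n) = sHH (- of_int (n + 1)) (R' (n + 1))"
proof -
  interpret HH: vector_space sHH by (rule V_space)
  have m: "sH c a * b = sH c (a * b)" "a * sH c b = sH c (a * b)" for a b c
    using bilinear_mapD(3,4)[OF bilinear_mul] by metis+
  have "tmap tHH tHH id TH (tHH a b) = tHH a (TH b)" for a b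
    by (rule trans[OF tmap_tensor[OF HH_tensor HH_tensor linear_id[OF V_space(1)] linear_TH]]) simp
  note tt = this linear_add[OF linear_tmap[OF HH_tensor HH_tensor linear_id[OF V_space(1)] linear_TH]]
  \<comment> \<open>The counit on the last leg. The coefficient of \<open>w\<close> in
    \<open>DH x\<close> has \<open>TH x\<close> as its second counit, so the coproduct side becomes
    \<open>TH\<close> on the second leg; on the other side the factor on legs 1 and 3 collapses to
    1.\<close>
  define K where "K = tlift tHHH (\<lambda>x c. sHH (\<epsilon>H c) x)"
  have bil: "bilinear_map sHH sH sHH (\<lambda>x c. sHH (\<epsilon>H c) x)"
    by (intro bilinear_mapI linear_bilinear_left[OF bilinear_scale] linear_bilinear_right[OF bilinear_scale]
        linear_ident linear_\<epsilon>H V_space)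
  have K: "K (tHHH x c) = sHH (\<epsilon>H c) x" "K (u + v) = K u + K v" for x c u v
    using V3.tlift_tensor[OF bil] linear_add[OF V3.linear_tlift[OF bil]] by (simp_all add: K_def)
  have K_reassoc: "K (reassoc a w) = tHH a (counit2 w)" for a w
    by (induct w rule: V2.tensor_induct)
      (simp_all add: reassoc_tensor K counit2_tensor counit_add bilinear_mapD[OF bilinear_reassoc]
        bilinear_mapD[OF V2.bilinear_t])
  have TH1: "TH_power 1 x = TH x" for x
    by (simp add: divided_power_def vector_space.vector_space_assms(4)[OF V_space(1)])
  have K_cop: "K (cop_right tHH tHHH (\<lambda>x. DH x 1) y) = tmap tHH tHH id TH y" for y
    by (induct y rule: V2.tensor_induct)
      (simp_all only: cop_right_tensor[OF linear_DH] K_reassoc K(2) counit2_DH tt TH1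
        linear_add[OF linear_cop_right[OF linear_DH]])
  have K_mult: "K (mult3 tHH tHHH (l12 u) (l13 v)) = mult2 tHH u (tHH (counit2 v) 1)" for u v
    by (induct u rule: V2.tensor_induct, induct v rule: V2.tensor_induct)
      (simp_all add: K leg_tensor leg_add mult3_tensor mult2_tensor mult3_add mult2_add counit2_tensor
        counit_add m bilinear_mapD[OF V2.bilinear_t] bilinear_mapD(3,4)[OF bilinear_mult2])
  have mult2_one: "mult2 tHH x (tHH 1 1) = x" for x
    by (induct x rule: V2.tensor_induct) (simp_all add: mult2_tensor mult2_add)
  let ?t = "taylor_coeff sHH (- 1) 1 R'"
  have "tmap tHH tHH id TH (R' n) = K (conv (\<lambda>a b. mult3 tHH tHHH (l12 a) (l13 b)) ?t R' n)"
    using K_cop[of "R' n"] hexagon_right'[of 1 n] by simp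
  also have "\<dots> = conv (\<lambda>a b. mult2 tHH a (tHH (counit2 b) 1)) ?t R' n"
    unfolding additive_conv[of K, OF K(2)] K_mult ..
  also have "\<dots> = conv (\<lambda>a b. mult2 tHH a (tHH b 1)) ?t (\<lambda>n. counit2 (R' n)) n"
    by (rule conv_map[where \<phi> = "\<lambda>x. x", symmetric, THEN fun_cong])
      (simp_all add: biadditive_def mult2_add HH_add counit_add bounded_R'
        upper_bounded_taylor_coeff[OF V_space(2)])
  also have "\<dots> = ?t n"
    unfolding counit2_R' by (subst conv_delta_right) (simp_all add: biadditive_def mult2_add HH_add mult2_one)
  finally show ?thesis by (simp add: taylor_coeff_def)
qed

end

section \<open>Expansions over \<open>H\<close>\<close>

context spectral_bialgebra
begin

text \<open>The left hexagon for all powers of \<open>z\<close> at once, with \<open>R'\<close>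
  evaluated at \<open>z + w\<close> on legs 1 and 3 and at \<open>w\<close> on legs 2 and 3. For
  negative powers both sides vanish.\<close>

lemma two_var_hexagon_left:
  "two_var (\<lambda>m n. cop_left tHH tHHH (\<lambda>x. DH x m) (R' n)) =
    conv (\<lambda>a b. mult3 tHH tHHH (l13 a) (l23 b))
      (taylor_expand sHH 1 (on_third R')) (taylor_expand sHH 1 (on_second R'))"
proof -
  have f: "biadditive (\<lambda>a b. mult3 tHH tHHH (l13 a) (l23 b))"
    by (simp add: biadditive_def mult3_add leg_add)
  have zero: "cop_left tHH tHHH (\<lambda>x. DH x m) y = 0" if "m < 0" for m y
    by (induct y rule: V2.tensor_induct,
        unfold cop_left_tensor[OF linear_DH] linear_add[OF linear_cop_left[OF linear_DH]])
      (simp_all add: DH_neg[OF that] biadditiveD(3)[OF bilinear_map_biadditive[OF V3.bilinear_t]])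
  have V: "upper_bounded (two_var (\<lambda>m n. if m < 0 then 0 else taylor_coeff sHH 1 (nat m) R' n))"
    unfolding taylor_expand_on_third[OF V_space(2), symmetric]
    by (rule upper_bounded_taylor_expand[OF upper_bounded_on(3)[OF bounded_R']])
  show ?thesis
    unfolding taylor_expand_on_third[OF V_space(2)] taylor_expand_on_second[OF V_space(2)]
      conv_two_var_const_right[OF f bounded_R' V]
  proof (rule two_var_cong)
    fix m n
    show "cop_left tHH tHHH (\<lambda>x. DH x m) (R' n) = conv (\<lambda>a b. mult3 tHH tHHH (l13 a) (l23 b))
        (\<lambda>n. if m < 0 then 0 else taylor_coeff sHH 1 (nat m) R' n) R' n"
    proof (cases "m < 0")
      case True
      then show ?thesis by (simp add: zero conv_def)
    next
      case False
      then show ?thesis using hexagon_left'[of "nat m" n] by simp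
    qed
  qed
qed

text \<open>Here the two variables are \<open>w\<close> and \<open>u\<close>: \<open>R'\<close> is
  evaluated at \<open>u - w\<close> on legs 1 and 2 and at \<open>u\<close> on legs 1 and 3.\<close>

lemma two_var_hexagon_right:
  "two_var (\<lambda>m n. cop_right tHH tHHH (\<lambda>x. DH x m) (R' n)) =
    conv (\<lambda>a b. mult3 tHH tHHH (l12 a) (l13 b))
      (taylor_expand sHH (- 1) (on_third R')) (taylor_expand sHH (- 1) (on_second R'))"
proof -
  have f: "biadditive (\<lambda>a b. mult3 tHH tHHH (l12 a) (l13 b))"
    by (simp add: biadditive_def mult3_add leg_add)
  have zero: "cop_right tHH tHHH (\<lambda>x. DH x m) y = 0" if "m < 0" for m y
    by (induct y rule: V2.tensor_induct,
        unfold cop_right_tensor[OF linear_DH] linear_add[OF linear_cop_right[OF linear_DH]])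
      (simp_all add: DH_neg[OF that] biadditiveD(4)[OF bilinear_map_biadditive[OF bilinear_reassoc]])
  have V: "upper_bounded (two_var (\<lambda>m n. if m < 0 then 0 else taylor_coeff sHH (- 1) (nat m) R' n))"
    unfolding taylor_expand_on_third[OF V_space(2), symmetric]
    by (rule upper_bounded_taylor_expand[OF upper_bounded_on(3)[OF bounded_R']])
  show ?thesis
    unfolding taylor_expand_on_third[OF V_space(2)] taylor_expand_on_second[OF V_space(2)]
      conv_two_var_const_right[OF f bounded_R' V]
  proof (rule two_var_cong)
    fix m n
    show "cop_right tHH tHHH (\<lambda>x. DH x m) (R' n) = conv (\<lambda>a b. mult3 tHH tHHH (l12 a) (l13 b))
        (\<lambda>n. if m < 0 then 0 else taylor_coeff sHH (- 1) (nat m) R' n) R' n"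
    proof (cases "m < 0")
      case True
      then show ?thesis by (simp add: zero conv_def)
    next
      case False
      then show ?thesis using hexagon_right'[of "nat m" n] by simp
    qed
  qed
qed

section \<open>Weak coassociativity of \<open>H\<close>\<close>

definition derivation2 :: "'hh \<Rightarrow> 'hh" where
  "derivation2 x = tmap tHH tHH TH id x + tmap tHH tHH id TH x"

abbreviation "TH2_power \<equiv> divided_power sHH derivation2"

lemma linear_derivation2: "Vector_Spaces.linear sHH sHH derivation2"
  and derivation2_tensor: "derivation2 (tHH a b) = tHH (TH a) b + tHH a (TH b)"
proof -
  show "Vector_Spaces.linear sHH sHH derivation2"
    unfolding derivation2_def[abs_def]
    by (intro linear_plus linear_tmap[OF HH_tensor HH_tensor] linear_TH linear_id V_space)
  show "derivation2 (tHH a b) = tHH (TH a) b + tHH a (TH b)"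
    by (simp add: derivation2_def tmap_tensor[OF HH_tensor HH_tensor linear_TH linear_id[OF V_space(1)]]
      tmap_tensor[OF HH_tensor HH_tensor linear_id[OF V_space(1)] linear_TH])
qed

lemmas linear_TH2_power = linear_divided_power[OF linear_derivation2]

lemma TH2_power_tensor: "TH2_power n (tHH a b) = conv tHH (\<lambda>i. TH_power i a) (\<lambda>j. TH_power j b) n"
  by (rule divided_power_Leibniz[OF V2.bilinear_t linear_TH linear_TH linear_derivation2 derivation2_tensor])

lemma \<Delta>H_TH_power: "\<Delta>H (TH_power n x) = TH2_power n (\<Delta>H x)"
proof -
  have "\<Delta>H ((TH ^^ k) x) = (derivation2 ^^ k) (\<Delta>H x)" for k
    by (induction k) (simp_all add: coderivation_TH derivation2_def)
  then show ?thesis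
    by (simp add: divided_power_def linear_scale[OF linear_\<Delta>H] linear_zero[OF linear_\<Delta>H])
qed

text \<open>The coefficient of \<open>z^m w^n\<close> in the operator that applies the exponential
  of \<open>(z + w) T\<close> to the first leg and that of \<open>w T\<close> to the second.
  \<open>right_expansion\<close> is the same operator with \<open>z + w\<close> replaced by
  \<open>u\<close>, where \<open>m\<close> is the exponent of \<open>w\<close> and \<open>n\<close>
  that of \<open>u\<close>.\<close>

definition left_expansion :: "int \<Rightarrow> int \<Rightarrow> 'hhh \<Rightarrow> 'hhh" where
  "left_expansion m n = tmap tHHH tHHH (\<lambda>v. shift_left m (TH2_power n v)) id"

definition right_expansion :: "int \<Rightarrow> int \<Rightarrow> 'hhh \<Rightarrow> 'hhh" where
  "right_expansion m n = tmap tHHH tHHH (tmap tHH tHH (TH_power n) (TH_power m)) id"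

lemma linear_left_expansion: "Vector_Spaces.linear sHHH sHHH (left_expansion m n)"
  and left_expansion_tensor:
    "left_expansion m n (tHHH v c) = tHHH (shift_left m (TH2_power n v)) c"
proof -
  note l = linear_comp[OF linear_shift_left linear_TH2_power] linear_id[OF V_space(1)]
  show "Vector_Spaces.linear sHHH sHHH (left_expansion m n)"
    unfolding left_expansion_def by (intro linear_tmap[OF HHH_tensor HHH_tensor] l)
  show "left_expansion m n (tHHH v c) = tHHH (shift_left m (TH2_power n v)) c"
    unfolding left_expansion_def by (rule trans[OF tmap_tensor[OF HHH_tensor HHH_tensor l]]) simp
qed

lemma linear_right_expansion: "Vector_Spaces.linear sHHH sHHH (right_expansion m n)"
  and right_expansion_tensor:
    "right_expansion m n (tHHH (tHH a b) c) = tHHH (tHH (TH_power n a) (TH_power m b)) c"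
proof -
  note l = linear_tmap[OF HH_tensor HH_tensor linear_TH_power[of n] linear_TH_power[of m]]
    linear_id[OF V_space(1)]
  show "Vector_Spaces.linear sHHH sHHH (right_expansion m n)"
    unfolding right_expansion_def by (intro linear_tmap[OF HHH_tensor HHH_tensor] l)
  show "right_expansion m n (tHHH (tHH a b) c) = tHHH (tHH (TH_power n a) (TH_power m b)) c"
    unfolding right_expansion_def
    by (rule trans[OF tmap_tensor[OF HHH_tensor HHH_tensor l]])
      (simp add: tmap_tensor[OF HH_tensor HH_tensor linear_TH_power linear_TH_power])
qed

lemma cop_left_DH: "cop_left tHH tHHH (\<lambda>x. DH x m) (DH x n) =
    left_expansion m n (cop_left tHH tHHH \<Delta>H (\<Delta>H x))"
proof -
  have "cop_left tHH tHHH (\<lambda>x. DH x m) (shift_left n w) = left_expansion m n (cop_left tHH tHHH \<Delta>H w)" for w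
    by (rule V2.linear_eqI[OF linear_comp[OF linear_cop_left[OF linear_DH] linear_shift_left]
        linear_comp[OF linear_left_expansion linear_cop_left[OF linear_\<Delta>H]]])
      (unfold shift_left_tensor cop_left_tensor[OF linear_DH] cop_left_tensor[OF linear_\<Delta>H]
        left_expansion_tensor, simp add: DH_eq \<Delta>H_TH_power)
  then show ?thesis by (simp add: DH_eq)
qed

lemma cop_right_DH: "cop_right tHH tHHH (\<lambda>x. DH x m) (DH x n) =
    right_expansion m n (cop_left tHH tHHH \<Delta>H (\<Delta>H x))"
proof -
  have re: "reassoc (TH_power n a) (shift_left m v) = right_expansion m n (reassoc a v)" for a v
    by (rule V2.linear_eqI[OF linear_comp[OF linear_bilinear_right[OF bilinear_reassoc linear_ident[OF V_space(2)]] linear_shift_left]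
        linear_comp[OF linear_right_expansion linear_bilinear_right[OF bilinear_reassoc linear_ident[OF V_space(2)]]]])
      (simp add: shift_left_tensor reassoc_tensor right_expansion_tensor)
  have "cop_right tHH tHHH (\<lambda>x. DH x m) (shift_left n w) = right_expansion m n (cop_right tHH tHHH \<Delta>H w)" for w
    by (rule V2.linear_eqI[OF linear_comp[OF linear_cop_right[OF linear_DH] linear_shift_left]
        linear_comp[OF linear_right_expansion linear_cop_right[OF linear_\<Delta>H]]])
      (unfold shift_left_tensor cop_right_tensor[OF linear_DH] cop_right_tensor[OF linear_\<Delta>H],
        simp add: re DH_eq)
  then show ?thesis by (simp add: DH_eq coassociative)
qed

text \<open>With coassociativity used up, all that remains to expand is the pair of exponentials on
  the first two legs, one pure tensor at a time.\<close>

lemma expansions_of_HHH: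
  obtains C where "upper_bounded C"
    "taylor_expand sHHH 1 C = two_var (\<lambda>m n. left_expansion m n y)"
    "taylor_expand sHHH (- 1) (rotate_index C) = two_var (\<lambda>m n. right_expansion m n y)"
proof -
  have "\<exists>C. upper_bounded C \<and> taylor_expand sHHH 1 C = two_var (\<lambda>m n. left_expansion m n y) \<and>
    taylor_expand sHHH (- 1) (rotate_index C) = two_var (\<lambda>m n. right_expansion m n y)"
  proof (induct y rule: tensor3_induct)
    case (add x y)
    then obtain C D where C: "upper_bounded C"
        "taylor_expand sHHH 1 C = two_var (\<lambda>m n. left_expansion m n x)"
        "taylor_expand sHHH (- 1) (rotate_index C) = two_var (\<lambda>m n. right_expansion m n x)"
      and D: "upper_bounded D"
        "taylor_expand sHHH 1 D = two_var (\<lambda>m n. left_expansion m n y)"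
        "taylor_expand sHHH (- 1) (rotate_index D) = two_var (\<lambda>m n. right_expansion m n y)"
      by blast
    have r: "rotate_index (\<lambda>x. C x + D x) = (\<lambda>x. rotate_index C x + rotate_index D x)"
      by (auto simp: rotate_index_def)
    show ?case
    proof (intro exI[of _ "\<lambda>x. C x + D x"] conjI)
      show "taylor_expand sHHH 1 (\<lambda>x. C x + D x) = two_var (\<lambda>m n. left_expansion m n (x + y))"
        by (rule ext) (simp add: taylor_expand_add[OF V_space(3)] C D linear_add[OF linear_left_expansion]
            two_var_def case_prod_unfold)
      show "taylor_expand sHHH (- 1) (rotate_index (\<lambda>x. C x + D x)) =
          two_var (\<lambda>m n. right_expansion m n (x + y))"
        unfolding r
        by (rule ext) (simp add: taylor_expand_add[OF V_space(3)] C D linear_add[OF linear_right_expansion]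
            upper_bounded_rotate_index two_var_def case_prod_unfold)
    qed (rule upper_bounded_add[OF C(1) D(1)])
  next
    case (tensor a b c)
    let ?f = "\<lambda>u v. tHHH (tHH u v) c"
    let ?a = "\<lambda>n. TH_power n a" and ?b = "\<lambda>n. TH_power n b"
    \<comment> \<open>The exponential acting on \<open>a\<close> depends on \<open>z + w\<close> and
      the one acting on \<open>b\<close> on \<open>w\<close>, which dictates the axes.\<close>
    let ?C = "conv ?f (on_third ?a) (on_second ?b)"
    have f: "bilinear_map sH sH sHHH ?f"
      by (intro bilinear_mapI linear_bilinear_left[OF V3.bilinear_t] linear_bilinear_left[OF V2.bilinear_t]
          linear_bilinear_right[OF V2.bilinear_t] linear_ident V_space)
    note fa = bilinear_map_biadditive[OF f]
    have bdd: "upper_bounded (on_third ?a)" "upper_bounded (on_second ?b)"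
      "upper_bounded (on_second ?a)" "upper_bounded (on_first ?b)"
      by (rule upper_bounded_on[OF bounded_TH_power])+
    have "taylor_expand sHHH 1 ?C = conv ?f (taylor_expand sH 1 (on_third ?a)) (taylor_expand sH 1 (on_second ?b))"
      by (rule taylor_expand_conv[OF f bdd(1,2)])
    also have "\<dots> = two_var (\<lambda>m n. conv ?f (\<lambda>n. if m < 0 then 0 else taylor_coeff sH 1 (nat m) ?a n) ?b n)"
      unfolding taylor_expand_on_second[OF V_space(1)]
      using conv_two_var_const_right[OF fa bounded_TH_power,
          of "\<lambda>m n. if m < 0 then 0 else taylor_coeff sH 1 (nat m) ?a n" b]
        upper_bounded_taylor_expand[OF bdd(1), of sH 1]
      by (simp add: taylor_expand_on_third[OF V_space(1)])
    also have "\<dots> = two_var (\<lambda>m n. conv (\<lambda>u v. ?f (TH_power m u) v) ?a ?b n)"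
    proof (rule two_var_cong)
      fix m n
      have "(if m < 0 then 0 else taylor_coeff sH 1 (nat m) ?a n) = TH_power m (TH_power n a)" for n
        by (simp add: taylor_coeff_def divided_power_divided_power[OF linear_TH] divided_power_neg[OF linear_TH])
      then have "conv ?f (\<lambda>n. if m < 0 then 0 else taylor_coeff sH 1 (nat m) ?a n) ?b n =
          conv ?f (\<lambda>n. TH_power m (TH_power n a)) ?b n" by simp
      also have "\<dots> = conv (\<lambda>u v. ?f (TH_power m u) v) ?a ?b n"
        by (rule conv_map[where \<psi> = "\<lambda>x. x", THEN fun_cong])
          (simp_all add: fa linear_add[OF linear_TH_power] bounded_TH_power)
      finally show "conv ?f (\<lambda>n. if m < 0 then 0 else taylor_coeff sH 1 (nat m) ?a n) ?b n =
          conv (\<lambda>u v. ?f (TH_power m u) v) ?a ?b n" .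
    qed
    also have "\<dots> = two_var (\<lambda>m n. left_expansion m n (tHHH (tHH a b) c))"
    proof (rule two_var_cong)
      fix m n
      have "left_expansion m n (tHHH (tHH a b) c) = tHHH (shift_left m (conv tHH ?a ?b n)) c"
        by (simp add: left_expansion_tensor TH2_power_tensor)
      also have "\<dots> = conv (\<lambda>u v. tHHH (shift_left m (tHH u v)) c) ?a ?b n"
        by (subst additive_conv[of "\<lambda>x. tHHH (shift_left m x) c"])
          (simp_all add: linear_add[OF linear_shift_left] HHH_add)
      finally show "conv (\<lambda>u v. ?f (TH_power m u) v) ?a ?b n = left_expansion m n (tHHH (tHH a b) c)"
        by (simp add: shift_left_tensor)
    qed
    finally have 1: "taylor_expand sHHH 1 ?C = two_var (\<lambda>m n. left_expansion m n (tHHH (tHH a b) c))" .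
    have "taylor_expand sHHH (- 1) (rotate_index ?C) =
        conv ?f (taylor_expand sH (- 1) (on_second ?a)) (taylor_expand sH (- 1) (on_first ?b))"
      unfolding rotate_index_conv rotate_index_on by (rule taylor_expand_conv[OF f bdd(3,4)])
    also have "\<dots> = conv ?f (two_var (\<lambda>m n. if m = 0 then ?a n else 0)) (two_var (\<lambda>m n. if n = 0 then ?b m else 0))"
      by (simp add: taylor_expand_on_second[OF V_space(1)] taylor_expand_on_first[OF V_space(1)])
    also have "\<dots> = conv (\<lambda>v u. ?f u v) (two_var (\<lambda>m n. if n = 0 then ?b m else 0)) (two_var (\<lambda>m n. if m = 0 then ?a n else 0))"
      by (rule conv_commute)
    also have "\<dots> = two_var (\<lambda>m n. conv (\<lambda>v u. ?f u v) ?b (\<lambda>q. if q = 0 then ?a n else 0) m)"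
    proof (rule conv_two_var_const_left)
      show "biadditive (\<lambda>v u. ?f u v)" using fa by (simp add: biadditive_def)
      show "upper_bounded (two_var (\<lambda>m n. if m = 0 then ?a n else 0))"
        using upper_bounded_taylor_expand[OF bdd(3), of sH 1]
        by (simp add: taylor_expand_on_second[OF V_space(1)])
    qed (rule bounded_TH_power)
    also have "\<dots> = two_var (\<lambda>m n. right_expansion m n (tHHH (tHH a b) c))"
    proof (rule two_var_cong)
      fix m n
      have "biadditive (\<lambda>v u. ?f u v)" using fa by (simp add: biadditive_def)
      then show "conv (\<lambda>v u. ?f u v) ?b (\<lambda>q. if q = 0 then ?a n else 0) m =
          right_expansion m n (tHHH (tHH a b) c)"
        by (simp add: conv_delta_right right_expansion_tensor)
    qed
    finally have 2: "taylor_expand sHHH (- 1) (rotate_index ?C) =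
      two_var (\<lambda>m n. right_expansion m n (tHHH (tHH a b) c))" .
    show ?case
      using 1 2 upper_bounded_conv[OF bdd(1,2)] by blast
  qed
  then show ?thesis using that by blast
qed

lemma weak_coassociativity_DH:
  obtains C where "upper_bounded C"
    "taylor_expand sHHH 1 C = two_var (\<lambda>m n. cop_left tHH tHHH (\<lambda>x. DH x m) (DH h n))"
    "taylor_expand sHHH (- 1) (rotate_index C) = two_var (\<lambda>m n. cop_right tHH tHHH (\<lambda>x. DH x m) (DH h n))"
  unfolding cop_left_DH cop_right_DH by (rule expansions_of_HHH)

text \<open>Cocommutativity lets the two middle factors of the fourfold coproduct be exchanged.\<close>

lemma middle_exchange:
  fixes sC :: "'k \<Rightarrow> 'c::ab_group_add \<Rightarrow> 'c"
  assumes Q: "bilinear_map sHH sHH sC Q" and Q': "bilinear_map sHH sHH sC Q'"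
    and ex: "\<And>a b c d. Q' (tHH a b) (tHH c d) = Q (tHH a c) (tHH b d)"
  shows "tlift tHH (\<lambda>a b. Q (\<Delta>H a) (\<Delta>H b)) (\<Delta>H x) = tlift tHH (\<lambda>a b. Q' (\<Delta>H a) (\<Delta>H b)) (\<Delta>H x)"
proof -
  \<comment> \<open>\<open>sw\<close> exchanges the first two legs and fixes every
    \<open>(\<Delta>H \<otimes> id)\<close> of something, by cocommutativity.\<close>
  define sw where "sw = tmap tHHH tHHH flip id"
  have sw: "sw (tHHH u d) = tHHH (flip u) d" "sw (x + y) = sw x + sw y" for u d x y
    unfolding sw_def using tmap_tensor[OF HHH_tensor HHH_tensor linear_flip linear_id[OF V_space(1)]]
      linear_add[OF linear_tmap[OF HHH_tensor HHH_tensor linear_flip linear_id[OF V_space(1)]]] by simp_all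
  have sw_cop: "sw (cop_left tHH tHHH \<Delta>H y) = cop_left tHH tHHH \<Delta>H y" for y
    using cocommutative by (induct y rule: V2.tensor_induct)
      (simp_all add: cop_left_tensor[OF linear_\<Delta>H] sw linear_add[OF linear_cop_left[OF linear_\<Delta>H]] flip_def)
  \<comment> \<open>\<open>P Q a\<close> reads the triple \<open>b \<otimes> c \<otimes> d\<close>
    as the last three legs of a fourfold coproduct whose first leg is \<open>a\<close>.\<close>
  define P where "P Q a = tlift tHHH (\<lambda>u d. tlift tHH (\<lambda>b c. Q (tHH a b) (tHH c d)) u)"
    for Q :: "'hh \<Rightarrow> 'hh \<Rightarrow> 'c" and a
  have P: "P Q a (tHHH (tHH b c) d) = Q (tHH a b) (tHH c d)" "P Q a (u + v) = P Q a u + P Q a v"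
    if Q: "bilinear_map sHH sHH sC Q" for Q a b c d u v
  proof -
    note li = linear_bilinear_left[OF Q] linear_bilinear_right[OF Q]
      linear_bilinear_left[OF V2.bilinear_t] linear_bilinear_right[OF V2.bilinear_t] linear_ident V_space
    have 1: "bilinear_map sH sH sC (\<lambda>b c. Q (tHH a b) (tHH c d))" for d
      by (intro bilinear_mapI li)
    have 2: "bilinear_map sHH sH sC (\<lambda>u d. tlift tHH (\<lambda>b c. Q (tHH a b) (tHH c d)) u)"
      by (intro bilinear_mapI V2.linear_tlift[OF 1] V2.linear_tlift_param[OF 1] li)
    show "P Q a (tHHH (tHH b c) d) = Q (tHH a b) (tHH c d)" "P Q a (u + v) = P Q a u + P Q a v"
      unfolding P_def by (simp_all add: V3.tlift_tensor[OF 2] V2.tlift_tensor[OF 1]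
          linear_add[OF V3.linear_tlift[OF 2]])
  qed
  \<comment> \<open>Coassociativity regroups the four legs so that the middle two come from a single
    \<open>\<Delta>H\<close>, where \<open>sw\<close> can act.\<close>
  have step: "tlift tHH (\<lambda>a b. Q (\<Delta>H a) (\<Delta>H b)) (\<Delta>H x) =
      tlift tHH (\<lambda>a w. P Q a (cop_left tHH tHHH \<Delta>H (\<Delta>H w))) (\<Delta>H x)"
    if Q: "bilinear_map sHH sHH sC Q" for Q
  proof -
    note li = linear_bilinear_left[OF Q] linear_bilinear_right[OF Q] linear_\<Delta>H linear_ident V_space
    define G where "G = tlift tHHH (\<lambda>u b. Q u (\<Delta>H b))"
    have bG: "bilinear_map sHH sH sC (\<lambda>u b. Q u (\<Delta>H b))"
      by (intro bilinear_mapI li)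
    have G: "G (tHHH u b) = Q u (\<Delta>H b)" "Vector_Spaces.linear sHHH sC G" for u b
      unfolding G_def using V3.tlift_tensor[OF bG] V3.linear_tlift[OF bG] by simp_all
    have bQ: "bilinear_map sH sH sC (\<lambda>a b. Q (\<Delta>H a) (\<Delta>H b))"
      by (intro bilinear_mapI li)
    have bR: "bilinear_map sH sH sC (\<lambda>a w. G (reassoc a (\<Delta>H w)))"
      by (intro bilinear_mapI linear_comp[OF G(2)] linear_bilinear_left[OF bilinear_reassoc]
          linear_bilinear_right[OF bilinear_reassoc] li)
    have 1: "G (cop_left tHH tHHH \<Delta>H y) = tlift tHH (\<lambda>a b. Q (\<Delta>H a) (\<Delta>H b)) y" for y
      by (rule V2.linear_eqI[OF linear_comp[OF G(2) linear_cop_left[OF linear_\<Delta>H]] V2.linear_tlift[OF bQ]])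
        (simp add: cop_left_tensor[OF linear_\<Delta>H] G V2.tlift_tensor[OF bQ])
    have 2: "G (cop_right tHH tHHH \<Delta>H y) = tlift tHH (\<lambda>a w. G (reassoc a (\<Delta>H w))) y" for y
      by (rule V2.linear_eqI[OF linear_comp[OF G(2) linear_cop_right[OF linear_\<Delta>H]] V2.linear_tlift[OF bR]])
        (simp add: cop_right_tensor[OF linear_\<Delta>H] V2.tlift_tensor[OF bR])
    have 3: "P Q a (reassoc b v) = Q (tHH a b) v" for a b v
      by (induct v rule: V2.tensor_induct)
        (simp_all add: reassoc_tensor P[OF Q] bilinear_mapD[OF bilinear_reassoc] bilinear_mapD[OF Q])
    have 4: "G (reassoc a v) = P Q a (cop_right tHH tHHH \<Delta>H v)" for a v
      by (induct v rule: V2.tensor_induct)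
        (simp_all add: reassoc_tensor G(1) linear_add[OF G(2)] cop_right_tensor[OF linear_\<Delta>H] 3 P(2)[OF Q]
          bilinear_mapD[OF bilinear_reassoc] linear_add[OF linear_cop_right[OF linear_\<Delta>H]])
    have "tlift tHH (\<lambda>a b. Q (\<Delta>H a) (\<Delta>H b)) (\<Delta>H x) = G (cop_left tHH tHHH \<Delta>H (\<Delta>H x))"
      by (simp only: 1)
    also have "\<dots> = tlift tHH (\<lambda>a w. G (reassoc a (\<Delta>H w))) (\<Delta>H x)"
      by (simp only: 2 coassociative)
    finally show ?thesis by (simp only: 4 coassociative)
  qed
  have "P Q a (sw y) = P Q' a y" for a y
    by (induct y rule: tensor3_induct) (simp_all add: P[OF Q] P[OF Q'] sw flip_tensor ex)
  then have "P Q a (cop_left tHH tHHH \<Delta>H y) = P Q' a (cop_left tHH tHHH \<Delta>H y)" for a y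
    by (metis sw_cop)
  then show ?thesis
    by (simp only: step[OF Q] step[OF Q'])
qed

end

section \<open>The smash product algebra\<close>

locale smash_product =
  braided_vertex_bialgebra sH sHH sHHH tHH tHHH \<Delta>H \<epsilon>H TH R sB sBB sBBB tBB tBBB \<Delta>B TB \<epsilon>B act +
  A: tensor_product sB sH sA tA + A: tensor_powers sA sAA sAAA tAA tAAA
  for sH :: "'k::field_char_0 \<Rightarrow> 'h::comm_ring_1 \<Rightarrow> 'h"
  and sHH :: "'k \<Rightarrow> 'hh::ab_group_add \<Rightarrow> 'hh"
  and sHHH :: "'k \<Rightarrow> 'hhh::ab_group_add \<Rightarrow> 'hhh"
  and tHH :: "'h \<Rightarrow> 'h \<Rightarrow> 'hh"
  and tHHH :: "'hh \<Rightarrow> 'h \<Rightarrow> 'hhh"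
  and \<Delta>H :: "'h \<Rightarrow> 'hh"
  and \<epsilon>H :: "'h \<Rightarrow> 'k"
  and TH :: "'h \<Rightarrow> 'h"
  and R :: "int \<Rightarrow> 'hh"
  and sB :: "'k \<Rightarrow> 'b::ring \<Rightarrow> 'b"
  and sBB :: "'k \<Rightarrow> 'bb::ab_group_add \<Rightarrow> 'bb"
  and sBBB :: "'k \<Rightarrow> 'bbb::ab_group_add \<Rightarrow> 'bbb"
  and tBB :: "'b \<Rightarrow> 'b \<Rightarrow> 'bb"
  and tBBB :: "'bb \<Rightarrow> 'b \<Rightarrow> 'bbb"
  and \<Delta>B :: "'b \<Rightarrow> int \<Rightarrow> 'bb"
  and TB :: "'b \<Rightarrow> 'b"
  and \<epsilon>B :: "'b \<Rightarrow> 'k"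
  and act :: "'h \<Rightarrow> 'b \<Rightarrow> 'b"
  and sA :: "'k \<Rightarrow> 'a::ab_group_add \<Rightarrow> 'a"
  and sAA :: "'k \<Rightarrow> 'aa::ab_group_add \<Rightarrow> 'aa"
  and sAAA :: "'k \<Rightarrow> 'aaa::ab_group_add \<Rightarrow> 'aaa"
  and tA :: "'b \<Rightarrow> 'h \<Rightarrow> 'a"
  and tAA :: "'a \<Rightarrow> 'a \<Rightarrow> 'aa"
  and tAAA :: "'aa \<Rightarrow> 'a \<Rightarrow> 'aaa"
begin

abbreviation "D \<equiv> H.DH"
abbreviation "\<mu> \<equiv> smash_mult tHH \<Delta>H act tA"
abbreviation "\<Delta>A \<equiv> smash_coproduct sHH tHH \<Delta>H TH R tBB \<Delta>B act tA tAA"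
abbreviation "TA \<equiv> smash_translation TB TH tA"
abbreviation "\<epsilon>A \<equiv> smash_covacuum \<epsilon>B \<epsilon>H tA"

lemmas A_tensor = A.tensor_product_axioms
lemmas AA_tensor = A.V2.tensor_product_axioms
lemmas AAA_tensor = A.V3.tensor_product_axioms
lemmas BB_tensor = B.V2.tensor_product_axioms
lemmas BBB_tensor = B.V3.tensor_product_axioms
lemmas spaces = H.V_space B.V_space A.V_space

lemmas bil_li = linear_bilinear_left[OF A.bilinear_t] linear_bilinear_right[OF A.bilinear_t]
  linear_bilinear_left[OF A.V2.bilinear_t] linear_bilinear_right[OF A.V2.bilinear_t]
  linear_bilinear_left[OF H.V2.bilinear_t] linear_bilinear_right[OF H.V2.bilinear_t]
  linear_bilinear_left[OF B.V2.bilinear_t] linear_bilinear_right[OF B.V2.bilinear_t]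
  linear_bilinear_left[OF bilinear_act] linear_bilinear_right[OF bilinear_act]
  linear_ident spaces

lemmas tensor_add = bilinear_mapD(1,2)[OF A.bilinear_t] bilinear_mapD(1,2)[OF A.V2.bilinear_t]
  bilinear_mapD(1,2)[OF A.V3.bilinear_t] H.HH_add H.HHH_add bilinear_mapD(1,2)[OF B.V2.bilinear_t]
  bilinear_mapD(1,2)[OF B.V3.bilinear_t] bilinear_mapD(1,2)[OF bilinear_act]
  bilinear_mapD(1,2)[OF H.bilinear_mul] bilinear_mapD(1,2)[OF B.bilinear_mul]

definition hact :: "'hh \<Rightarrow> 'a \<Rightarrow> 'a" where "hact = tmap2 tHH tA tA act (*)"

lemma bilinear_hact: "bilinear_map sHH sA sA hact"
  unfolding hact_def by (rule bilinear_tmap2[OF H.HH_tensor A_tensor A_tensor bilinear_act H.bilinear_mul])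

lemma hact_tensor: "hact (tHH x y) (tA b h) = tA (act x b) (y * h)"
  unfolding hact_def by (rule tmap2_tensor[OF H.HH_tensor A_tensor A_tensor bilinear_act H.bilinear_mul])

definition L :: "'h \<Rightarrow> 'a \<Rightarrow> 'a" where "L x = hact (tHH x 1)"
definition M :: "'h \<Rightarrow> 'a \<Rightarrow> 'a" where "M x = hact (tHH 1 x)"
text \<open>Left multiplication by \<open>1 \<otimes> x\<close> in the smash product, in a form that
  does not mention a unit of \<open>B\<close>.\<close>

definition diag :: "'h \<Rightarrow> 'a \<Rightarrow> 'a" where "diag x = hact (\<Delta>H x)"
text \<open>Left multiplication by \<open>b \<otimes> 1\<close>. Every left multiplication by a pure
  tensor is \<open>lmul\<close> composed with \<open>diag\<close>.\<close>

definition lmul :: "'b \<Rightarrow> 'a \<Rightarrow> 'a" where "lmul b = tlift tA (\<lambda>b' h. tA (b * b') h)"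

lemma bilinear_L: "bilinear_map sH sA sA L"
  and bilinear_M: "bilinear_map sH sA sA M"
  and bilinear_diag: "bilinear_map sH sA sA diag"
  unfolding L_def[abs_def] M_def[abs_def] diag_def[abs_def]
  by (intro bilinear_mapI linear_bilinear_left[OF bilinear_hact] linear_bilinear_right[OF bilinear_hact]
      H.linear_\<Delta>H bil_li)+

lemma bilinear_lmul: "bilinear_map sB sA sA lmul"
  and lmul_tensor: "lmul b (tA b' h) = tA (b * b') h"
proof -
  have bil: "bilinear_map sB sH sA (\<lambda>b' h. tA (b * b') h)" for b
    by (intro bilinear_mapI linear_bilinear_left[OF B.bilinear_mul] linear_bilinear_right[OF B.bilinear_mul] bil_li)
  show "bilinear_map sB sA sA lmul"
    unfolding lmul_def[abs_def]
    by (intro bilinear_mapI A.linear_tlift[OF bil] A.linear_tlift_param[OF bil]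
        linear_bilinear_left[OF B.bilinear_mul] linear_bilinear_right[OF B.bilinear_mul] bil_li)
  show "lmul b (tA b' h) = tA (b * b') h"
    unfolding lmul_def by (rule A.tlift_tensor[OF bil])
qed

lemma L_tensor: "L x (tA b h) = tA (act x b) h"
  and M_tensor: "M x (tA b h) = tA b (x * h)"
  by (simp_all add: L_def M_def hact_tensor act_one)

lemmas op_add = bilinear_mapD(1,2)[OF bilinear_hact] bilinear_mapD(1,2)[OF bilinear_L]
  bilinear_mapD(1,2)[OF bilinear_M] bilinear_mapD(1,2)[OF bilinear_diag]
  bilinear_mapD(1,2)[OF bilinear_lmul]

lemmas op_li = linear_bilinear_left[OF bilinear_hact] linear_bilinear_right[OF bilinear_hact]
  linear_bilinear_left[OF bilinear_L] linear_bilinear_right[OF bilinear_L]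
  linear_bilinear_left[OF bilinear_M] linear_bilinear_right[OF bilinear_M]
  linear_bilinear_left[OF bilinear_diag] linear_bilinear_right[OF bilinear_diag]
  linear_bilinear_left[OF bilinear_lmul] linear_bilinear_right[OF bilinear_lmul]

lemma smash_mult_eq: "\<mu> x y = tlift tA (\<lambda>b h. lmul b (diag h y)) x"
proof -
  have "tlift tA (\<lambda>b' h'. tlift tHH (\<lambda>h1 h2. tA (b * act h1 b') (h2 * h')) u) y = lmul b (hact u y)" for b u
  proof -
    have "tlift tHH (\<lambda>h1 h2. tA (b * act h1 b') (h2 * h')) u = lmul b (hact u (tA b' h'))" for b' h'
    proof -
      have "Vector_Spaces.linear sHH sA (\<lambda>u. lmul b (hact u (tA b' h')))"
        by (intro op_li bil_li)
      from H.V2.linear_eq_tlift[OF this] show ?thesis by (simp add: hact_tensor lmul_tensor)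
    qed
    moreover have "Vector_Spaces.linear sA sA (\<lambda>y. lmul b (hact u y))"
      by (intro op_li bil_li)
    from A.linear_eq_tlift[OF this]
    have "tlift tA (\<lambda>b' h'. lmul b (hact u (tA b' h'))) y = lmul b (hact u y)" .
    ultimately show ?thesis by simp
  qed
  then show ?thesis by (simp add: smash_mult_def diag_def)
qed

lemma bilinear_smash_aux: "bilinear_map sB sH sA (\<lambda>b h. lmul b (diag h y))"
  by (intro bilinear_mapI op_li bil_li)

lemma bilinear_smash_mult: "bilinear_map sA sA sA \<mu>"
proof -
  have "bilinear_map sA sA sA (\<lambda>x y. tlift tA (\<lambda>b h. lmul b (diag h y)) x)"
    by (intro bilinear_mapI A.linear_tlift[OF bilinear_smash_aux]
        A.linear_tlift_param[OF bilinear_smash_aux] op_li bil_li)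
  then show ?thesis by (simp add: smash_mult_eq[abs_def])
qed

lemma smash_mult_tensor: "\<mu> (tA b h) y = lmul b (diag h y)"
  unfolding smash_mult_eq by (rule A.tlift_tensor[OF bilinear_smash_aux])

lemmas mu_add = bilinear_mapD(1,2)[OF bilinear_smash_mult]

lemma hact_hact: "hact u (hact v a) = hact (mult2 tHH u v) a"
  by (induct u rule: H.V2.tensor_induct, induct v rule: H.V2.tensor_induct, induct a rule: A.tensor_induct)
    (simp_all add: hact_tensor H.mult2_tensor H.mult2_add op_add act_mult mult.assoc)

lemma mult2_commute: "mult2 tHH u v = mult2 tHH v u"
  by (induct u rule: H.V2.tensor_induct, induct v rule: H.V2.tensor_induct)
    (simp_all add: H.mult2_tensor H.mult2_add mult.commute)

lemma hact_commute: "hact u (hact v a) = hact v (hact u a)"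
  by (simp add: hact_hact mult2_commute)

lemma diag_mult: "diag (x * y) a = diag x (diag y a)"
  by (simp add: diag_def hact_hact H.\<Delta>H_mult mult2_def)

lemma hact_one: "hact (tHH 1 1) a = a"
  by (induct a rule: A.tensor_induct) (simp_all add: hact_tensor act_one op_add)

lemma diag_one: "diag 1 a = a"
  by (simp add: diag_def H.\<Delta>H_one hact_one)

lemma lmul_lmul: "lmul b (lmul b' a) = lmul (b * b') a"
  by (induct a rule: A.tensor_induct) (simp_all add: lmul_tensor op_add mult.assoc)

lemma M_lmul: "M x (lmul b a) = lmul b (M x a)"
  by (induct a rule: A.tensor_induct) (simp_all add: lmul_tensor M_tensor op_add)

lemma L_lmul: "L x (lmul b a) = tlift tHH (\<lambda>x1 x2. lmul (act x1 b) (L x2 a)) (\<Delta>H x)"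
proof -
  have bil: "bilinear_map sH sH sA (\<lambda>x1 x2. lmul (act x1 b) (L x2 a))" for a
    by (intro bilinear_mapI op_li bil_li)
  have lin: "Vector_Spaces.linear sA sA (\<lambda>a. tlift tHH (\<lambda>x1 x2. lmul (act x1 b) (L x2 a)) (\<Delta>H x))"
    by (intro H.V2.linear_tlift_param[OF bil] op_li bil_li)
  show ?thesis
  proof (rule A.linear_eqI[where f = "\<lambda>a. L x (lmul b a)", OF _ lin])
    show "Vector_Spaces.linear sA sA (\<lambda>a. L x (lmul b a))" by (intro op_li bil_li)
    fix b' h
    have bil2: "bilinear_map sH sH sB (\<lambda>x1 x2. act x1 b * act x2 b')"
      by (intro bilinear_mapI linear_bilinear_left[OF B.bilinear_mul] linear_bilinear_right[OF B.bilinear_mul] bil_li)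
    have "tA (tlift tHH (\<lambda>x1 x2. act x1 b * act x2 b') u) h =
        tlift tHH (\<lambda>x1 x2. lmul (act x1 b) (L x2 (tA b' h))) u" for u
      by (rule H.V2.linear_eqI[OF linear_bilinear_left[OF A.bilinear_t H.V2.linear_tlift[OF bil2]] H.V2.linear_tlift[OF bil]])
        (unfold H.V2.tlift_tensor[OF bil] H.V2.tlift_tensor[OF bil2], simp add: lmul_tensor L_tensor)
    then show "L x (lmul b (tA b' h)) = tlift tHH (\<lambda>x1 x2. lmul (act x1 b) (L x2 (tA b' h))) (\<Delta>H x)"
      by (simp add: lmul_tensor L_tensor act_product)
  qed
qed

lemma hact_L_M: "hact (tHH x y) a = L x (M y a)"
  by (induct a rule: A.tensor_induct) (simp_all add: hact_tensor L_tensor M_tensor op_add)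

lemma L_M_commute: "L x (M y a) = M y (L x a)"
  unfolding L_def M_def by (rule hact_commute)

text \<open>The first leg of \<open>\<Delta>H x\<close> is split when it acts on a product in
  \<open>B\<close>, and the second leg passes through \<open>lmul\<close>. Coassociativity regroups
  the last two of the three legs into \<open>diag\<close>.\<close>

lemma diag_lmul: "diag x (lmul b a) = tlift tHH (\<lambda>x1 x2. lmul (act x1 b) (diag x2 a)) (\<Delta>H x)"
proof -
  have bil1: "bilinear_map sH sH sA (\<lambda>x1 x2. lmul (act x1 b) (hact (tHH x2 c) a))" for c
    by (intro bilinear_mapI op_li bil_li)
  have bil: "bilinear_map sHH sH sA (\<lambda>v c. tlift tHH (\<lambda>x1 x2. lmul (act x1 b) (hact (tHH x2 c) a)) v)"
    by (intro bilinear_mapI H.V2.linear_tlift[OF bil1] H.V2.linear_tlift_param[OF bil1] op_li bil_li)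
  define G where "G = tlift tHHH (\<lambda>v c. tlift tHH (\<lambda>x1 x2. lmul (act x1 b) (hact (tHH x2 c) a)) v)"
  have G: "G (tHHH v c) = tlift tHH (\<lambda>x1 x2. lmul (act x1 b) (hact (tHH x2 c) a)) v"
    and G_lin: "Vector_Spaces.linear sHHH sA G" for v c
    unfolding G_def by (rule H.V3.tlift_tensor[OF bil], rule H.V3.linear_tlift[OF bil])
  have G_re: "G (H.reassoc x1 v) = lmul (act x1 b) (hact v a)" for x1 v
    by (induct v rule: H.V2.tensor_induct)
      (simp_all add: H.reassoc_tensor G H.V2.tlift_tensor[OF bil1] linear_add[OF G_lin] op_add
        bilinear_mapD(2)[OF H.bilinear_reassoc])
  have bil3: "bilinear_map sH sH sA (\<lambda>x1 x2. lmul (act x1 b) (diag x2 a))"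
    by (intro bilinear_mapI op_li bil_li)
  have 1: "hact u (lmul b a) = G (cop_left tHH tHHH \<Delta>H u)" for u
    by (rule H.V2.linear_eqI[OF _ linear_comp[OF G_lin H.linear_cop_left[OF H.linear_\<Delta>H]]])
      (auto intro!: op_li bil_li simp: H.cop_left_tensor[OF H.linear_\<Delta>H] G hact_L_M M_lmul L_lmul)
  have 2: "tlift tHH (\<lambda>x1 x2. lmul (act x1 b) (diag x2 a)) u = G (cop_right tHH tHHH \<Delta>H u)" for u
    by (rule H.V2.linear_eqI[OF H.V2.linear_tlift[OF bil3] linear_comp[OF G_lin H.linear_cop_right[OF H.linear_\<Delta>H]]])
      (unfold H.cop_right_tensor[OF H.linear_\<Delta>H] G_re H.V2.tlift_tensor[OF bil3], simp add: diag_def)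
  show ?thesis
    by (simp add: 2 H.coassociative[symmetric] flip: 1) (simp add: diag_def)
qed

lemma smash_mult_lmul: "\<mu> (lmul b x) y = lmul b (\<mu> x y)"
  by (induct x rule: A.tensor_induct) (simp_all add: lmul_tensor smash_mult_tensor lmul_lmul mu_add op_add)

lemma smash_mult_diag: "\<mu> (diag h x) y = diag h (\<mu> x y)"
proof (induct x rule: A.tensor_induct)
  case (tensor b h')
  let ?w = "diag h' y"
  have bil: "bilinear_map sH sH sA (\<lambda>x1 x2. lmul (act x1 b) (diag x2 ?w))"
    by (intro bilinear_mapI op_li bil_li)
  have "\<mu> (hact u (tA b h')) y = tlift tHH (\<lambda>x1 x2. lmul (act x1 b) (diag x2 ?w)) u" for u
    by (rule H.V2.linear_eqI[OF _ H.V2.linear_tlift[OF bil]])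
      (auto intro!: linear_bilinear_left[OF bilinear_smash_mult] op_li bil_li
        simp: hact_tensor smash_mult_tensor H.V2.tlift_tensor[OF bil] diag_mult)
  then show ?case
    by (simp add: smash_mult_tensor diag_lmul) (simp add: diag_def)
qed (simp_all add: mu_add op_add)

text \<open>Left multiplication by \<open>x\<close> is composed of operators \<open>lmul b\<close>
  and \<open>diag h\<close>, and each of these commutes with right multiplications.\<close>

lemma smash_mult_assoc: "\<mu> (\<mu> x y) z = \<mu> x (\<mu> y z)"
  by (induct x rule: A.tensor_induct) (simp_all add: smash_mult_tensor smash_mult_lmul smash_mult_diag mu_add)

lemma smash_algebra: "associative_algebra sA \<mu>"
proof -
  interpret vector_space sA by (rule A.V_space)
  show ?thesis
    by unfold_locales (rule bilinear_smash_mult, rule smash_mult_assoc)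
qed

lemma smash_unit:
  assumes e: "unit_of (*) e" and act_e: "\<And>h. act h e = sB (\<epsilon>H h) e"
  shows "unit_of \<mu> (tA e 1)"
proof -
  have "lmul e x = x" for x
    by (induct x rule: A.tensor_induct) (use e in \<open>simp_all add: lmul_tensor unit_of_def op_add\<close>)
  moreover have "\<mu> x (tA e 1) = x" for x
  proof (induct x rule: A.tensor_induct)
    case (tensor b h)
    have "hact u (tA e 1) = tA e (H.counit1 u)" for u
      by (induct u rule: H.V2.tensor_induct)
        (simp_all add: hact_tensor act_e H.counit1_tensor op_add tensor_add H.counit_add
          bilinear_mapD(3,4)[OF A.bilinear_t])
    then have "diag h (tA e 1) = tA e h"
      using H.counit_left[of h] by (simp add: diag_def H.counit1_def)
    then show ?case
      using e by (simp add: smash_mult_tensor lmul_tensor unit_of_def)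
  qed (simp add: mu_add)
  ultimately show ?thesis
    by (simp add: unit_of_def smash_mult_tensor diag_one)
qed

end

section \<open>The twisted coproduct\<close>

context smash_product
begin

text \<open>The shuffle of \<open>(B \<otimes> B) \<otimes> (H \<otimes> H)\<close> onto
  \<open>A \<otimes> A\<close>.\<close>

definition \<gamma> :: "'bb \<Rightarrow> 'hh \<Rightarrow> 'aa" where "\<gamma> = tmap2 tBB tHH tAA tA tA"
definition \<rho> :: "'hh \<Rightarrow> 'aa \<Rightarrow> 'aa" where "\<rho> = tmap2 tHH tAA tAA M L"
definition LL :: "'hh \<Rightarrow> 'aa \<Rightarrow> 'aa" where "LL = tmap2 tHH tAA tAA L L"
definition MM :: "'hh \<Rightarrow> 'aa \<Rightarrow> 'aa" where "MM = tmap2 tHH tAA tAA M M"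
definition \<mu>2 :: "'aa \<Rightarrow> 'aa \<Rightarrow> 'aa" where "\<mu>2 = tmap2 tAA tAA tAA \<mu> \<mu>"
definition diag2 :: "'hh \<Rightarrow> 'aa \<Rightarrow> 'aa" where "diag2 = tmap2 tHH tAA tAA diag diag"

lemma bilinear_\<gamma>: "bilinear_map sBB sHH sAA \<gamma>"
  unfolding \<gamma>_def by (rule bilinear_tmap2[OF BB_tensor H.HH_tensor AA_tensor A.bilinear_t A.bilinear_t])
lemma \<gamma>_tensor: "\<gamma> (tBB b c) (tHH x y) = tAA (tA b x) (tA c y)"
  unfolding \<gamma>_def by (rule tmap2_tensor[OF BB_tensor H.HH_tensor AA_tensor A.bilinear_t A.bilinear_t])
lemma bilinear_\<rho>: "bilinear_map sHH sAA sAA \<rho>"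
  unfolding \<rho>_def by (rule bilinear_tmap2[OF H.HH_tensor AA_tensor AA_tensor bilinear_M bilinear_L])
lemma \<rho>_tensor: "\<rho> (tHH x y) (tAA a b) = tAA (M x a) (L y b)"
  unfolding \<rho>_def by (rule tmap2_tensor[OF H.HH_tensor AA_tensor AA_tensor bilinear_M bilinear_L])
lemma bilinear_LL: "bilinear_map sHH sAA sAA LL"
  unfolding LL_def by (rule bilinear_tmap2[OF H.HH_tensor AA_tensor AA_tensor bilinear_L bilinear_L])
lemma LL_tensor: "LL (tHH x y) (tAA a b) = tAA (L x a) (L y b)"
  unfolding LL_def by (rule tmap2_tensor[OF H.HH_tensor AA_tensor AA_tensor bilinear_L bilinear_L])
lemma bilinear_MM: "bilinear_map sHH sAA sAA MM"
  unfolding MM_def by (rule bilinear_tmap2[OF H.HH_tensor AA_tensor AA_tensor bilinear_M bilinear_M])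
lemma MM_tensor: "MM (tHH x y) (tAA a b) = tAA (M x a) (M y b)"
  unfolding MM_def by (rule tmap2_tensor[OF H.HH_tensor AA_tensor AA_tensor bilinear_M bilinear_M])
lemma bilinear_\<mu>2: "bilinear_map sAA sAA sAA \<mu>2"
  unfolding \<mu>2_def by (rule bilinear_tmap2[OF AA_tensor AA_tensor AA_tensor bilinear_smash_mult bilinear_smash_mult])
lemma \<mu>2_tensor: "\<mu>2 (tAA a b) (tAA c d) = tAA (\<mu> a c) (\<mu> b d)"
  unfolding \<mu>2_def by (rule tmap2_tensor[OF AA_tensor AA_tensor AA_tensor bilinear_smash_mult bilinear_smash_mult])
lemma bilinear_diag2: "bilinear_map sHH sAA sAA diag2"
  unfolding diag2_def by (rule bilinear_tmap2[OF H.HH_tensor AA_tensor AA_tensor bilinear_diag bilinear_diag])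
lemma diag2_tensor: "diag2 (tHH x y) (tAA a b) = tAA (diag x a) (diag y b)"
  unfolding diag2_def by (rule tmap2_tensor[OF H.HH_tensor AA_tensor AA_tensor bilinear_diag bilinear_diag])

lemmas op2_tensor = \<gamma>_tensor \<rho>_tensor LL_tensor MM_tensor \<mu>2_tensor diag2_tensor
lemmas op2_add = bilinear_mapD(1,2)[OF bilinear_\<gamma>] bilinear_mapD(1,2)[OF bilinear_\<rho>]
  bilinear_mapD(1,2)[OF bilinear_LL] bilinear_mapD(1,2)[OF bilinear_MM]
  bilinear_mapD(1,2)[OF bilinear_\<mu>2] bilinear_mapD(1,2)[OF bilinear_diag2]
lemmas op2_biadditive = bilinear_\<gamma>[THEN bilinear_map_biadditive] bilinear_\<rho>[THEN bilinear_map_biadditive]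
  bilinear_LL[THEN bilinear_map_biadditive] bilinear_MM[THEN bilinear_map_biadditive]
  bilinear_\<mu>2[THEN bilinear_map_biadditive] bilinear_diag2[THEN bilinear_map_biadditive]

definition act2 :: "'hh \<Rightarrow> 'bb \<Rightarrow> 'bb" where "act2 = tmap2 tHH tBB tBB act act"

lemma bilinear_act2: "bilinear_map sHH sBB sBB act2"
  unfolding act2_def by (rule bilinear_tmap2[OF H.HH_tensor BB_tensor BB_tensor bilinear_act bilinear_act])
lemma act2_tensor: "act2 (tHH x y) (tBB a b) = tBB (act x a) (act y b)"
  unfolding act2_def by (rule tmap2_tensor[OF H.HH_tensor BB_tensor BB_tensor bilinear_act bilinear_act])

lemma bounded_\<Delta>B: "upper_bounded (\<Delta>B b)"
  using B.laurent_coproduct by (simp add: upper_bounded_int_iff)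

lemma linear_\<Delta>B: "Vector_Spaces.linear sB sBB (\<lambda>b. \<Delta>B b n)"
  by (rule B.linear_coproduct)

lemmas bounds = bounded_\<Delta>B H.bounded_DH H.bounded_R' H.bounded_R

text \<open>The coproduct of \<open>B \<otimes> H\<close> without the twist by \<open>R\<close>.\<close>

definition \<Delta>0 :: "'a \<Rightarrow> int \<Rightarrow> 'aa" where
  "\<Delta>0 a n = tlift tA (\<lambda>b h. conv \<gamma> (\<Delta>B b) (D h) n) a"

lemma bilinear_\<Delta>0_aux: "bilinear_map sB sH sAA (\<lambda>b h. conv \<gamma> (\<Delta>B b) (D h) n)"
  by (rule conv_bilinear[OF bilinear_\<gamma>, where F = "\<lambda>i b. \<Delta>B b i" and G = "\<lambda>i h. D h i"])
    (rule linear_\<Delta>B H.linear_DH bounds)+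

lemma linear_\<Delta>0: "Vector_Spaces.linear sA sAA (\<lambda>a. \<Delta>0 a n)"
  unfolding \<Delta>0_def by (rule A.linear_tlift[OF bilinear_\<Delta>0_aux])

lemma \<Delta>0_tensor: "\<Delta>0 (tA b h) = conv \<gamma> (\<Delta>B b) (D h)"
  unfolding \<Delta>0_def by (rule ext) (rule A.tlift_tensor[OF bilinear_\<Delta>0_aux])

lemma bounded_\<Delta>0: "upper_bounded (\<Delta>0 a)"
  using upper_bounded_int_tensor_induct[where F = "\<lambda>n a. \<Delta>0 a n", OF A_tensor linear_\<Delta>0, of a]
  by (simp add: \<Delta>0_tensor upper_bounded_conv bounds)

text \<open>The second leg of \<open>R\<close> acts on the left factor, whence the flip.\<close>

lemma twist_eq: "twist tHH tBB act tA tAA r x y = \<rho> (H.flip r) (\<gamma> x y)"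
proof -
  have y: "tlift tHH (\<lambda>h1 h2. tAA (tA b1 (r2 * h1)) (tA (act r1 b2) h2)) y =
      \<rho> (tHH r2 r1) (\<gamma> (tBB b1 b2) y)" for r1 r2 b1 b2
  proof -
    have "Vector_Spaces.linear sHH sAA (\<lambda>y. \<rho> (tHH r2 r1) (\<gamma> (tBB b1 b2) y))"
      by (intro linear_bilinear_right[OF bilinear_\<rho>] linear_bilinear_right[OF bilinear_\<gamma>] bil_li)
    from H.V2.linear_eq_tlift[OF this] show ?thesis by (simp add: op2_tensor L_tensor M_tensor)
  qed
  have x: "tlift tBB (\<lambda>b1 b2. \<rho> (tHH r2 r1) (\<gamma> (tBB b1 b2) y)) x = \<rho> (tHH r2 r1) (\<gamma> x y)" for r1 r2
    by (rule B.V2.linear_eq_tlift[where s = sAA])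
      (intro linear_bilinear_right[OF bilinear_\<rho>] linear_bilinear_left[OF bilinear_\<gamma>] bil_li)
  have r: "tlift tHH (\<lambda>r1 r2. \<rho> (H.flip (tHH r1 r2)) (\<gamma> x y)) r = \<rho> (H.flip r) (\<gamma> x y)"
    by (rule H.V2.linear_eq_tlift[where s = sAA]) (intro linear_bilinear_left[OF bilinear_\<rho>] H.linear_flip)
  show ?thesis unfolding twist_def y x using r by (simp add: H.flip_tensor)
qed

lemma \<Delta>A_eq: "\<Delta>A a = conv \<rho> H.R' (\<Delta>0 a)"
proof
  fix n
  have lin: "Vector_Spaces.linear sA sAA (\<lambda>a. conv \<rho> H.R' (\<lambda>q. \<Delta>0 a q) n)"
    by (rule conv_linear_right[OF bilinear_\<rho> H.bounded_R' linear_\<Delta>0 bounded_\<Delta>0])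
  have "conv3 (twist tHH tBB act tA tAA) R (\<Delta>B b) (D h) n = conv \<rho> H.R' (\<Delta>0 (tA b h)) n" for b h
  proof -
    have f: "biadditive (\<lambda>r w. \<rho> (H.flip r) w)"
      by (simp add: biadditive_def op2_add linear_add[OF H.linear_flip])
    have "conv3 (twist tHH tBB act tA tAA) R (\<Delta>B b) (D h) =
        tconv (\<lambda>r x y. \<rho> (H.flip r) (\<gamma> x y)) R (\<Delta>B b) (D h)"
      by (simp add: conv3_eq_tconv twist_eq[abs_def])
    also have "\<dots> = conv (\<lambda>r w. \<rho> (H.flip r) w) R (conv \<gamma> (\<Delta>B b) (D h))"
      by (rule conv_conv_right[symmetric]) (rule f op2_biadditive bounds)+
    also have "\<dots> = conv \<rho> (\<lambda>n. H.flip (R n)) (conv \<gamma> (\<Delta>B b) (D h))"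
      by (rule conv_map[where \<psi> = "\<lambda>x. x", symmetric])
        (simp_all add: op2_biadditive linear_add[OF H.linear_flip] bounds upper_bounded_conv)
    finally show ?thesis by (simp add: \<Delta>0_tensor H.R'_def[abs_def])
  qed
  then show "\<Delta>A a n = conv \<rho> H.R' (\<Delta>0 a) n"
    using A.linear_eq_tlift[OF lin, of a] by (simp add: smash_coproduct_def)
qed

lemma linear_\<Delta>A: "Vector_Spaces.linear sA sAA (\<lambda>a. \<Delta>A a n)"
  unfolding \<Delta>A_eq by (rule conv_linear_right[OF bilinear_\<rho> H.bounded_R' linear_\<Delta>0 bounded_\<Delta>0])

lemma bounded_\<Delta>A: "upper_bounded (\<Delta>A a)"
  unfolding \<Delta>A_eq by (rule upper_bounded_conv[OF H.bounded_R' bounded_\<Delta>0])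

lemma \<Delta>0_L: "\<Delta>0 (L x a) n = conv LL (D x) (\<Delta>0 a) n"
proof (rule A.linear_eqI)
  show "Vector_Spaces.linear sA sAA (\<lambda>a. \<Delta>0 (L x a) n)"
    by (rule linear_comp[OF linear_\<Delta>0]) (intro op_li bil_li)
  show "Vector_Spaces.linear sA sAA (\<lambda>a. conv LL (D x) (\<Delta>0 a) n)"
    by (rule conv_linear_right[OF bilinear_LL H.bounded_DH linear_\<Delta>0 bounded_\<Delta>0])
  have e: "\<gamma> (act2 u b) y = LL u (\<gamma> b y)" for u b y
    by (induct u rule: H.V2.tensor_induct, induct b rule: B.V2.tensor_induct, induct y rule: H.V2.tensor_induct)
      (simp_all add: op2_tensor op2_add act2_tensor L_tensor bilinear_mapD(1,2)[OF bilinear_act2])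
  fix b h
  have "\<Delta>0 (L x (tA b h)) = conv \<gamma> (conv act2 (D x) (\<Delta>B b)) (D h)"
    by (simp add: L_tensor \<Delta>0_tensor act_coproduct[abs_def] conv2_eq_conv act2_def)
  also have "\<dots> = conv LL (D x) (conv \<gamma> (\<Delta>B b) (D h))"
    by (rule conv_assoc) (rule op2_biadditive bilinear_map_biadditive[OF bilinear_act2] bounds e)+
  finally show "\<Delta>0 (L x (tA b h)) n = conv LL (D x) (\<Delta>0 (tA b h)) n"
    by (simp add: \<Delta>0_tensor)
qed

text \<open>The source here is multiplicativity of the coproduct of \<open>H\<close>, whereas
  \<open>\<Delta>0_L\<close> rests on the \<open>H\<close>-linearity of that of
  \<open>B\<close>.\<close>

lemma \<Delta>0_M: "\<Delta>0 (M x a) n = conv MM (D x) (\<Delta>0 a) n"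
proof (rule A.linear_eqI)
  show "Vector_Spaces.linear sA sAA (\<lambda>a. \<Delta>0 (M x a) n)"
    by (rule linear_comp[OF linear_\<Delta>0]) (intro op_li bil_li)
  show "Vector_Spaces.linear sA sAA (\<lambda>a. conv MM (D x) (\<Delta>0 a) n)"
    by (rule conv_linear_right[OF bilinear_MM H.bounded_DH linear_\<Delta>0 bounded_\<Delta>0])
  have e: "\<gamma> b (mult2 tHH u y) = MM u (\<gamma> b y)" for u b y
    by (induct u rule: H.V2.tensor_induct, induct b rule: B.V2.tensor_induct, induct y rule: H.V2.tensor_induct)
      (simp_all add: op2_tensor op2_add H.mult2_tensor H.mult2_add M_tensor)
  fix b h
  have "\<Delta>0 (M x (tA b h)) = conv \<gamma> (\<Delta>B b) (conv (mult2 tHH) (D x) (D h))"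
    by (simp add: M_tensor \<Delta>0_tensor H.DH_mult[abs_def])
  also have "\<dots> = conv MM (D x) (conv \<gamma> (\<Delta>B b) (D h))"
    by (rule conv_left_commute) (rule op2_biadditive bilinear_map_biadditive[OF H.bilinear_mult2] bounds e)+
  finally show "\<Delta>0 (M x (tA b h)) n = conv MM (D x) (\<Delta>0 (tA b h)) n"
    by (simp add: \<Delta>0_tensor)
qed

lemma M_M_commute: "M x (M y a) = M y (M x a)" and L_L_commute: "L x (L y a) = L y (L x a)"
  unfolding L_def M_def by (rule hact_commute)+

lemma \<rho>_LL: "\<rho> r (LL u w) = LL u (\<rho> r w)"
  by (induct r rule: H.V2.tensor_induct, induct u rule: H.V2.tensor_induct, induct w rule: A.V2.tensor_induct)
    (simp_all add: op2_tensor op2_add L_M_commute L_L_commute)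

lemma \<rho>_MM: "\<rho> r (MM u w) = MM u (\<rho> r w)"
  by (induct r rule: H.V2.tensor_induct, induct u rule: H.V2.tensor_induct, induct w rule: A.V2.tensor_induct)
    (simp_all add: op2_tensor op2_add L_M_commute M_M_commute)

lemma \<Delta>A_L: "\<Delta>A (L x a) = conv LL (D x) (\<Delta>A a)"
proof -
  have "\<Delta>0 (L x a) = conv LL (D x) (\<Delta>0 a)" by (rule ext) (rule \<Delta>0_L)
  then show ?thesis unfolding \<Delta>A_eq
    by (simp add: conv_left_commute[OF op2_biadditive(2,3,2,3) H.bounded_R' H.bounded_DH bounded_\<Delta>0 \<rho>_LL])
qed

lemma \<Delta>A_M: "\<Delta>A (M x a) = conv MM (D x) (\<Delta>A a)"
proof -
  have "\<Delta>0 (M x a) = conv MM (D x) (\<Delta>0 a)" by (rule ext) (rule \<Delta>0_M)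
  then show ?thesis unfolding \<Delta>A_eq
    by (simp add: conv_left_commute[OF op2_biadditive(2,4,2,4) H.bounded_R' H.bounded_DH bounded_\<Delta>0 \<rho>_MM])
qed

section \<open>Covacuum axioms\<close>

lemma bilinear_\<epsilon>A_aux: "bilinear_map sB sH (*) (\<lambda>b h. \<epsilon>B b * \<epsilon>H h)"
proof -
  have k: "vector_space ((*) :: 'k \<Rightarrow> 'k \<Rightarrow> 'k)" by (rule linear_vector_space[OF B.linear_covacuum])
  show ?thesis
    by (intro bilinear_mapI linear_bilinear_left[OF bilinear_scale[OF k]]
        linear_bilinear_right[OF bilinear_scale[OF k]] B.linear_covacuum H.linear_\<epsilon>H)
qed

lemma linear_\<epsilon>A: "Vector_Spaces.linear sA (*) \<epsilon>A"
  and \<epsilon>A_tensor: "\<epsilon>A (tA b h) = \<epsilon>B b * \<epsilon>H h"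
  unfolding smash_covacuum_def
  by (rule A.linear_tlift[OF bilinear_\<epsilon>A_aux], rule A.tlift_tensor[OF bilinear_\<epsilon>A_aux])

lemma \<epsilon>A_M: "\<epsilon>A (M x a) = \<epsilon>H x * \<epsilon>A a"
  by (induct a rule: A.tensor_induct)
    (simp_all add: M_tensor \<epsilon>A_tensor H.\<epsilon>H_mult op_add linear_add[OF linear_\<epsilon>A] algebra_simps)

lemma \<epsilon>A_L: "\<epsilon>A (L x a) = \<epsilon>H x * \<epsilon>A a"
  by (induct a rule: A.tensor_induct)
    (simp_all add: L_tensor \<epsilon>A_tensor act_covacuum op_add linear_add[OF linear_\<epsilon>A] algebra_simps)

lemma L_one: "L 1 a = a" and M_one: "M 1 a = a"
  by (simp_all add: L_def M_def hact_one)

lemma covacuum_left: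
  "tlift tAA (\<lambda>a b. sA (\<epsilon>A a) b) (\<Delta>A a n) = (if n = 0 then a else 0)"
proof -
  define E where "E = tlift tAA (\<lambda>a b. sA (\<epsilon>A a) b)"
  define EB where "EB = tlift tBB (\<lambda>a b. sB (\<epsilon>B a) b)"
  note bA = bilinear_counit(1)[OF linear_\<epsilon>A] and bB = bilinear_counit(1)[OF B.linear_covacuum]
  have E: "E (tAA a b) = sA (\<epsilon>A a) b" and E_lin: "Vector_Spaces.linear sAA sA E" for a b
    unfolding E_def by (rule A.V2.tlift_tensor[OF bA], rule A.V2.linear_tlift[OF bA])
  have EB: "EB (tBB b c) = sB (\<epsilon>B b) c" and EB_lin: "Vector_Spaces.linear sBB sB EB" for b c
    unfolding EB_def by (rule B.V2.tlift_tensor[OF bB], rule B.V2.linear_tlift[OF bB])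
  note add = linear_add[OF E_lin] linear_add[OF EB_lin] H.counit_add op_add op2_add tensor_add
  \<comment> \<open>Under the covacuum on the left factor, \<open>M\<close> contributes only a
    scalar, so the twist acts through \<open>counit1 r\<close>, which is 1 for
    \<open>R'\<close>.\<close>
  have \<rho>: "E (\<rho> r w) = L (H.counit1 r) (E w)" for r w
    by (induct r rule: H.V2.tensor_induct, induct w rule: A.V2.tensor_induct)
      (simp_all add: op2_tensor E add H.counit1_tensor \<epsilon>A_M bilinear_mapD(3,4)[OF bilinear_L]
        vector_space.vector_space_assms(3)[OF A.V_space(1)])
  have \<gamma>: "E (\<gamma> x y) = tA (EB x) (H.counit1 y)" for x y
    by (induct x rule: B.V2.tensor_induct, induct y rule: H.V2.tensor_induct)
      (simp_all add: op2_tensor E EB add H.counit1_tensor \<epsilon>A_tensor bilinear_mapD(3,4)[OF A.bilinear_t]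
        vector_space.vector_space_assms(3)[OF A.V_space(1)])
  have EB_\<Delta>B: "EB (\<Delta>B b i) = (if i = 0 then b else 0)" for b i
    unfolding EB_def by (rule B.covacuum_left)
  have "E (\<Delta>A a n) = conv (\<lambda>r w. L (H.counit1 r) (E w)) H.R' (\<Delta>0 a) n"
    unfolding \<Delta>A_eq \<rho>[symmetric] by (rule additive_conv[OF linear_add[OF E_lin]])
  also have "\<dots> = conv L (\<lambda>n. H.counit1 (H.R' n)) (\<lambda>n. E (\<Delta>0 a n)) n"
    by (rule conv_map[symmetric, THEN fun_cong])
      (simp_all add: bilinear_map_biadditive[OF bilinear_L] add bounds bounded_\<Delta>0)
  also have "\<dots> = E (\<Delta>0 a n)"
    unfolding H.counit1_R' conv_delta_left[OF bilinear_map_biadditive[OF bilinear_L]] by (rule L_one)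
  also have "\<dots> = (if n = 0 then a else 0)"
  proof (induct a rule: A.tensor_induct)
    case (tensor b h)
    have "E (\<Delta>0 (tA b h) n) = conv (\<lambda>x y. tA (EB x) (H.counit1 y)) (\<Delta>B b) (D h) n"
      unfolding \<Delta>0_tensor \<gamma>[symmetric] by (rule additive_conv[OF linear_add[OF E_lin]])
    also have "\<dots> = conv tA (\<lambda>n. EB (\<Delta>B b n)) (\<lambda>n. H.counit1 (D h n)) n"
      by (rule conv_map[symmetric, THEN fun_cong])
        (simp_all add: bilinear_map_biadditive[OF A.bilinear_t] add bounds)
    also have "\<dots> = (if n = 0 then tA b h else 0)"
      by (simp add: EB_\<Delta>B conv_delta_left[OF bilinear_map_biadditive[OF A.bilinear_t]] H.counit1_DH
          biadditiveD(4)[OF bilinear_map_biadditive[OF A.bilinear_t]])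
    finally show ?case .
  qed (simp add: linear_add[OF linear_\<Delta>0] add)
  finally show ?thesis by (simp only: E_def)
qed

lemma covacuum_right:
  assumes "n \<le> 0"
  shows "tlift tAA (\<lambda>a b. sA (\<epsilon>A b) a) (\<Delta>A a n) = (if n = 0 then a else 0)"
proof -
  define E where "E = tlift tAA (\<lambda>a b. sA (\<epsilon>A b) a)"
  define EB where "EB = tlift tBB (\<lambda>a b. sB (\<epsilon>B b) a)"
  note bA = bilinear_counit(2)[OF linear_\<epsilon>A] and bB = bilinear_counit(2)[OF B.linear_covacuum]
  have E: "E (tAA a b) = sA (\<epsilon>A b) a" and E_lin: "Vector_Spaces.linear sAA sA E" for a b
    unfolding E_def by (rule A.V2.tlift_tensor[OF bA], rule A.V2.linear_tlift[OF bA])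
  have EB: "EB (tBB b c) = sB (\<epsilon>B c) b" and EB_lin: "Vector_Spaces.linear sBB sB EB" for b c
    unfolding EB_def by (rule B.V2.tlift_tensor[OF bB], rule B.V2.linear_tlift[OF bB])
  note add = linear_add[OF E_lin] linear_add[OF EB_lin] H.counit_add op_add op2_add tensor_add
  have \<rho>: "E (\<rho> r w) = M (H.counit2 r) (E w)" for r w
    by (induct r rule: H.V2.tensor_induct, induct w rule: A.V2.tensor_induct)
      (simp_all add: op2_tensor E add H.counit2_tensor \<epsilon>A_L bilinear_mapD(3,4)[OF bilinear_M]
        vector_space.vector_space_assms(3)[OF A.V_space(1)])
  have \<gamma>: "E (\<gamma> x y) = tA (EB x) (H.counit2 y)" for x y
    by (induct x rule: B.V2.tensor_induct, induct y rule: H.V2.tensor_induct)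
      (simp_all add: op2_tensor E EB add H.counit2_tensor \<epsilon>A_tensor bilinear_mapD(3,4)[OF A.bilinear_t]
        vector_space.vector_space_assms(3)[OF A.V_space(1)])
  have "E (\<Delta>A a n) = conv (\<lambda>r w. M (H.counit2 r) (E w)) H.R' (\<Delta>0 a) n"
    unfolding \<Delta>A_eq \<rho>[symmetric] by (rule additive_conv[OF linear_add[OF E_lin]])
  also have "\<dots> = conv M (\<lambda>n. H.counit2 (H.R' n)) (\<lambda>n. E (\<Delta>0 a n)) n"
    by (rule conv_map[symmetric, THEN fun_cong])
      (simp_all add: bilinear_map_biadditive[OF bilinear_M] add bounds bounded_\<Delta>0)
  also have "\<dots> = E (\<Delta>0 a n)"
    unfolding H.counit2_R' conv_delta_left[OF bilinear_map_biadditive[OF bilinear_M]] by (rule M_one)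
  also have "\<dots> = (if n = 0 then a else 0)"
  proof (induct a rule: A.tensor_induct)
    case (tensor b h)
    have "EB (\<Delta>B b 0) = b" unfolding EB_def by (rule B.covacuum_right_0)
    moreover have neg: "EB (\<Delta>B b i) = 0" if "i < 0" for i
      unfolding EB_def using that by (rule B.covacuum_right_neg)
    moreover have "E (\<Delta>0 (tA b h) n) = conv (\<lambda>x y. tA (EB x) (H.counit2 y)) (\<Delta>B b) (D h) n"
      unfolding \<Delta>0_tensor \<gamma>[symmetric] by (rule additive_conv[OF linear_add[OF E_lin]])
    moreover have "\<dots> = conv tA (\<lambda>n. EB (\<Delta>B b n)) (\<lambda>n. H.counit2 (D h n)) n"
      by (rule conv_map[symmetric, THEN fun_cong])
        (simp_all add: bilinear_map_biadditive[OF A.bilinear_t] add bounds)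
    \<comment> \<open>Terms with \<open>i < 0\<close> vanish by the covacuum axiom of
      \<open>B\<close>, those with \<open>i > n\<close> because \<open>D\<close> has no negative
      powers. For \<open>n \<le> 0\<close> only \<open>i = 0\<close> is left, and for
      \<open>n < 0\<close> that term vanishes as well.\<close>
    moreover have "\<dots> = (\<Sum>i\<in>{0}. tA (EB (\<Delta>B b i)) (H.counit2 (D h (n - i))))"
    proof (rule conv_eq_sum[OF bilinear_map_biadditive[OF A.bilinear_t]])
      fix i assume "EB (\<Delta>B b i) \<noteq> 0" "H.counit2 (D h (n - i)) \<noteq> 0"
      then have "i \<ge> 0" "n - i \<ge> 0"
        using neg[of i] H.DH_neg[of "n - i" h] linear_zero[OF H.linear_counit2] by (metis linorder_not_less)+
      with assms show "i \<in> {0}" by simp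
    qed simp
    ultimately show ?case
      using assms H.DH_neg[of n h]
      by (cases "n = 0") (simp_all add: H.counit2_DH divided_power_zero[OF H.linear_TH]
          linear_zero[OF H.linear_counit2] biadditiveD(4)[OF bilinear_map_biadditive[OF A.bilinear_t]]
          divided_power_neg[OF H.linear_TH])
  qed (simp add: linear_add[OF linear_\<Delta>0] add)
  finally show ?thesis by (simp only: E_def)
qed

section \<open>Translation axiom\<close>

lemma linear_TA: "Vector_Spaces.linear sA sA TA"
  and TA_tensor: "TA (tA b h) = tA (TB b) h + tA b (TH h)"
proof -
  note l1 = linear_tmap[OF A_tensor A_tensor B.linear_translation linear_id[OF H.V_space(1)]]
  note l2 = linear_tmap[OF A_tensor A_tensor linear_id[OF B.V_space(1)] H.linear_TH]
  show "Vector_Spaces.linear sA sA TA"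
    unfolding smash_translation_def[abs_def] by (rule linear_plus[OF l1 l2])
  show "TA (tA b h) = tA (TB b) h + tA b (TH h)"
    by (simp add: smash_translation_def
        tmap_tensor[OF A_tensor A_tensor B.linear_translation linear_id[OF H.V_space(1)]]
        tmap_tensor[OF A_tensor A_tensor linear_id[OF B.V_space(1)] H.linear_TH])
qed

lemma TA_L: "TA (L x a) = L (TH x) a + L x (TA a)"
  by (induct a rule: A.tensor_induct)
    (simp_all add: L_tensor TA_tensor TB_act tensor_add op_add linear_add[OF linear_TA])

definition TA2 :: "'aa \<Rightarrow> 'aa" where "TA2 = tmap tAA tAA id TA"
definition TB2 :: "'bb \<Rightarrow> 'bb" where "TB2 = tmap tBB tBB id TB"
definition TH2 :: "'hh \<Rightarrow> 'hh" where "TH2 = tmap tHH tHH id TH"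

lemma linear_T2: "Vector_Spaces.linear sAA sAA TA2" "Vector_Spaces.linear sBB sBB TB2"
    "Vector_Spaces.linear sHH sHH TH2"
  and T2_tensor: "TA2 (tAA a a') = tAA a (TA a')" "TB2 (tBB b b') = tBB b (TB b')"
    "TH2 (tHH h h') = tHH h (TH h')"
proof -
  note l = linear_id[OF A.V_space(1)] linear_id[OF B.V_space(1)] linear_id[OF H.V_space(1)]
  show "Vector_Spaces.linear sAA sAA TA2" "Vector_Spaces.linear sBB sBB TB2" "Vector_Spaces.linear sHH sHH TH2"
    unfolding TA2_def TB2_def TH2_def
    by (rule linear_tmap[OF AA_tensor AA_tensor l(1) linear_TA] linear_tmap[OF BB_tensor BB_tensor l(2) B.linear_translation]
        linear_tmap[OF H.HH_tensor H.HH_tensor l(3) H.linear_TH])+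
  show "TA2 (tAA a a') = tAA a (TA a')" "TB2 (tBB b b') = tBB b (TB b')" "TH2 (tHH h h') = tHH h (TH h')"
    unfolding TA2_def TB2_def TH2_def
    using tmap_tensor[OF AA_tensor AA_tensor l(1) linear_TA] tmap_tensor[OF BB_tensor BB_tensor l(2) B.linear_translation]
      tmap_tensor[OF H.HH_tensor H.HH_tensor l(3) H.linear_TH] by simp_all
qed

lemmas T2_add = linear_T2[THEN linear_add]

lemma TA2_conv:
  fixes n :: int
  assumes f: "biadditive f" and "\<And>x y. TA2 (f x y) = f (\<phi> x) y + f x (\<psi> y)"
    and \<phi>: "Vector_Spaces.linear s1 s1 \<phi>" and \<psi>: "Vector_Spaces.linear s2 s2 \<psi>"
    and F: "upper_bounded F" and G: "upper_bounded G"
  shows "TA2 (conv f F G n) = conv f (\<lambda>n. \<phi> (F n)) G n + conv f F (\<lambda>n. \<psi> (G n)) n"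
proof -
  have sum: "conv (\<lambda>x y. g x y + h x y) F G n = conv g F G n + conv h F G n" for g h
    by (simp add: conv_def case_prod_unfold sum.distrib)
  have "TA2 (conv f F G n) = conv (\<lambda>x y. f (\<phi> x) y + f x (\<psi> y)) F G n"
    unfolding assms(2)[symmetric] by (rule additive_conv[OF T2_add(1)])
  also have "\<dots> = conv (\<lambda>x y. f (\<phi> x) y) F G n + conv (\<lambda>x y. f x (\<psi> y)) F G n"
    by (rule sum)
  also have "conv (\<lambda>x y. f (\<phi> x) y) F G n = conv f (\<lambda>n. \<phi> (F n)) G n"
    by (rule conv_map[where \<psi> = "\<lambda>x. x", symmetric, THEN fun_cong]) (simp_all add: f linear_add[OF \<phi>] F G)
  also have "conv (\<lambda>x y. f x (\<psi> y)) F G n = conv f F (\<lambda>n. \<psi> (G n)) n"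
    by (rule conv_map[where \<phi> = "\<lambda>x. x", symmetric, THEN fun_cong]) (simp_all add: f linear_add[OF \<psi>] F G)
  finally show ?thesis .
qed

lemma linear_series_deriv_\<Delta>0: "Vector_Spaces.linear sA sAA (\<lambda>a. series_deriv sAA (\<Delta>0 a) n)"
  unfolding series_deriv_def by (rule linear_scaled[OF linear_\<Delta>0])

lemma \<Delta>0_translation: "\<Delta>0 (TA a) n = series_deriv sAA (\<Delta>0 a) n + TA2 (\<Delta>0 a n)"
proof (rule A.linear_eqI[where f = "\<lambda>a. \<Delta>0 (TA a) n"])
  show "Vector_Spaces.linear sA sAA (\<lambda>a. \<Delta>0 (TA a) n)"
    by (rule linear_comp[OF linear_\<Delta>0 linear_TA])
  show "Vector_Spaces.linear sA sAA (\<lambda>a. series_deriv sAA (\<Delta>0 a) n + TA2 (\<Delta>0 a n))"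
    by (rule linear_plus[OF linear_series_deriv_\<Delta>0 linear_comp[OF linear_T2(1) linear_\<Delta>0]])
  fix b h
  let ?X = "\<Delta>B b" and ?Y = "D h"
  have X: "\<Delta>B (TB b) = (\<lambda>n. series_deriv sBB ?X n + TB2 (?X n))"
    by (rule ext) (simp only: B.coproduct_translation series_deriv_def TB2_def)
  have Y: "D (TH h) = (\<lambda>n. series_deriv sHH ?Y n + TH2 (?Y n))"
    by (rule ext) (simp only: H.DH_translation series_deriv_def TH2_def)
  note bd = upper_bounded_series_deriv[OF B.V_space(2) bounded_\<Delta>B[of b]]
    upper_bounded_series_deriv[OF H.V_space(2) H.bounded_DH[of h]]
    bounded_linear_image[OF linear_T2(2) bounded_\<Delta>B[of b]]
    bounded_linear_image[OF linear_T2(3) H.bounded_DH[of h]] bounds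
  have T: "TA2 (\<gamma> x y) = \<gamma> (TB2 x) y + \<gamma> x (TH2 y)" for x y
    by (induct x rule: B.V2.tensor_induct, induct y rule: H.V2.tensor_induct)
      (simp_all add: op2_tensor op2_add T2_tensor T2_add TA_tensor tensor_add)
  have "\<Delta>0 (TA (tA b h)) n = conv \<gamma> (\<Delta>B (TB b)) ?Y n + conv \<gamma> ?X (D (TH h)) n"
    by (simp add: TA_tensor linear_add[OF linear_\<Delta>0] \<Delta>0_tensor)
  also have "\<dots> = (conv \<gamma> (series_deriv sBB ?X) ?Y n + conv \<gamma> ?X (series_deriv sHH ?Y) n) +
      (conv \<gamma> (\<lambda>n. TB2 (?X n)) ?Y n + conv \<gamma> ?X (\<lambda>n. TH2 (?Y n)) n)"
    unfolding X Y by (simp add: conv_add_left[OF op2_biadditive(1)] conv_add_right[OF op2_biadditive(1)] bd)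
  also have "conv \<gamma> (\<lambda>n. TB2 (?X n)) ?Y n + conv \<gamma> ?X (\<lambda>n. TH2 (?Y n)) n = TA2 (conv \<gamma> ?X ?Y n)"
    by (rule TA2_conv[OF op2_biadditive(1) T linear_T2(2,3) bounded_\<Delta>B H.bounded_DH, symmetric])
  also have "conv \<gamma> (series_deriv sBB ?X) ?Y n + conv \<gamma> ?X (series_deriv sHH ?Y) n =
      series_deriv sAA (conv \<gamma> ?X ?Y) n"
    by (rule series_deriv_conv[OF bilinear_\<gamma> bounded_\<Delta>B H.bounded_DH, symmetric])
  finally show "\<Delta>0 (TA (tA b h)) n = series_deriv sAA (\<Delta>0 (tA b h)) n + TA2 (\<Delta>0 (tA b h) n)"
    by (simp add: \<Delta>0_tensor)
qed

lemma \<Delta>A_translation: "\<Delta>A (TA a) n = sAA (of_int (n + 1)) (\<Delta>A a (n + 1)) + tmap tAA tAA id TA (\<Delta>A a n)"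
proof -
  let ?W = "\<Delta>0 a"
  note bd = upper_bounded_series_deriv[OF A.V_space(2) bounded_\<Delta>0[of a]]
    bounded_linear_image[OF linear_T2(1) bounded_\<Delta>0[of a]] bounds bounded_\<Delta>0
    upper_bounded_series_deriv[OF H.V_space(2) H.bounded_R']
  \<comment> \<open>The second leg of \<open>r\<close> acts through \<open>L\<close>, and the
    translation of \<open>B\<close> is a derivation of the action of \<open>H\<close>.\<close>
  have T: "TA2 (\<rho> r w) = \<rho> (TH2 r) w + \<rho> r (TA2 w)" for r w
    by (induct r rule: H.V2.tensor_induct, induct w rule: A.V2.tensor_induct)
      (simp_all add: op2_tensor op2_add T2_tensor T2_add TA_L tensor_add)
  interpret HH: vector_space sHH by (rule H.V_space)
  have R: "TH2 (H.R' n) = - series_deriv sHH H.R' n" for n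
    by (simp add: TH2_def H.translation_R' series_deriv_def del: of_int_add)
  have neg: "conv \<rho> (\<lambda>n. - F n) G n = - conv \<rho> F G n" for F G
  proof -
    have m: "\<rho> (- x) w = - \<rho> x w" for x w
      using op2_add(3)[of "- x" x w] biadditiveD(3)[OF op2_biadditive(2), of w]
      by (simp add: eq_neg_iff_add_eq_0)
    show ?thesis by (simp add: conv_def m case_prod_unfold sum_negf)
  qed
  have "\<Delta>0 (TA a) = (\<lambda>n. series_deriv sAA ?W n + TA2 (?W n))"
    by (rule ext) (rule \<Delta>0_translation)
  then have "\<Delta>A (TA a) n = conv \<rho> H.R' (series_deriv sAA ?W) n + conv \<rho> H.R' (\<lambda>n. TA2 (?W n)) n"
    unfolding \<Delta>A_eq by (simp add: conv_add_right[OF op2_biadditive(2)] bd)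
  \<comment> \<open>The two added terms cancel: the derivative of \<open>R'\<close> is minus
    \<open>TH\<close> on its second leg. They complete the product rule for \<open>d/dz\<close> and
    the one for \<open>TA2\<close>.\<close>
  also have "\<dots> = (conv \<rho> (series_deriv sHH H.R') ?W n + conv \<rho> H.R' (series_deriv sAA ?W) n) +
      (conv \<rho> (\<lambda>n. TH2 (H.R' n)) ?W n + conv \<rho> H.R' (\<lambda>n. TA2 (?W n)) n)"
    by (simp add: R neg)
  also have "\<dots> = series_deriv sAA (conv \<rho> H.R' ?W) n + TA2 (conv \<rho> H.R' ?W n)"
    by (simp only: TA2_conv[OF op2_biadditive(2) T linear_T2(3,1) H.bounded_R' bounded_\<Delta>0]
        series_deriv_conv[OF bilinear_\<rho> H.bounded_R' bounded_\<Delta>0])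
  finally show ?thesis by (simp only: \<Delta>A_eq series_deriv_def TA2_def)
qed

end

section \<open>Weak coassociativity\<close>

context smash_product
begin

definition \<gamma>3 :: "'bbb \<Rightarrow> 'hhh \<Rightarrow> 'aaa" where "\<gamma>3 = tmap2 tBBB tHHH tAAA \<gamma> tA"
text \<open>The patterns of operators that \<open>\<rho>\<close> turns into when one of its legs is
  split: the coproduct of the first leg gives \<open>M\<close>, \<open>M\<close>, \<open>L\<close>
  (\<open>MML\<close>), that of the second gives \<open>M\<close>, \<open>L\<close>,
  \<open>L\<close> (\<open>MLL\<close>).\<close>

definition MML :: "'hhh \<Rightarrow> 'aaa \<Rightarrow> 'aaa" where "MML = tmap2 tHHH tAAA tAAA MM L"
definition MLL :: "'hhh \<Rightarrow> 'aaa \<Rightarrow> 'aaa" where "MLL = tmap2 tHHH tAAA tAAA \<rho> L"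

lemma bilinear_\<gamma>3: "bilinear_map sBBB sHHH sAAA \<gamma>3"
  unfolding \<gamma>3_def by (rule bilinear_tmap2[OF BBB_tensor H.HHH_tensor AAA_tensor bilinear_\<gamma> A.bilinear_t])
lemma \<gamma>3_tensor: "\<gamma>3 (tBBB x b) (tHHH y h) = tAAA (\<gamma> x y) (tA b h)"
  unfolding \<gamma>3_def by (rule tmap2_tensor[OF BBB_tensor H.HHH_tensor AAA_tensor bilinear_\<gamma> A.bilinear_t])
lemma bilinear_MML: "bilinear_map sHHH sAAA sAAA MML"
  unfolding MML_def by (rule bilinear_tmap2[OF H.HHH_tensor AAA_tensor AAA_tensor bilinear_MM bilinear_L])
lemma MML_tensor: "MML (tHHH y h) (tAAA w a) = tAAA (MM y w) (L h a)"
  unfolding MML_def by (rule tmap2_tensor[OF H.HHH_tensor AAA_tensor AAA_tensor bilinear_MM bilinear_L])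
lemma bilinear_MLL: "bilinear_map sHHH sAAA sAAA MLL"
  unfolding MLL_def by (rule bilinear_tmap2[OF H.HHH_tensor AAA_tensor AAA_tensor bilinear_\<rho> bilinear_L])
lemma MLL_tensor: "MLL (tHHH y h) (tAAA w a) = tAAA (\<rho> y w) (L h a)"
  unfolding MLL_def by (rule tmap2_tensor[OF H.HHH_tensor AAA_tensor AAA_tensor bilinear_\<rho> bilinear_L])

definition \<rho>12 :: "'hh \<Rightarrow> 'aaa \<Rightarrow> 'aaa" where "\<rho>12 r = MLL (H.l12 r)"
definition \<rho>13 :: "'hh \<Rightarrow> 'aaa \<Rightarrow> 'aaa" where "\<rho>13 r = MML (H.l13 r)"
definition \<rho>23 :: "'hh \<Rightarrow> 'aaa \<Rightarrow> 'aaa" where "\<rho>23 r = MML (H.l23 r)"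

lemma bilinear_\<rho>12: "bilinear_map sHH sAAA sAAA \<rho>12"
  and bilinear_\<rho>13: "bilinear_map sHH sAAA sAAA \<rho>13"
  and bilinear_\<rho>23: "bilinear_map sHH sAAA sAAA \<rho>23"
  unfolding \<rho>12_def[abs_def] \<rho>13_def[abs_def] \<rho>23_def[abs_def]
  by (intro bilinear_mapI linear_bilinear_left[OF bilinear_MLL] linear_bilinear_right[OF bilinear_MLL]
      linear_bilinear_left[OF bilinear_MML] linear_bilinear_right[OF bilinear_MML] H.linear_leg
      linear_ident spaces)+

lemma \<rho>_legs_tensor:
  "\<rho>12 (tHH x y) (tAAA (tAA a b) c) = tAAA (tAA (M x a) (L y b)) c"
  "\<rho>13 (tHH x y) (tAAA (tAA a b) c) = tAAA (tAA (M x a) b) (L y c)"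
  "\<rho>23 (tHH x y) (tAAA (tAA a b) c) = tAAA (tAA a (M x b)) (L y c)"
  by (simp_all add: \<rho>12_def \<rho>13_def \<rho>23_def H.leg_tensor MLL_tensor MML_tensor op2_tensor L_one M_one)

lemmas op3_tensor = \<gamma>3_tensor MML_tensor MLL_tensor
lemmas op3_add = bilinear_mapD(1,2)[OF bilinear_\<gamma>3] bilinear_mapD(1,2)[OF bilinear_MML]
  bilinear_mapD(1,2)[OF bilinear_MLL] bilinear_mapD(1,2)[OF bilinear_\<rho>12]
  bilinear_mapD(1,2)[OF bilinear_\<rho>13] bilinear_mapD(1,2)[OF bilinear_\<rho>23]
lemmas op3_biadditive = bilinear_\<gamma>3[THEN bilinear_map_biadditive]
  bilinear_MML[THEN bilinear_map_biadditive] bilinear_MLL[THEN bilinear_map_biadditive]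
  bilinear_\<rho>12[THEN bilinear_map_biadditive] bilinear_\<rho>13[THEN bilinear_map_biadditive]
  bilinear_\<rho>23[THEN bilinear_map_biadditive]

lemmas reassoc_add = bilinear_mapD(1,2)[OF A.bilinear_reassoc] bilinear_mapD(1,2)[OF B.bilinear_reassoc]
  bilinear_mapD(1,2)[OF H.bilinear_reassoc]

lemma \<rho>12_tensor: "\<rho>12 r (tAAA w a) = tAAA (\<rho> r w) a"
  by (induct r rule: H.V2.tensor_induct, induct w rule: A.V2.tensor_induct)
    (simp_all add: \<rho>_legs_tensor op2_tensor op2_add op3_add tensor_add)

lemma \<rho>23_reassoc: "\<rho>23 r (A.reassoc a w) = A.reassoc a (\<rho> r w)"
  by (induct r rule: H.V2.tensor_induct, induct w rule: A.V2.tensor_induct)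
    (simp_all add: \<rho>_legs_tensor A.reassoc_tensor op2_tensor op2_add op3_add reassoc_add)

lemma MLL_reassoc: "MLL (H.reassoc x v) (A.reassoc a w) = A.reassoc (M x a) (LL v w)"
  by (induct v rule: H.V2.tensor_induct, induct w rule: A.V2.tensor_induct)
    (simp_all add: A.reassoc_tensor H.reassoc_tensor op3_tensor op2_tensor op2_add op3_add reassoc_add)

lemma \<gamma>3_reassoc: "\<gamma>3 (B.reassoc b x) (H.reassoc h y) = A.reassoc (tA b h) (\<gamma> x y)"
  by (induct x rule: B.V2.tensor_induct, induct y rule: H.V2.tensor_induct)
    (simp_all add: A.reassoc_tensor H.reassoc_tensor B.reassoc_tensor op3_tensor op2_tensor op2_add
      op3_add reassoc_add)

lemma \<rho>_legs_commute:
  "\<rho>12 r (\<rho>13 s w) = \<rho>13 s (\<rho>12 r w)" "\<rho>12 r (\<rho>23 s w) = \<rho>23 s (\<rho>12 r w)"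
  by (induct r rule: H.V2.tensor_induct, induct s rule: H.V2.tensor_induct, induct w rule: A.tensor3_induct;
      simp add: \<rho>_legs_tensor op3_add L_M_commute M_M_commute)+

lemma MML_mult3: "MML (mult3 tHH tHHH (H.l13 r) (H.l23 s)) w = \<rho>13 r (\<rho>23 s w)"
proof -
  have "MML (mult3 tHH tHHH x y) w = MML x (MML y w)" for x y
    by (induct x rule: H.tensor3_induct, induct y rule: H.tensor3_induct, induct w rule: A.tensor3_induct)
      (simp_all add: H.mult3_tensor H.mult2_tensor H.mult3_add MML_tensor op2_tensor op3_add L_def M_def hact_hact)
  then show ?thesis by (simp add: \<rho>13_def \<rho>23_def)
qed

lemma MLL_l13: "MLL (H.l13 r) w = \<rho>13 r w"
  by (induct r rule: H.V2.tensor_induct, induct w rule: A.tensor3_induct)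
    (simp_all add: \<rho>_legs_tensor H.leg_tensor H.leg_add op3_tensor op2_tensor op3_add L_one)

lemma MLL_mult3: "MLL (mult3 tHH tHHH (H.l12 r) (H.l13 s)) w = \<rho>12 r (\<rho>13 s w)"
proof -
  have "MLL (mult3 tHH tHHH x y) w = MLL x (MLL y w)" for x y
    by (induct x rule: H.tensor3_induct, induct y rule: H.tensor3_induct, induct w rule: A.tensor3_induct)
      (simp_all add: H.mult3_tensor H.mult2_tensor H.mult3_add MLL_tensor op2_tensor op3_add L_def M_def hact_hact)
  then show ?thesis by (simp add: \<rho>12_def MLL_l13)
qed

abbreviation "clH m \<equiv> cop_left tHH tHHH (\<lambda>x. D x m)"
abbreviation "crH m \<equiv> cop_right tHH tHHH (\<lambda>x. D x m)"
abbreviation "clB m \<equiv> cop_left tBB tBBB (\<lambda>x. \<Delta>B x m)"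
abbreviation "crB m \<equiv> cop_right tBB tBBB (\<lambda>x. \<Delta>B x m)"
abbreviation "clA m \<equiv> cop_left tAA tAAA (\<lambda>x. \<Delta>A x m)"
abbreviation "crA m \<equiv> cop_right tAA tAAA (\<lambda>x. \<Delta>A x m)"
abbreviation "cl0 m \<equiv> cop_left tAA tAAA (\<lambda>x. \<Delta>0 x m)"
abbreviation "cr0 m \<equiv> cop_right tAA tAAA (\<lambda>x. \<Delta>0 x m)"

lemmas cl_linear = H.linear_cop_left[OF H.linear_DH] B.linear_cop_left[OF linear_\<Delta>B]
  A.linear_cop_left[OF linear_\<Delta>A] A.linear_cop_left[OF linear_\<Delta>0]
lemmas cr_linear = H.linear_cop_right[OF H.linear_DH] B.linear_cop_right[OF linear_\<Delta>B]
  A.linear_cop_right[OF linear_\<Delta>A] A.linear_cop_right[OF linear_\<Delta>0]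
lemmas cl_tensor = H.cop_left_tensor[OF H.linear_DH] B.cop_left_tensor[OF linear_\<Delta>B]
  A.cop_left_tensor[OF linear_\<Delta>A] A.cop_left_tensor[OF linear_\<Delta>0]
lemmas cr_tensor = H.cop_right_tensor[OF H.linear_DH] B.cop_right_tensor[OF linear_\<Delta>B]
  A.cop_right_tensor[OF linear_\<Delta>A] A.cop_right_tensor[OF linear_\<Delta>0]

lemma cl_bounded:
  "upper_bounded (\<lambda>m. clH m y)" "upper_bounded (\<lambda>m. clB m x)"
  "upper_bounded (\<lambda>m. clA m w)" "upper_bounded (\<lambda>m. cl0 m w)"
  by (rule upper_bounded_int_tensor_induct[OF H.HH_tensor cl_linear(1)]
      upper_bounded_int_tensor_induct[OF BB_tensor cl_linear(2)]
      upper_bounded_int_tensor_induct[OF AA_tensor cl_linear(3)]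
      upper_bounded_int_tensor_induct[OF AA_tensor cl_linear(4)];
      unfold cl_tensor;
      intro bounded_bilinear_left[OF H.V3.bilinear_t] bounded_bilinear_left[OF B.V3.bilinear_t]
        bounded_bilinear_left[OF A.V3.bilinear_t] bounds bounded_\<Delta>A bounded_\<Delta>0)+

lemma cr_bounded:
  "upper_bounded (\<lambda>m. crH m y)" "upper_bounded (\<lambda>m. crB m x)"
  "upper_bounded (\<lambda>m. crA m w)" "upper_bounded (\<lambda>m. cr0 m w)"
  by (rule upper_bounded_int_tensor_induct[OF H.HH_tensor cr_linear(1)]
      upper_bounded_int_tensor_induct[OF BB_tensor cr_linear(2)]
      upper_bounded_int_tensor_induct[OF AA_tensor cr_linear(3)]
      upper_bounded_int_tensor_induct[OF AA_tensor cr_linear(4)];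
      unfold cr_tensor;
      intro bounded_bilinear_right[OF H.bilinear_reassoc] bounded_bilinear_right[OF B.bilinear_reassoc]
        bounded_bilinear_right[OF A.bilinear_reassoc] bounds bounded_\<Delta>A bounded_\<Delta>0)+

lemmas c_add = cl_linear[THEN linear_add] cr_linear[THEN linear_add]
lemmas c_zero = cl_linear[THEN linear_zero] cr_linear[THEN linear_zero]

text \<open>The twist of the inner coproduct involves only its own variable and the first two
  factors.\<close>

lemma clA_eq: "clA m w = conv \<rho>12 H.R' (\<lambda>q. cl0 q w) m"
proof (induct w rule: A.V2.tensor_induct)
  case (tensor a b)
  have "clA m (tAA a b) = conv (\<lambda>r u. tAAA (\<rho> r u) b) H.R' (\<Delta>0 a) m"
    unfolding cl_tensor unfolding \<Delta>A_eq by (rule additive_conv) (simp add: tensor_add)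
  also have "\<dots> = conv (\<lambda>r u. \<rho>12 r (tAAA u b)) H.R' (\<Delta>0 a) m"
    by (simp add: \<rho>12_tensor)
  also have "\<dots> = conv \<rho>12 H.R' (\<lambda>q. tAAA (\<Delta>0 a q) b) m"
    by (rule conv_map[where \<phi> = "\<lambda>x. x", symmetric, THEN fun_cong])
      (simp_all add: op3_biadditive tensor_add bounds bounded_\<Delta>0)
  finally show ?case by (simp only: cl_tensor)
qed (simp add: c_add conv_add_right[OF op3_biadditive(4)] bounds cl_bounded)

lemma crA_eq: "crA m w = conv \<rho>23 H.R' (\<lambda>q. cr0 q w) m"
proof (induct w rule: A.V2.tensor_induct)
  case (tensor a b)
  have "crA m (tAA a b) = conv (\<lambda>r u. A.reassoc a (\<rho> r u)) H.R' (\<Delta>0 b) m"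
    unfolding cr_tensor unfolding \<Delta>A_eq by (rule additive_conv) (simp add: reassoc_add)
  also have "\<dots> = conv (\<lambda>r u. \<rho>23 r (A.reassoc a u)) H.R' (\<Delta>0 b) m"
    by (simp add: \<rho>23_reassoc)
  also have "\<dots> = conv \<rho>23 H.R' (\<lambda>q. A.reassoc a (\<Delta>0 b q)) m"
    by (rule conv_map[where \<phi> = "\<lambda>x. x", symmetric, THEN fun_cong])
      (simp_all add: op3_biadditive reassoc_add bounds bounded_\<Delta>0)
  finally show ?case by (simp only: cr_tensor)
qed (simp add: c_add conv_add_right[OF op3_biadditive(6)] bounds cr_bounded)

text \<open>The outer twist passes through the inner coproduct by \<open>\<Delta>A_M\<close>, and
  its first leg is replaced by the coproduct of that leg. This is where the left side of a hexagon
  appears.\<close>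

lemma clA_\<rho>: "clA m (\<rho> r w) = conv MML (\<lambda>p. clH p r) (\<lambda>q. clA q w) m"
proof (induct r rule: H.V2.tensor_induct, induct w rule: A.V2.tensor_induct)
  fix x y a b
  have "clA m (\<rho> (tHH x y) (tAA a b)) = conv (\<lambda>u v. tAAA (MM u v) (L y b)) (D x) (\<Delta>A a) m"
    unfolding op2_tensor cl_tensor \<Delta>A_M by (rule additive_conv) (simp add: tensor_add)
  also have "\<dots> = conv (\<lambda>u v. MML (tHHH u y) (tAAA v b)) (D x) (\<Delta>A a) m"
    by (simp add: MML_tensor)
  also have "\<dots> = conv MML (\<lambda>p. tHHH (D x p) y) (\<lambda>q. tAAA (\<Delta>A a q) b) m"
    by (rule conv_map[symmetric, THEN fun_cong])
      (simp_all add: op3_biadditive tensor_add bounds bounded_\<Delta>A)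
  finally show "clA m (\<rho> (tHH x y) (tAA a b)) =
      conv MML (\<lambda>p. clH p (tHH x y)) (\<lambda>q. clA q (tAA a b)) m" by (simp only: cl_tensor)
qed (simp_all add: c_add op2_add conv_add_left[OF op3_biadditive(2)] conv_add_right[OF op3_biadditive(2)] cl_bounded)

lemma crA_\<rho>: "crA m (\<rho> r w) = conv MLL (\<lambda>p. crH p r) (\<lambda>q. crA q w) m"
proof (induct r rule: H.V2.tensor_induct, induct w rule: A.V2.tensor_induct)
  fix x y a b
  have "crA m (\<rho> (tHH x y) (tAA a b)) = conv (\<lambda>u v. A.reassoc (M x a) (LL u v)) (D y) (\<Delta>A b) m"
    unfolding op2_tensor cr_tensor \<Delta>A_L by (rule additive_conv) (simp add: reassoc_add)
  also have "\<dots> = conv (\<lambda>u v. MLL (H.reassoc x u) (A.reassoc a v)) (D y) (\<Delta>A b) m"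
    by (simp add: MLL_reassoc)
  also have "\<dots> = conv MLL (\<lambda>p. H.reassoc x (D y p)) (\<lambda>q. A.reassoc a (\<Delta>A b q)) m"
    by (rule conv_map[symmetric, THEN fun_cong])
      (simp_all add: op3_biadditive reassoc_add bounds bounded_\<Delta>A)
  finally show "crA m (\<rho> (tHH x y) (tAA a b)) =
      conv MLL (\<lambda>p. crH p (tHH x y)) (\<lambda>q. crA q (tAA a b)) m" by (simp only: cr_tensor)
qed (simp_all add: c_add op2_add conv_add_left[OF op3_biadditive(3)] conv_add_right[OF op3_biadditive(3)] cr_bounded)

lemma cl0_\<gamma>: "cl0 m (\<gamma> x y) = conv \<gamma>3 (\<lambda>p. clB p x) (\<lambda>q. clH q y) m"
proof (induct x rule: B.V2.tensor_induct, induct y rule: H.V2.tensor_induct)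
  fix b c h k
  have "cl0 m (\<gamma> (tBB b c) (tHH h k)) = conv (\<lambda>u v. tAAA (\<gamma> u v) (tA c k)) (\<Delta>B b) (D h) m"
    unfolding op2_tensor cl_tensor \<Delta>0_tensor by (rule additive_conv) (simp add: tensor_add)
  also have "\<dots> = conv (\<lambda>u v. \<gamma>3 (tBBB u c) (tHHH v k)) (\<Delta>B b) (D h) m"
    by (simp add: \<gamma>3_tensor)
  also have "\<dots> = conv \<gamma>3 (\<lambda>p. tBBB (\<Delta>B b p) c) (\<lambda>q. tHHH (D h q) k) m"
    by (rule conv_map[symmetric, THEN fun_cong]) (simp_all add: op3_biadditive tensor_add bounds)
  finally show "cl0 m (\<gamma> (tBB b c) (tHH h k)) =
      conv \<gamma>3 (\<lambda>p. clB p (tBB b c)) (\<lambda>q. clH q (tHH h k)) m" by (simp only: cl_tensor)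
qed (simp_all add: c_add op2_add conv_add_left[OF op3_biadditive(1)] conv_add_right[OF op3_biadditive(1)] cl_bounded)

lemma cr0_\<gamma>: "cr0 m (\<gamma> x y) = conv \<gamma>3 (\<lambda>p. crB p x) (\<lambda>q. crH q y) m"
proof (induct x rule: B.V2.tensor_induct, induct y rule: H.V2.tensor_induct)
  fix b c h k
  have "cr0 m (\<gamma> (tBB b c) (tHH h k)) = conv (\<lambda>u v. A.reassoc (tA b h) (\<gamma> u v)) (\<Delta>B c) (D k) m"
    unfolding op2_tensor cr_tensor \<Delta>0_tensor by (rule additive_conv) (simp add: reassoc_add)
  also have "\<dots> = conv (\<lambda>u v. \<gamma>3 (B.reassoc b u) (H.reassoc h v)) (\<Delta>B c) (D k) m"
    by (simp add: \<gamma>3_reassoc)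
  also have "\<dots> = conv \<gamma>3 (\<lambda>p. B.reassoc b (\<Delta>B c p)) (\<lambda>q. H.reassoc h (D k q)) m"
    by (rule conv_map[symmetric, THEN fun_cong]) (simp_all add: op3_biadditive reassoc_add bounds)
  finally show "cr0 m (\<gamma> (tBB b c) (tHH h k)) =
      conv \<gamma>3 (\<lambda>p. crB p (tBB b c)) (\<lambda>q. crH q (tHH h k)) m" by (simp only: cr_tensor)
qed (simp_all add: c_add op2_add conv_add_left[OF op3_biadditive(1)] conv_add_right[OF op3_biadditive(1)] cr_bounded)

lemma weak_coassociativity_tensor:
  obtains C where "upper_bounded C"
    "taylor_expand sAAA 1 C = two_var (\<lambda>m n. clA m (\<Delta>A (tA b h) n))"
    "taylor_expand sAAA (- 1) (rotate_index C) = two_var (\<lambda>m n. crA m (\<Delta>A (tA b h) n))"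
proof -
  let ?a = "tA b h"
  obtain cB where cB: "upper_bounded cB"
    "taylor_expand sBBB 1 cB = two_var (\<lambda>m n. clB m (\<Delta>B b n))"
    "taylor_expand sBBB (- 1) (rotate_index cB) = two_var (\<lambda>m n. crB m (\<Delta>B b n))"
  proof -
    obtain c where c: "bounded_support c"
      "\<And>m n. clB m (\<Delta>B b n) = expand_z_w sBBB c m n" "\<And>m n. crB m (\<Delta>B b n) = expand_w_u sBBB c m n"
      using B.weak_coassociativity[of b] by blast
    show ?thesis
    proof (rule that)
      show "upper_bounded (\<lambda>(i, j, l). c i j l)" using c(1) by (simp add: bounded_support_iff)
      show "taylor_expand sBBB 1 (\<lambda>(i, j, l). c i j l) = two_var (\<lambda>m n. clB m (\<Delta>B b n))"
        by (rule ext) (simp add: c(2) expand_z_w_eq two_var_def case_prod_unfold)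
      show "taylor_expand sBBB (- 1) (rotate_index (\<lambda>(i, j, l). c i j l)) = two_var (\<lambda>m n. crB m (\<Delta>B b n))"
        by (rule ext) (simp add: c(3) expand_w_u_eq two_var_def rotate_index_def case_prod_unfold)
    qed
  qed
  obtain cH where cH: "upper_bounded cH"
    "taylor_expand sHHH 1 cH = two_var (\<lambda>m n. clH m (D h n))"
    "taylor_expand sHHH (- 1) (rotate_index cH) = two_var (\<lambda>m n. crH m (D h n))"
    by (rule H.weak_coassociativity_DH)
  let ?R1 = "on_first H.R'" and ?R2 = "on_second H.R'" and ?R3 = "on_third H.R'"
  note Rb = upper_bounded_on[OF H.bounded_R']
  \<comment> \<open>Evaluates \<open>R'\<close> at \<open>z + w\<close> on factors 1 and 3, at
    \<open>w\<close> on factors 2 and 3, at \<open>z\<close> on factors 1 and 2. After rotation the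
    same three factors are series in \<open>u\<close>, \<open>w\<close> and
    \<open>u - w\<close>.\<close>
  let ?C = "conv \<rho>13 ?R3 (conv \<rho>23 ?R2 (conv \<rho>12 ?R1 (conv \<gamma>3 cB cH)))"
  note cb = upper_bounded_conv Rb cB(1) cH(1) upper_bounded_rotate_index upper_bounded_taylor_expand
  have Tb: "upper_bounded (taylor_expand sHH c ?R1)" "upper_bounded (taylor_expand sHH c ?R2)"
    "upper_bounded (taylor_expand sHH c ?R3)" for c
    by (intro cb)+
  note tc = taylor_expand_conv[OF bilinear_\<rho>13] taylor_expand_conv[OF bilinear_\<rho>23]
    taylor_expand_conv[OF bilinear_\<rho>12] taylor_expand_conv[OF bilinear_\<gamma>3]

  have U3: "two_var (\<lambda>m n. cl0 m (\<Delta>0 ?a n)) = conv \<gamma>3 (taylor_expand sBBB 1 cB) (taylor_expand sHHH 1 cH)"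
    unfolding cB(2) cH(2) \<Delta>0_tensor
    by (rule two_var_conv[where \<phi> = cl0, OF op2_biadditive(1) op3_biadditive(1) bounds(1,2)
          c_add(4) c_zero(2) c_zero(1) cl0_\<gamma>]) (unfold cB(2)[symmetric] cH(2)[symmetric], (intro cb)+)
  have U3b: "upper_bounded (two_var (\<lambda>m n. cl0 m (\<Delta>0 ?a n)))"
    unfolding U3 by (intro cb)
  have U2: "two_var (\<lambda>m n. clA m (\<Delta>0 ?a n)) =
      conv \<rho>12 (taylor_expand sHH 1 ?R1) (two_var (\<lambda>m n. cl0 m (\<Delta>0 ?a n)))"
    unfolding clA_eq taylor_expand_on_first[OF H.V_space(2)]
    by (rule conv_two_var_const_left[OF op3_biadditive(4) H.bounded_R' U3b, symmetric])
  have U2b: "upper_bounded (two_var (\<lambda>m n. clA m (\<Delta>0 ?a n)))"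
    unfolding U2 by (intro upper_bounded_conv U3b Tb)
  have "two_var (\<lambda>m n. clA m (\<Delta>A ?a n)) =
      conv MML (two_var (\<lambda>m n. clH m (H.R' n))) (two_var (\<lambda>m n. clA m (\<Delta>0 ?a n)))"
    unfolding \<Delta>A_eq[of ?a]
    by (rule two_var_conv[where \<phi> = clA, OF op2_biadditive(2) op3_biadditive(2) H.bounded_R' bounded_\<Delta>0
          c_add(3) c_zero(1) c_zero(3) clA_\<rho> _ U2b])
      (unfold H.two_var_hexagon_left, intro upper_bounded_conv Tb)
  \<comment> \<open>The left hexagon splits the outer twist into the factors at \<open>z + w\<close>
    and at \<open>w\<close>.\<close>
  also have "\<dots> = conv \<rho>13 (taylor_expand sHH 1 ?R3) (conv \<rho>23 (taylor_expand sHH 1 ?R2)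
      (two_var (\<lambda>m n. clA m (\<Delta>0 ?a n))))"
    unfolding H.two_var_hexagon_left
  proof (rule conv_assoc)
    show "biadditive (\<lambda>a b. mult3 tHH tHHH (H.l13 a) (H.l23 b))"
      by (simp add: biadditive_def H.mult3_add H.leg_add)
  qed (rule op3_biadditive Tb U2b MML_mult3)+
  also have "\<dots> = taylor_expand sAAA 1 ?C"
    unfolding U2 U3 by (simp add: tc cb)
  finally have 1: "taylor_expand sAAA 1 ?C = two_var (\<lambda>m n. clA m (\<Delta>A ?a n))" ..

  have V3: "two_var (\<lambda>m n. cr0 m (\<Delta>0 ?a n)) =
      conv \<gamma>3 (taylor_expand sBBB (- 1) (rotate_index cB)) (taylor_expand sHHH (- 1) (rotate_index cH))"
    unfolding cB(3) cH(3) \<Delta>0_tensor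
    by (rule two_var_conv[where \<phi> = cr0, OF op2_biadditive(1) op3_biadditive(1) bounds(1,2)
          c_add(8) c_zero(6) c_zero(5) cr0_\<gamma>]) (unfold cB(3)[symmetric] cH(3)[symmetric], (intro cb)+)
  have V3b: "upper_bounded (two_var (\<lambda>m n. cr0 m (\<Delta>0 ?a n)))"
    unfolding V3 by (intro cb)
  have V2: "two_var (\<lambda>m n. crA m (\<Delta>0 ?a n)) =
      conv \<rho>23 (taylor_expand sHH (- 1) ?R1) (two_var (\<lambda>m n. cr0 m (\<Delta>0 ?a n)))"
    unfolding crA_eq taylor_expand_on_first[OF H.V_space(2)]
    by (rule conv_two_var_const_left[OF op3_biadditive(6) H.bounded_R' V3b, symmetric])
  have V2b: "upper_bounded (two_var (\<lambda>m n. crA m (\<Delta>0 ?a n)))"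
    unfolding V2 by (intro upper_bounded_conv V3b Tb)
  have "two_var (\<lambda>m n. crA m (\<Delta>A ?a n)) =
      conv MLL (two_var (\<lambda>m n. crH m (H.R' n))) (two_var (\<lambda>m n. crA m (\<Delta>0 ?a n)))"
    unfolding \<Delta>A_eq[of ?a]
    by (rule two_var_conv[where \<phi> = crA, OF op2_biadditive(2) op3_biadditive(3) H.bounded_R' bounded_\<Delta>0
          c_add(7) c_zero(5) c_zero(7) crA_\<rho> _ V2b])
      (unfold H.two_var_hexagon_right, intro upper_bounded_conv Tb)
  also have "\<dots> = conv \<rho>12 (taylor_expand sHH (- 1) ?R3) (conv \<rho>13 (taylor_expand sHH (- 1) ?R2)
      (two_var (\<lambda>m n. crA m (\<Delta>0 ?a n))))"
    unfolding H.two_var_hexagon_right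
  proof (rule conv_assoc)
    show "biadditive (\<lambda>a b. mult3 tHH tHHH (H.l12 a) (H.l13 b))"
      by (simp add: biadditive_def H.mult3_add H.leg_add)
  qed (rule op3_biadditive Tb V2b MLL_mult3)+
  \<comment> \<open>The right hexagon produces the three twists in another order; since they commute
    they can be arranged as in \<open>?C\<close>.\<close>
  also have "\<dots> = conv \<rho>13 (taylor_expand sHH (- 1) ?R2) (conv \<rho>12 (taylor_expand sHH (- 1) ?R3)
      (two_var (\<lambda>m n. crA m (\<Delta>0 ?a n))))"
    by (rule conv_left_commute) (rule op3_biadditive Tb V2b \<rho>_legs_commute)+
  also have "conv \<rho>12 (taylor_expand sHH (- 1) ?R3) (two_var (\<lambda>m n. crA m (\<Delta>0 ?a n))) =
      conv \<rho>23 (taylor_expand sHH (- 1) ?R1) (conv \<rho>12 (taylor_expand sHH (- 1) ?R3)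
        (two_var (\<lambda>m n. cr0 m (\<Delta>0 ?a n))))"
    unfolding V2 by (rule conv_left_commute) (rule op3_biadditive Tb V3b \<rho>_legs_commute)+
  also have "conv \<rho>13 (taylor_expand sHH (- 1) ?R2) \<dots> = taylor_expand sAAA (- 1) (rotate_index ?C)"
    unfolding V3 rotate_index_conv rotate_index_on by (simp add: tc cb)
  finally have 2: "taylor_expand sAAA (- 1) (rotate_index ?C) = two_var (\<lambda>m n. crA m (\<Delta>A ?a n))" ..
  show ?thesis by (rule that[OF _ 1 2]) (intro cb)
qed

lemma weak_coassociativity_smash:
  "\<exists>c. bounded_support c \<and>
    (\<forall>m n. clA m (\<Delta>A v n) = expand_z_w sAAA c m n) \<and> (\<forall>n p. crA n (\<Delta>A v p) = expand_w_u sAAA c n p)"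
proof -
  have "\<exists>C. upper_bounded C \<and> taylor_expand sAAA 1 C = two_var (\<lambda>m n. clA m (\<Delta>A v n)) \<and>
    taylor_expand sAAA (- 1) (rotate_index C) = two_var (\<lambda>m n. crA m (\<Delta>A v n))"
  proof (induct v rule: A.tensor_induct)
    case (tensor b h)
    show ?case by (rule weak_coassociativity_tensor) blast
  next
    case (add x y)
    then obtain C E where C: "upper_bounded C"
        "taylor_expand sAAA 1 C = two_var (\<lambda>m n. clA m (\<Delta>A x n))"
        "taylor_expand sAAA (- 1) (rotate_index C) = two_var (\<lambda>m n. crA m (\<Delta>A x n))"
      and E: "upper_bounded E"
        "taylor_expand sAAA 1 E = two_var (\<lambda>m n. clA m (\<Delta>A y n))"
        "taylor_expand sAAA (- 1) (rotate_index E) = two_var (\<lambda>m n. crA m (\<Delta>A y n))"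
      by blast
    have r: "rotate_index (\<lambda>x. C x + E x) = (\<lambda>x. rotate_index C x + rotate_index E x)"
      by (auto simp: rotate_index_def)
    show ?case
    proof (intro exI[of _ "\<lambda>x. C x + E x"] conjI)
      show "taylor_expand sAAA 1 (\<lambda>x. C x + E x) = two_var (\<lambda>m n. clA m (\<Delta>A (x + y) n))"
        by (rule ext) (simp add: taylor_expand_add[OF A.V_space(3)] C E linear_add[OF linear_\<Delta>A] c_add
            two_var_def case_prod_unfold)
      show "taylor_expand sAAA (- 1) (rotate_index (\<lambda>x. C x + E x)) =
          two_var (\<lambda>m n. crA m (\<Delta>A (x + y) n))"
        unfolding r
        by (rule ext) (simp add: taylor_expand_add[OF A.V_space(3)] C E linear_add[OF linear_\<Delta>A] c_add
            upper_bounded_rotate_index two_var_def case_prod_unfold)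
    qed (rule upper_bounded_add[OF C(1) E(1)])
  qed
  then obtain C where C: "upper_bounded C"
      "taylor_expand sAAA 1 C = two_var (\<lambda>m n. clA m (\<Delta>A v n))"
      "taylor_expand sAAA (- 1) (rotate_index C) = two_var (\<lambda>m n. crA m (\<Delta>A v n))"
    by blast
  have "(\<lambda>(i, j, l). C (i, j, l)) = C" "(\<lambda>(j, l, i). C (i, j, l)) = rotate_index C"
    by (auto simp: rotate_index_def)
  then show ?thesis
    by (intro exI[of _ "\<lambda>i j l. C (i, j, l)"])
      (simp add: bounded_support_iff expand_z_w_eq expand_w_u_eq C two_var_apply)
qed

end

section \<open>Multiplicativity\<close>

context smash_product
begin

text \<open>A componentwise action with four legs in view, as needed for exchanging the middle
  two.\<close>

definition hact2 :: "'hh \<Rightarrow> 'hh \<Rightarrow> 'aa \<Rightarrow> 'aa" where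
  "hact2 u v = tlift tAA (\<lambda>a b. tAA (hact u a) (hact v b))"

lemma bilinear_hact2_aux: "bilinear_map sA sA sAA (\<lambda>a b. tAA (hact u a) (hact v b))"
  by (intro bilinear_mapI op_li bil_li)

lemma hact2_tensor: "hact2 u v (tAA a b) = tAA (hact u a) (hact v b)"
  unfolding hact2_def by (rule A.V2.tlift_tensor[OF bilinear_hact2_aux])

lemma linear_hact2:
  "Vector_Spaces.linear sHH sAA (\<lambda>u. hact2 u v w)" "Vector_Spaces.linear sHH sAA (\<lambda>v. hact2 u v w)"
  "Vector_Spaces.linear sAA sAA (hact2 u v)"
  unfolding hact2_def
  by (intro A.V2.linear_tlift_param[OF bilinear_hact2_aux] A.V2.linear_tlift[OF bilinear_hact2_aux] op_li bil_li)+

lemmas hact2_add = linear_hact2[THEN linear_add]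

text \<open>Writing \<open>diag h\<close> as \<open>L\<close> and \<open>M\<close> of the two legs
  of \<open>h\<close>, its coproduct places legs 1 and 3 of the fourfold coproduct on the left
  factor, whereas \<open>diag2\<close> places legs 1 and 2 there. Cocommutativity identifies the
  two.\<close>

lemma \<Delta>A_diag: "\<Delta>A (diag h a) = conv diag2 (D h) (\<Delta>A a)"
proof
  fix n
  let ?W = "\<Delta>A a"
  \<comment> \<open>\<open>Q\<close> takes the coproducts of the legs used by \<open>L\<close> and
    by \<open>M\<close>, \<open>Q'\<close> those of the legs meant for the left and the right
    factor. In \<open>Q'\<close> both legs of \<open>u\<close> carry the exponential, hence
    \<open>TH2_power\<close>.\<close>
  define Q where "Q u v = conv LL (\<lambda>i. H.shift_left i u) (conv MM (\<lambda>j. H.shift_left j v) ?W) n" for u v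
  define Q' where "Q' u v = conv (\<lambda>y w. hact2 y v w) (\<lambda>i. H.TH2_power i u) ?W n" for u v
  have TH2_bounded: "upper_bounded (\<lambda>i. H.TH2_power i u)" for u
    by (rule upper_bounded_int_tensor_induct[OF H.HH_tensor H.linear_TH2_power])
      (simp add: H.TH2_power_tensor upper_bounded_conv H.bounded_TH_power)
  have bh: "bilinear_map sHH sAA sAA (\<lambda>y w. hact2 y v w)" for v
    by (intro bilinear_mapI linear_hact2)
  have Q: "bilinear_map sHH sHH sAA Q"
    unfolding Q_def[abs_def]
    by (rule conv_bilinear[OF bilinear_LL H.linear_shift_left H.bounded_shift_left
          conv_linear_left[OF bilinear_MM H.linear_shift_left H.bounded_shift_left bounded_\<Delta>A]
          upper_bounded_conv[OF H.bounded_shift_left bounded_\<Delta>A]])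
  have Q'1: "Vector_Spaces.linear sHH sAA (\<lambda>u. Q' u v)" for v
    unfolding Q'_def by (rule conv_linear_left[OF bh H.linear_TH2_power TH2_bounded bounded_\<Delta>A])
  \<comment> \<open>The index set of this sum does not involve \<open>v\<close>, so linearity holds
    term by term.\<close>
  have Q'2: "Vector_Spaces.linear sHH sAA (\<lambda>v. Q' u v)" for u
  proof -
    show ?thesis
      unfolding Q'_def conv_def case_prod_unfold
      by (rule linear_sum_fun[OF H.V_space(2) A.V_space(2)]) (rule linear_hact2)
  qed
  have Q': "bilinear_map sHH sHH sAA Q'"
    by (rule bilinear_mapI[OF Q'2 Q'1])
  have ex: "Q' (tHH p q) (tHH c d) = Q (tHH p c) (tHH q d)" for p q c d
  proof -
    let ?p = "\<lambda>i. H.TH_power i p" and ?q = "\<lambda>i. H.TH_power i q"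
    have e: "hact2 (tHH x y) (tHH c d) w = LL (tHH x c) (MM (tHH y d) w)" for x y w
      by (induct w rule: A.V2.tensor_induct)
        (simp_all add: hact2_tensor op2_tensor hact_L_M hact2_add op2_add)
    have bL: "biadditive (\<lambda>x z. LL (tHH x c) z)" and bM: "biadditive (\<lambda>x z. MM (tHH x d) z)"
      by (simp_all add: biadditive_def op2_add tensor_add)
    have "Q (tHH p c) (tHH q d) =
        conv (\<lambda>x z. LL (tHH x c) z) ?p (conv (\<lambda>x z. MM (tHH x d) z) ?q ?W) n"
    proof -
      have "conv MM (\<lambda>j. tHH (?q j) d) ?W = conv (\<lambda>x z. MM (tHH x d) z) ?q ?W"
        by (rule conv_map[where \<psi> = "\<lambda>x. x"])
          (simp_all add: op2_biadditive tensor_add H.bounded_TH_power bounded_\<Delta>A)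
      moreover have "conv LL (\<lambda>j. tHH (?p j) c) Z = conv (\<lambda>x z. LL (tHH x c) z) ?p Z"
        if "upper_bounded Z" for Z
        by (rule conv_map[where \<psi> = "\<lambda>x. x"])
          (simp_all add: op2_biadditive tensor_add H.bounded_TH_power that)
      ultimately show ?thesis
        by (simp add: Q_def H.shift_left_tensor upper_bounded_conv H.bounded_TH_power bounded_\<Delta>A)
    qed
    also have "\<dots> = tconv (\<lambda>x y w. LL (tHH x c) (MM (tHH y d) w)) ?p ?q ?W n"
      by (rule conv_conv_right[OF bL bM, THEN fun_cong]) (rule H.bounded_TH_power bounded_\<Delta>A)+
    also have "\<dots> = tconv (\<lambda>x y w. hact2 (tHH x y) (tHH c d) w) ?p ?q ?W n"
      by (simp add: e)
    also have "\<dots> = conv (\<lambda>y w. hact2 y (tHH c d) w) (conv tHH ?p ?q) ?W n"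
      by (rule conv_conv_left[OF bilinear_map_biadditive[OF bh] bilinear_map_biadditive[OF H.V2.bilinear_t],
            THEN fun_cong, symmetric]) (rule H.bounded_TH_power bounded_\<Delta>A)+
    finally show ?thesis by (simp add: Q'_def H.TH2_power_tensor[abs_def])
  qed
  have bQ: "bilinear_map sH sH sAA (\<lambda>x y. Q (\<Delta>H x) (\<Delta>H y))"
    and bQ': "bilinear_map sH sH sAA (\<lambda>x y. Q' (\<Delta>H x) (\<Delta>H y))"
    by (intro bilinear_mapI linear_bilinear_left[OF Q] linear_bilinear_right[OF Q]
        linear_bilinear_left[OF Q'] linear_bilinear_right[OF Q'] H.linear_\<Delta>H)+
  have 1: "\<Delta>A (hact u a) n = tlift tHH (\<lambda>x y. Q (\<Delta>H x) (\<Delta>H y)) u" for u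
  proof (rule H.V2.linear_eqI[OF _ H.V2.linear_tlift[OF bQ]])
    show "Vector_Spaces.linear sHH sAA (\<lambda>u. \<Delta>A (hact u a) n)"
      by (rule linear_comp[OF linear_\<Delta>A]) (intro op_li bil_li)
    show "\<Delta>A (hact (tHH x y) a) n = tlift tHH (\<lambda>x y. Q (\<Delta>H x) (\<Delta>H y)) (tHH x y)" for x y
      by (unfold H.V2.tlift_tensor[OF bQ], simp add: hact_L_M \<Delta>A_L \<Delta>A_M Q_def H.DH_eq[abs_def])
  qed
  have 2: "conv diag2 (\<lambda>i. H.shift_left i u) ?W n = tlift tHH (\<lambda>x y. Q' (\<Delta>H x) (\<Delta>H y)) u" for u
  proof (rule H.V2.linear_eqI[OF _ H.V2.linear_tlift[OF bQ']])
    show "Vector_Spaces.linear sHH sAA (\<lambda>u. conv diag2 (\<lambda>i. H.shift_left i u) ?W n)"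
      by (rule conv_linear_left[OF bilinear_diag2 H.linear_shift_left H.bounded_shift_left bounded_\<Delta>A])
    fix x y
    have d: "diag2 (tHH x y) w = hact2 (\<Delta>H x) (\<Delta>H y) w" for x y w
      by (induct w rule: A.V2.tensor_induct) (simp_all add: op2_tensor hact2_tensor diag_def op2_add hact2_add)
    have "conv diag2 (\<lambda>i. H.shift_left i (tHH x y)) ?W n = conv (\<lambda>z w. diag2 (tHH z y) w) (\<lambda>i. H.TH_power i x) ?W n"
      unfolding H.shift_left_tensor
      by (rule conv_map[where \<psi> = "\<lambda>x. x", THEN fun_cong])
        (simp_all add: op2_biadditive tensor_add H.bounded_TH_power bounded_\<Delta>A)
    also have "\<dots> = conv (\<lambda>z w. hact2 (\<Delta>H z) (\<Delta>H y) w) (\<lambda>i. H.TH_power i x) ?W n"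
      by (simp add: d)
    also have "\<dots> = conv (\<lambda>z w. hact2 z (\<Delta>H y) w) (\<lambda>i. \<Delta>H (H.TH_power i x)) ?W n"
      by (rule conv_map[where \<psi> = "\<lambda>x. x", symmetric, THEN fun_cong])
        (simp_all add: bilinear_map_biadditive[OF bh] linear_add[OF H.linear_\<Delta>H] H.bounded_TH_power bounded_\<Delta>A)
    finally show "conv diag2 (\<lambda>i. H.shift_left i (tHH x y)) ?W n = tlift tHH (\<lambda>x y. Q' (\<Delta>H x) (\<Delta>H y)) (tHH x y)"
      by (unfold H.V2.tlift_tensor[OF bQ'], simp add: Q'_def H.\<Delta>H_TH_power)
  qed
  have "\<Delta>A (diag h a) n = tlift tHH (\<lambda>x y. Q (\<Delta>H x) (\<Delta>H y)) (\<Delta>H h)"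
    unfolding diag_def by (rule 1)
  also have "\<dots> = tlift tHH (\<lambda>x y. Q' (\<Delta>H x) (\<Delta>H y)) (\<Delta>H h)"
    by (rule H.middle_exchange[OF Q Q' ex])
  also have "\<dots> = conv diag2 (D h) ?W n"
    by (simp only: 2[symmetric] H.DH_eq[abs_def])
  finally show "\<Delta>A (diag h a) n = conv diag2 (D h) ?W n" .
qed

section \<open>Coproduct of left multiplication by \<open>B\<close>\<close>

definition lmul2 :: "'bb \<Rightarrow> 'aa \<Rightarrow> 'aa" where "lmul2 = tmap2 tBB tAA tAA lmul lmul"
definition mulB2 :: "'bb \<Rightarrow> 'bb \<Rightarrow> 'bb" where "mulB2 = tmap2 tBB tBB tBB (*) (*)"

lemma bilinear_lmul2: "bilinear_map sBB sAA sAA lmul2"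
  unfolding lmul2_def by (rule bilinear_tmap2[OF BB_tensor AA_tensor AA_tensor bilinear_lmul bilinear_lmul])
lemma lmul2_tensor: "lmul2 (tBB b c) (tAA a a') = tAA (lmul b a) (lmul c a')"
  unfolding lmul2_def by (rule tmap2_tensor[OF BB_tensor AA_tensor AA_tensor bilinear_lmul bilinear_lmul])
lemma bilinear_mulB2: "bilinear_map sBB sBB sBB mulB2"
  unfolding mulB2_def by (rule bilinear_tmap2[OF BB_tensor BB_tensor BB_tensor B.bilinear_mul B.bilinear_mul])
lemma mulB2_tensor: "mulB2 (tBB b c) (tBB b' c') = tBB (b * b') (c * c')"
  unfolding mulB2_def by (rule tmap2_tensor[OF BB_tensor BB_tensor BB_tensor B.bilinear_mul B.bilinear_mul])

lemmas li2 = linear_bilinear_left[OF bilinear_lmul2] linear_bilinear_right[OF bilinear_lmul2]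
  linear_bilinear_left[OF bilinear_mulB2] linear_bilinear_right[OF bilinear_mulB2]
  linear_bilinear_left[OF bilinear_act2] linear_bilinear_right[OF bilinear_act2]
  linear_comp[OF linear_hact2(1)] linear_comp[OF linear_hact2(3)]

lemmas more_add = bilinear_mapD(1,2)[OF bilinear_lmul2] bilinear_mapD(1,2)[OF bilinear_mulB2]
  bilinear_mapD(1,2)[OF bilinear_act2]

text \<open>\<open>\<Phi> (b\<^sub>1 \<otimes> b\<^sub>2) (y\<^sub>1 \<otimes> y\<^sub>2 \<otimes> y\<^sub>3)\<close> is the operator \<open>(b\<^sub>1 \<cdot> y\<^sub>1 \<cdot> y\<^sub>2) \<otimes> (y\<^sub>3 b\<^sub>2)\<close> on \<open>A \<otimes> A\<close>, where
  \<open>y\<^sub>1\<close> acts on the factor \<open>B\<close> and \<open>y\<^sub>2\<close> on the factor \<open>H\<close> of \<open>A\<close>.\<close>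

definition \<Phi> :: "'bb \<Rightarrow> 'hhh \<Rightarrow> 'aa \<Rightarrow> 'aa" where
  "\<Phi> x y w = tlift tHHH (\<lambda>v c. lmul2 (act2 (tHH 1 c) x) (hact2 v (tHH 1 1) w)) y"

lemma bilinear_\<Phi>_aux: "bilinear_map sHH sH sAA (\<lambda>v c. lmul2 (act2 (tHH 1 c) x) (hact2 v (tHH 1 1) w))"
  by (intro bilinear_mapI li2(1-6) linear_hact2 bil_li)

lemma \<Phi>_tensor: "\<Phi> x (tHHH v c) w = lmul2 (act2 (tHH 1 c) x) (hact2 v (tHH 1 1) w)"
  unfolding \<Phi>_def by (rule H.V3.tlift_tensor[OF bilinear_\<Phi>_aux])

lemma linear_\<Phi>: "Vector_Spaces.linear sBB sAA (\<lambda>x. \<Phi> x y w)"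
  "Vector_Spaces.linear sHHH sAA (\<lambda>y. \<Phi> x y w)" "Vector_Spaces.linear sAA sAA (\<lambda>w. \<Phi> x y w)"
  unfolding \<Phi>_def
  by (intro H.V3.linear_tlift[OF bilinear_\<Phi>_aux] H.V3.linear_tlift_param[OF bilinear_\<Phi>_aux]
      li2(1-6) linear_hact2 bil_li)+

lemmas \<Phi>_add = linear_\<Phi>[THEN linear_add]
lemmas \<Phi>_zero = linear_\<Phi>[THEN linear_zero]

lemma \<Phi>_tensor': "\<Phi> (tBB b c) (tHHH (tHH x y) z) (tAA a a') =
    tAA (lmul b (L x (M y a))) (lmul (act z c) a')"
  by (simp add: \<Phi>_tensor act2_tensor hact2_tensor lmul2_tensor hact_L_M act_one hact_one L_one M_one)

text \<open>The operator \<open>\<rho> r\<close> composed with \<open>\<Phi> x (l13 s)\<close> once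
  the second leg of \<open>r\<close> has been split by the product: of \<open>y\<close> the first
  leg multiplies the \<open>H\<close>-part of the left factor, the second acts on the second leg of
  \<open>x\<close>, the third acts on the \<open>B\<close>-part of the right factor.\<close>

definition \<Psi> :: "'bb \<Rightarrow> 'hh \<Rightarrow> 'hhh \<Rightarrow> 'aa \<Rightarrow> 'aa" where
  "\<Psi> x s y w = tlift tHHH (\<lambda>u d. \<Phi> x (mult3 tHH tHHH (H.l13 s) (H.l23 u)) (\<rho> (tHH 1 d) w)) y"

lemma linear_\<Phi>_comp:
  assumes "Vector_Spaces.linear s sHHH F"
  shows "Vector_Spaces.linear s sAA (\<lambda>z. \<Phi> x (F z) w)"
  by (rule linear_comp[OF linear_\<Phi>(2) assms])

lemma linear_\<Phi>_comp':
  assumes "Vector_Spaces.linear s sAA F"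
  shows "Vector_Spaces.linear s sAA (\<lambda>z. \<Phi> x y (F z))"
  by (rule linear_comp[OF linear_\<Phi>(3) assms])

lemma bilinear_\<Psi>_aux: "bilinear_map sHH sH sAA
    (\<lambda>u d. \<Phi> x (mult3 tHH tHHH (H.l13 s) (H.l23 u)) (\<rho> (tHH 1 d) w))"
  by (intro bilinear_mapI linear_\<Phi>_comp linear_\<Phi>_comp' linear_bilinear_right[OF H.bilinear_mult3]
      H.linear_leg linear_bilinear_left[OF bilinear_\<rho>] bil_li)

lemma \<Psi>_tensor: "\<Psi> x s (tHHH u d) w = \<Phi> x (mult3 tHH tHHH (H.l13 s) (H.l23 u)) (\<rho> (tHH 1 d) w)"
  unfolding \<Psi>_def by (rule H.V3.tlift_tensor[OF bilinear_\<Psi>_aux])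

lemma linear_\<Psi>: "Vector_Spaces.linear sBB sAA (\<lambda>x. \<Psi> x s y w)"
  "Vector_Spaces.linear sHH sAA (\<lambda>s. \<Psi> x s y w)"
  "Vector_Spaces.linear sHHH sAA (\<lambda>y. \<Psi> x s y w)" "Vector_Spaces.linear sAA sAA (\<lambda>w. \<Psi> x s y w)"
  unfolding \<Psi>_def
  by (intro H.V3.linear_tlift[OF bilinear_\<Psi>_aux] H.V3.linear_tlift_param[OF bilinear_\<Psi>_aux]
      linear_\<Phi> linear_\<Phi>_comp linear_\<Phi>_comp' linear_bilinear_left[OF H.bilinear_mult3]
      linear_bilinear_right[OF bilinear_\<rho>] H.linear_leg bil_li)+

lemmas \<Psi>_add = linear_\<Psi>[THEN linear_add]

lemma \<Psi>_reassoc: "tAA (lmul b (L s1 (M r a))) (tlift tHH (\<lambda>x1 x2. lmul (act x1 (act s2 c)) (L x2 a')) v) =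
    \<Psi> (tBB b c) (tHH s1 s2) (H.reassoc r v) (tAA a a')"
proof -
  have bil: "bilinear_map sH sH sA (\<lambda>x1 x2. lmul (act x1 (act s2 c)) (L x2 a'))"
    by (intro bilinear_mapI op_li bil_li)
  show ?thesis
  proof (rule H.V2.linear_eqI[where x = v])
    show "Vector_Spaces.linear sHH sAA (\<lambda>v. tAA (lmul b (L s1 (M r a)))
        (tlift tHH (\<lambda>x1 x2. lmul (act x1 (act s2 c)) (L x2 a')) v))"
      by (rule linear_bilinear_right[OF A.V2.bilinear_t H.V2.linear_tlift[OF bil]])
    show "Vector_Spaces.linear sHH sAA (\<lambda>v. \<Psi> (tBB b c) (tHH s1 s2) (H.reassoc r v) (tAA a a'))"
      by (rule linear_comp[OF linear_\<Psi>(3)])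
        (intro linear_bilinear_right[OF H.bilinear_reassoc] bil_li)
    show "tAA (lmul b (L s1 (M r a))) (tlift tHH (\<lambda>x1 x2. lmul (act x1 (act s2 c)) (L x2 a')) (tHH x y)) =
        \<Psi> (tBB b c) (tHH s1 s2) (H.reassoc r (tHH x y)) (tAA a a')" for x y
      by (unfold H.V2.tlift_tensor[OF bil], simp add: H.reassoc_tensor \<Psi>_tensor H.leg_tensor H.mult3_tensor
          H.mult2_tensor op2_tensor \<Phi>_tensor' M_one mult.commute flip: act_mult)
  qed
qed

text \<open>On the right factor \<open>L\<close> meets a product with an element of
  \<open>B\<close>, and \<open>L_lmul\<close> splits the second leg of \<open>r\<close>.\<close>

lemma \<rho>_\<Phi>: "\<rho> r (\<Phi> x (H.l13 s) w) = \<Psi> x s (cop_right tHH tHHH \<Delta>H r) w"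
  by (induct r rule: H.V2.tensor_induct, induct s rule: H.V2.tensor_induct,
      induct x rule: B.V2.tensor_induct, induct w rule: A.V2.tensor_induct)
    (simp_all add: H.leg_tensor H.leg_add \<Phi>_tensor' op2_tensor op2_add \<Phi>_add \<Psi>_add
      H.cop_right_tensor[OF H.linear_\<Delta>H] linear_add[OF H.linear_cop_right[OF H.linear_\<Delta>H]]
      M_lmul M_one L_lmul L_M_commute[symmetric] flip: \<Psi>_reassoc)

text \<open>For a product on legs 12 and 13, the first factor joins the coefficient of
  \<open>\<Phi>\<close> and the second becomes a twist of \<open>w\<close>.\<close>

lemma \<Psi>_mult3: "\<Psi> x s (mult3 tHH tHHH (H.l12 p) (H.l13 q)) w =
    \<Phi> x (mult3 tHH tHHH (H.l13 s) (H.l23 p)) (\<rho> q w)"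
  by (induct p rule: H.V2.tensor_induct, induct q rule: H.V2.tensor_induct,
      induct s rule: H.V2.tensor_induct, induct x rule: B.V2.tensor_induct, induct w rule: A.V2.tensor_induct)
    (simp_all add: H.leg_tensor H.leg_add H.mult3_tensor H.mult2_tensor H.mult3_add \<Psi>_tensor \<Phi>_tensor'
      op2_tensor op2_add \<Phi>_add \<Psi>_add M_one, simp_all add: M_def hact_hact H.mult2_tensor)

text \<open>Multiplying by an element of \<open>H\<close> in the left factor is \<open>diag\<close>,
  which splits the first leg of \<open>r\<close>; hence the left coproduct.\<close>

lemma \<mu>2_\<Phi>: "\<mu>2 (\<rho> r (\<gamma> x (tHH 1 1))) w = \<Phi> x (cop_left tHH tHHH \<Delta>H r) w"
  by (induct r rule: H.V2.tensor_induct, induct x rule: B.V2.tensor_induct, induct w rule: A.V2.tensor_induct)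
    (simp_all add: op2_tensor op2_add M_tensor L_tensor smash_mult_tensor diag_one diag_def \<Phi>_tensor act2_tensor
      hact2_tensor lmul2_tensor act_one hact_one \<Phi>_add H.cop_left_tensor[OF H.linear_\<Delta>H]
      linear_add[OF H.linear_cop_left[OF H.linear_\<Delta>H]] H.\<Delta>H_one more_add)

text \<open>The two hexagon relations turn the factor \<open>R\<close> of \<open>\<Delta>(b b')\<close>, followed by the twist by \<open>R\<close>, into
  the twist by \<open>R\<close> of \<open>\<Delta>(b')\<close> multiplied by the twist of \<open>\<Delta>(b)\<close>.\<close>

lemma twist_exchange:
  assumes V: "upper_bounded V"
  shows "conv \<rho> H.R' (conv (\<lambda>s w. \<Phi> x (H.l13 s) w) H.R' V) =
    conv (\<lambda>r w. \<Phi> x (cop_left tHH tHHH \<Delta>H r) w) H.R' (conv \<rho> H.R' V)"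
proof -
  let ?\<nu> = "\<lambda>a b. mult3 tHH tHHH (H.l12 a) (H.l13 b)" and ?\<mu> = "\<lambda>a b. mult3 tHH tHHH (H.l13 a) (H.l23 b)"
  have n: "biadditive ?\<nu>" and m: "biadditive ?\<mu>"
    by (simp_all add: biadditive_def H.mult3_add H.leg_add)
  have W: "upper_bounded (conv \<rho> H.R' V)" by (rule upper_bounded_conv[OF H.bounded_R' V])
  have b13: "biadditive (\<lambda>s w. \<Phi> x (H.l13 s) w)" and b\<Phi>: "biadditive (\<lambda>y w. \<Phi> x y w)"
    and b\<mu>: "biadditive (\<lambda>p w. \<Phi> x (?\<mu> s p) w)" and b\<Psi>: "biadditive (\<lambda>y w. \<Psi> x s y w)"
    and b\<rho>: "biadditive (\<lambda>r w. \<rho> r (\<Phi> x (H.l13 s) w))" for s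
    by (simp_all add: biadditive_def \<Phi>_add \<Psi>_add op2_add H.mult3_add H.leg_add)
  note bR = H.bounded_R'
  \<comment> \<open>With the braiding coefficient \<open>s\<close> fixed, the right hexagon splits
    the outer twist; its part \<open>p\<close> joins \<open>s\<close>, the other part twists
    \<open>V\<close>.\<close>
  have fixed_s: "conv (\<lambda>r w. \<rho> r (\<Phi> x (H.l13 s) w)) H.R' V =
      conv (\<lambda>p w. \<Phi> x (?\<mu> s p) w) H.R' (conv \<rho> H.R' V)" for s
  proof -
    have "conv (\<lambda>r w. \<rho> r (\<Phi> x (H.l13 s) w)) H.R' V =
        conv (\<lambda>r w. \<Psi> x s (cop_right tHH tHHH \<Delta>H r) w) H.R' V"
      by (simp add: \<rho>_\<Phi>)
    also have "\<dots> = conv (\<lambda>y w. \<Psi> x s y w) (\<lambda>n. cop_right tHH tHHH \<Delta>H (H.R' n)) V"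
      by (rule conv_map[where \<psi> = "\<lambda>x. x", symmetric])
        (simp_all add: b\<Psi> linear_add[OF H.linear_cop_right[OF H.linear_\<Delta>H]] bR V)
    also have "(\<lambda>n. cop_right tHH tHHH \<Delta>H (H.R' n)) = conv ?\<nu> H.R' H.R'"
      by (rule ext) (rule H.hexagon_right_0)
    also have "conv (\<lambda>y w. \<Psi> x s y w) \<dots> V = conv (\<lambda>p w. \<Phi> x (?\<mu> s p) w) H.R' (conv \<rho> H.R' V)"
      by (rule conv_assoc[OF b\<Psi> n b\<mu> op2_biadditive(2) bR bR V \<Psi>_mult3])
    finally show ?thesis .
  qed
  have "conv \<rho> H.R' (conv (\<lambda>s w. \<Phi> x (H.l13 s) w) H.R' V) =
      tconv (\<lambda>r s w. \<rho> r (\<Phi> x (H.l13 s) w)) H.R' H.R' V"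
    by (rule conv_conv_right[OF op2_biadditive(2) b13 bR bR V])
  also have "\<dots> = tconv (\<lambda>s r w. \<rho> r (\<Phi> x (H.l13 s) w)) H.R' H.R' V"
    by (rule tconv_swap_left)
  also have "\<dots> = tconv (\<lambda>s p w. \<Phi> x (?\<mu> s p) w) H.R' H.R' (conv \<rho> H.R' V)"
  proof (rule tconv_cong[OF b\<rho> _ b\<mu> _ bR bR V bR W fixed_s])
    have "H.l13 0 = 0" by (rule linear_zero[OF H.linear_leg(2)])
    then show "\<rho> r (\<Phi> x (H.l13 0) w) = 0" "\<Phi> x (?\<mu> 0 r) w = 0" for r w
      using biadditiveD(4)[OF op2_biadditive(2)] biadditiveD(3)[OF m] by (simp_all add: \<Phi>_zero)
  qed
  \<comment> \<open>With \<open>s\<close> and \<open>p\<close> both running through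
    \<open>R'\<close>, their product is one side of the left hexagon, which is now read
    backwards.\<close>
  also have "\<dots> = conv (\<lambda>y w. \<Phi> x y w) (conv ?\<mu> H.R' H.R') (conv \<rho> H.R' V)"
    by (rule conv_conv_left[OF b\<Phi> m bR bR W, symmetric])
  also have "conv ?\<mu> H.R' H.R' = (\<lambda>n. cop_left tHH tHHH \<Delta>H (H.R' n))"
    by (rule ext) (rule H.hexagon_left_0[symmetric])
  also have "conv (\<lambda>y w. \<Phi> x y w) \<dots> (conv \<rho> H.R' V) =
      conv (\<lambda>r w. \<Phi> x (cop_left tHH tHHH \<Delta>H r) w) H.R' (conv \<rho> H.R' V)"
    by (rule conv_map[where \<psi> = "\<lambda>x. x"])
      (simp_all add: b\<Phi> linear_add[OF H.linear_cop_left[OF H.linear_\<Delta>H]] bR W)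
  finally show ?thesis .
qed

lemma bilinear_braided_aux: "bilinear_map sH sH sBB (\<lambda>r1 r2. mulB2 (act2 (tHH 1 r1) x) (act2 (tHH r2 1) y))"
  by (intro bilinear_mapI li2(1-6) bil_li)

lemma braided_mult_eq: "braided_mult tHH tBB act r x y =
    tlift tHH (\<lambda>r1 r2. mulB2 (act2 (tHH 1 r1) x) (act2 (tHH r2 1) y)) r"
proof -
  have 1: "tlift tBB (\<lambda>c1 c2. tBB (b1 * act r2 c1) (act r1 b2 * c2)) y =
      mulB2 (act2 (tHH 1 r1) (tBB b1 b2)) (act2 (tHH r2 1) y)" for r1 r2 b1 b2
  proof -
    have "Vector_Spaces.linear sBB sBB (\<lambda>y. mulB2 (act2 (tHH 1 r1) (tBB b1 b2)) (act2 (tHH r2 1) y))"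
      by (intro li2(1-6) bil_li)
    from B.V2.linear_eq_tlift[OF this] show ?thesis by (simp add: act2_tensor mulB2_tensor act_one)
  qed
  have 2: "tlift tBB (\<lambda>b1 b2. mulB2 (act2 (tHH 1 r1) (tBB b1 b2)) (act2 (tHH r2 1) y)) x =
      mulB2 (act2 (tHH 1 r1) x) (act2 (tHH r2 1) y)" for r1 r2
    by (rule B.V2.linear_eq_tlift[where s = sBB]) (intro li2(1-6) bil_li)
  show ?thesis unfolding braided_mult_def 1 2 ..
qed

lemma braided_mult_tensor: "braided_mult tHH tBB act (tHH r1 r2) x y =
    mulB2 (act2 (tHH 1 r1) x) (act2 (tHH r2 1) y)"
  unfolding braided_mult_eq by (rule H.V2.tlift_tensor[OF bilinear_braided_aux])

lemma linear_braided_mult: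
  "Vector_Spaces.linear sHH sBB (\<lambda>r. braided_mult tHH tBB act r x y)"
  "Vector_Spaces.linear sBB sBB (\<lambda>x. braided_mult tHH tBB act r x y)"
  "Vector_Spaces.linear sBB sBB (\<lambda>y. braided_mult tHH tBB act r x y)"
  unfolding braided_mult_eq
  by (intro H.V2.linear_tlift[OF bilinear_braided_aux] H.V2.linear_tlift_param[OF bilinear_braided_aux]
      li2(1-6) bil_li)+

lemmas braided_add = linear_braided_mult[THEN linear_add]

text \<open>The braiding acts on the second leg of \<open>x\<close> and the first leg of
  \<open>y\<close>, which belong to different factors of \<open>A \<otimes> A\<close>; so it appears
  as \<open>\<Phi>\<close> with the flipped \<open>r\<close> on legs 1 and 3.\<close>

lemma \<gamma>_braided: "\<gamma> (braided_mult tHH tBB act r x y) z = \<Phi> x (H.l13 (H.flip r)) (\<gamma> y z)"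
  by (induct r rule: H.V2.tensor_induct, induct x rule: B.V2.tensor_induct,
      induct y rule: B.V2.tensor_induct, induct z rule: H.V2.tensor_induct)
    (simp_all add: braided_mult_tensor braided_add act2_tensor mulB2_tensor op2_tensor op2_add act_one
      H.flip_tensor H.leg_tensor H.leg_add linear_add[OF H.linear_flip] \<Phi>_tensor' \<Phi>_add lmul_tensor L_tensor M_tensor)

lemma DH_one: "D 1 = (\<lambda>n. if n = 0 then tHH 1 1 else 0)"
proof
  fix n
  have "TH 1 = 0" using H.derivation_TH[of 1 1] by simp
  then have "(TH ^^ k) 1 = (if k = 0 then 1 else 0)" for k
    by (induction k) (simp_all add: linear_zero[OF H.linear_TH])
  then have "H.TH_power n 1 = (if n = 0 then 1 else 0)"
    using vector_space.vector_space_assms(4)[OF H.V_space(1)]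
    by (simp add: divided_power_def linear_zero[OF linear_scaled[OF linear_ident[OF H.V_space(1)]]])
  then show "D 1 n = (if n = 0 then tHH 1 1 else 0)"
    by (simp add: H.DH_eq H.\<Delta>H_one H.shift_left_tensor
        biadditiveD(3)[OF bilinear_map_biadditive[OF H.V2.bilinear_t]])
qed

lemma \<Delta>A_one: "\<Delta>A (tA b 1) = conv (\<lambda>r x. \<rho> r (\<gamma> x (tHH 1 1))) H.R' (\<Delta>B b)"
proof -
  have "\<Delta>0 (tA b 1) = (\<lambda>n. \<gamma> (\<Delta>B b n) (tHH 1 1))"
    unfolding \<Delta>0_tensor DH_one by (rule ext) (rule conv_delta_right[OF op2_biadditive(1)])
  then have "\<Delta>A (tA b 1) = conv \<rho> H.R' (\<lambda>n. \<gamma> (\<Delta>B b n) (tHH 1 1))"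
    by (simp add: \<Delta>A_eq)
  also have "\<dots> = conv (\<lambda>r x. \<rho> r (\<gamma> x (tHH 1 1))) H.R' (\<Delta>B b)"
    by (rule conv_map[where \<phi> = "\<lambda>x. x"]) (simp_all add: op2_biadditive op2_add bounds)
  finally show ?thesis .
qed

text \<open>The coefficients of the coproduct of \<open>b\<close> are pulled to the front and held
  fixed; for each of them the claim is \<open>twist_exchange\<close>, and \<open>conv_tconv\<close>
  restores the series.\<close>

lemma \<Delta>A_lmul: "\<Delta>A (lmul b a) n = conv \<mu>2 (\<Delta>A (tA b 1)) (\<Delta>A a) n"
proof (rule A.linear_eqI[where x = a])
  show "Vector_Spaces.linear sA sAA (\<lambda>a. \<Delta>A (lmul b a) n)"
    by (rule linear_comp[OF linear_\<Delta>A]) (intro op_li bil_li)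
  show "Vector_Spaces.linear sA sAA (\<lambda>a. conv \<mu>2 (\<Delta>A (tA b 1)) (\<Delta>A a) n)"
    by (rule conv_linear_right[OF bilinear_\<mu>2 bounded_\<Delta>A linear_\<Delta>A bounded_\<Delta>A])
  fix b' h
  let ?X = "\<Delta>B b" and ?X' = "\<Delta>B b'" and ?Y = "D h"
  let ?V = "conv \<gamma> ?X' ?Y" and ?br = "braided_mult tHH tBB act"
  let ?\<kappa> = "\<lambda>x r w. \<Phi> x (cop_left tHH tHHH \<Delta>H r) w"
  have bV: "upper_bounded ?V" by (intro upper_bounded_conv bounds)
  have b1: "biadditive (\<lambda>y t. \<gamma> t y)" and b2: "biadditive (\<lambda>r y. ?br r x y)"
    and b3: "biadditive (\<lambda>s w. \<Phi> x (H.l13 s) w)" and b4: "biadditive (?\<kappa> x)"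
    and b5: "biadditive (\<lambda>r w. \<Phi> x (H.l13 (H.flip r)) w)"
    and b6: "biadditive (\<lambda>r x. \<rho> r (\<gamma> x (tHH 1 1)))" for x
    by (simp_all add: biadditive_def op2_add braided_add \<Phi>_add H.leg_add linear_add[OF H.linear_flip]
        linear_add[OF H.linear_cop_left[OF H.linear_\<Delta>H]])
  have "conv \<gamma> (\<Delta>B (b * b')) ?Y = conv (\<lambda>y t. \<gamma> t y) ?Y (tconv (\<lambda>x r y. ?br r x y) ?X R ?X')"
  proof -
    have "\<Delta>B (b * b') = tconv ?br R ?X ?X'"
      by (rule ext) (simp add: coproduct_product conv3_eq_tconv)
    \<comment> \<open>Puts the coproduct of \<open>b\<close> first, the position in which
      \<open>conv_tconv\<close> allows a series.\<close>
    also have "\<dots> = tconv (\<lambda>x r y. ?br r x y) ?X R ?X'"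
      by (rule tconv_swap_left)
    finally show ?thesis by (simp add: conv_commute[of \<gamma>])
  qed
  also have "\<dots> = tconv (\<lambda>x s w. \<Phi> x (H.l13 s) w) ?X H.R' ?V"
  proof (rule conv_tconv[OF b1 b2 _ b3 _ bounds(2,1,4,1,3) bV])
    show "?br r 0 y = 0" for r y by (rule linear_zero[OF linear_braided_mult(2)])
    show "\<Phi> 0 (H.l13 r) y = 0" for r y by (rule \<Phi>_zero)
    fix x
    have "conv (\<lambda>y t. \<gamma> t y) ?Y (conv (\<lambda>r y. ?br r x y) R ?X') = conv \<gamma> (conv (\<lambda>r y. ?br r x y) R ?X') ?Y"
      by (rule conv_commute)
    also have "\<dots> = conv (\<lambda>r w. \<Phi> x (H.l13 (H.flip r)) w) R ?V"
      by (rule conv_assoc[OF op2_biadditive(1) b2 b5 op2_biadditive(1) bounds(4,1,2) \<gamma>_braided])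
    also have "\<dots> = conv (\<lambda>s w. \<Phi> x (H.l13 s) w) H.R' ?V"
      unfolding H.R'_def[abs_def]
      by (rule conv_map[where \<psi> = "\<lambda>x. x", symmetric]) (simp_all add: b3 linear_add[OF H.linear_flip] bounds bV)
    finally show "conv (\<lambda>y t. \<gamma> t y) ?Y (conv (\<lambda>r y. ?br r x y) R ?X') =
        conv (\<lambda>s w. \<Phi> x (H.l13 s) w) H.R' ?V" .
  qed
  finally have 1: "\<Delta>0 (lmul b (tA b' h)) = tconv (\<lambda>x s w. \<Phi> x (H.l13 s) w) ?X H.R' ?V"
    by (simp add: lmul_tensor \<Delta>0_tensor)
  have W: "\<Delta>A (tA b' h) = conv \<rho> H.R' ?V" by (simp add: \<Delta>A_eq \<Delta>0_tensor)
  have "\<Delta>A (lmul b (tA b' h)) = conv \<rho> H.R' (tconv (\<lambda>x s w. \<Phi> x (H.l13 s) w) ?X H.R' ?V)"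
    by (simp add: \<Delta>A_eq 1)
  also have "\<dots> = tconv ?\<kappa> ?X H.R' (\<Delta>A (tA b' h))"
    unfolding W
    by (rule conv_tconv[where h = "\<lambda>x s w. \<Phi> x (H.l13 s) w" and h' = ?\<kappa>, OF op2_biadditive(2) b3 \<Phi>_zero(1) b4 \<Phi>_zero(1) bounds(3,1,3) bV bounds(3)
          upper_bounded_conv[OF bounds(3) bV] twist_exchange[OF bV]])
  also have "\<dots> = tconv (\<lambda>r x w. ?\<kappa> x r w) H.R' ?X (\<Delta>A (tA b' h))"
    by (rule tconv_swap_left)
  also have "\<dots> = tconv (\<lambda>r x w. \<mu>2 (\<rho> r (\<gamma> x (tHH 1 1))) w) H.R' ?X (\<Delta>A (tA b' h))"
    by (simp add: \<mu>2_\<Phi>)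
  also have "\<dots> = conv \<mu>2 (\<Delta>A (tA b 1)) (\<Delta>A (tA b' h))"
    unfolding \<Delta>A_one by (rule conv_conv_left[OF op2_biadditive(5) b6 bounds(3,1) bounded_\<Delta>A, symmetric])
  finally show "\<Delta>A (lmul b (tA b' h)) n = conv \<mu>2 (\<Delta>A (tA b 1)) (\<Delta>A (tA b' h)) n" by simp
qed

text \<open>Moves the \<open>H\<close>-part of the first factor onto the second. By commutativity of
  \<open>H\<close> the action of \<open>x h\<close> is \<open>diag x\<close> followed by
  \<open>diag h\<close>.\<close>

lemma \<mu>2_MM: "\<mu>2 (MM y t) w = \<mu>2 t (diag2 y w)"
proof -
  have "\<mu> (M x a) c = \<mu> a (diag x c)" for x a c
    by (induct a rule: A.tensor_induct)
      (simp_all add: M_tensor smash_mult_tensor mu_add op_add mult.commute[of x] flip: diag_mult)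
  then show ?thesis
    by (induct y rule: H.V2.tensor_induct, induct t rule: A.V2.tensor_induct, induct w rule: A.V2.tensor_induct)
      (simp_all add: op2_tensor op2_add)
qed

text \<open>Since \<open>b \<otimes> h\<close> is \<open>M h\<close> applied to
  \<open>b \<otimes> 1\<close>, \<open>\<mu>2_MM\<close> separates the two parts, and
  \<open>\<Delta>A_diag\<close> and \<open>\<Delta>A_lmul\<close> treat them one after the
  other.\<close>

lemma \<Delta>A_mult: "\<Delta>A (\<mu> x a) n = conv \<mu>2 (\<Delta>A x) (\<Delta>A a) n"
proof (rule A.linear_eqI[where x = x])
  show "Vector_Spaces.linear sA sAA (\<lambda>x. \<Delta>A (\<mu> x a) n)"
    by (rule linear_comp[OF linear_\<Delta>A]) (intro linear_bilinear_left[OF bilinear_smash_mult] bil_li)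
  show "Vector_Spaces.linear sA sAA (\<lambda>x. conv \<mu>2 (\<Delta>A x) (\<Delta>A a) n)"
    by (rule conv_linear_left[OF bilinear_\<mu>2 linear_\<Delta>A bounded_\<Delta>A bounded_\<Delta>A])
  fix b h
  let ?T = "\<Delta>A (tA b 1)"
  have g: "biadditive (\<lambda>t y. MM y t)" using op2_biadditive(4) by (simp add: biadditive_def)
  have "\<Delta>A (tA b h) = conv MM (D h) ?T"
    using \<Delta>A_M[of h "tA b 1"] by (simp add: M_tensor)
  also have "\<dots> = conv (\<lambda>t y. MM y t) ?T (D h)"
    by (rule conv_commute)
  finally have "conv \<mu>2 (\<Delta>A (tA b h)) (\<Delta>A a) = conv \<mu>2 (conv (\<lambda>t y. MM y t) ?T (D h)) (\<Delta>A a)"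
    by simp
  also have "\<dots> = conv \<mu>2 ?T (conv diag2 (D h) (\<Delta>A a))"
    by (rule conv_assoc[OF op2_biadditive(5) g op2_biadditive(5,6) bounded_\<Delta>A H.bounded_DH bounded_\<Delta>A \<mu>2_MM])
  finally show "\<Delta>A (\<mu> (tA b h) a) n = conv \<mu>2 (\<Delta>A (tA b h)) (\<Delta>A a) n"
    by (simp add: smash_mult_tensor \<Delta>A_lmul \<Delta>A_diag)
qed

lemma smash_vertex_bialgebra: "vertex_bialgebra sA sAA sAAA tAA tAAA \<mu> \<Delta>A TA \<epsilon>A"
proof -
  have "nonlocal_vertex_coalgebra sA sAA sAAA tAA tAAA \<Delta>A TA \<epsilon>A"
  proof (intro nonlocal_vertex_coalgebra.intro nonlocal_vertex_coalgebra_axioms.intro)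
    show "tensor_powers sA sAA sAAA tAA tAAA" by (rule A.tensor_powers_axioms)
    show "Vector_Spaces.linear sA sAA (\<lambda>v. \<Delta>A v n)" for n by (rule linear_\<Delta>A)
    show "laurent_inf (\<Delta>A v)" for v
      using bounded_\<Delta>A by (simp add: upper_bounded_int_iff)
    show "Vector_Spaces.linear sA sA TA" by (rule linear_TA)
    show "Vector_Spaces.linear sA (*) \<epsilon>A" by (rule linear_\<epsilon>A)
    show "\<Delta>A (TA v) n = sAA (of_int (n + 1)) (\<Delta>A v (n + 1)) + tmap tAA tAA id TA (\<Delta>A v n)" for v n
      by (rule \<Delta>A_translation)
    show "\<exists>c. bounded_support c \<and>
       (\<forall>m n. clA m (\<Delta>A v n) = expand_z_w sAAA c m n) \<and>
       (\<forall>n p. crA n (\<Delta>A v p) = expand_w_u sAAA c n p)" for v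
      by (rule weak_coassociativity_smash)
    show "tlift tAA (\<lambda>a b. sA (\<epsilon>A a) b) (\<Delta>A v n) = (if n = 0 then v else 0)" for v n
      by (rule covacuum_left)
    show "tlift tAA (\<lambda>a b. sA (\<epsilon>A b) a) (\<Delta>A v 0) = v" for v
      by (simp add: covacuum_right)
    show "tlift tAA (\<lambda>a b. sA (\<epsilon>A b) a) (\<Delta>A v n) = 0" if "n < 0" for v n
      using that by (simp add: covacuum_right)
  qed
  moreover have "\<Delta>A (\<mu> x y) n = conv2 (tmap2 tAA tAA tAA \<mu> \<mu>) (\<Delta>A x) (\<Delta>A y) n" for x y n
    using \<Delta>A_mult by (simp add: conv2_eq_conv \<mu>2_def)
  ultimately show ?thesis
    by (intro vertex_bialgebra.intro vertex_bialgebra_axioms.intro smash_algebra)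
qed

end

theorem theorem4:
  fixes sH :: "'k::field_char_0 \<Rightarrow> 'h::comm_ring_1 \<Rightarrow> 'h"
    and sHH :: "'k \<Rightarrow> 'hh::ab_group_add \<Rightarrow> 'hh"
    and sHHH :: "'k \<Rightarrow> 'hhh::ab_group_add \<Rightarrow> 'hhh"
    and tHH :: "'h \<Rightarrow> 'h \<Rightarrow> 'hh"
    and tHHH :: "'hh \<Rightarrow> 'h \<Rightarrow> 'hhh"
    and \<Delta>H :: "'h \<Rightarrow> 'hh"
    and \<epsilon>H :: "'h \<Rightarrow> 'k"
    and TH :: "'h \<Rightarrow> 'h"
    and R :: "int \<Rightarrow> 'hh"
    and sB :: "'k \<Rightarrow> 'b::ring \<Rightarrow> 'b"
    and sBB :: "'k \<Rightarrow> 'bb::ab_group_add \<Rightarrow> 'bb"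
    and sBBB :: "'k \<Rightarrow> 'bbb::ab_group_add \<Rightarrow> 'bbb"
    and tBB :: "'b \<Rightarrow> 'b \<Rightarrow> 'bb"
    and tBBB :: "'bb \<Rightarrow> 'b \<Rightarrow> 'bbb"
    and \<Delta>B :: "'b \<Rightarrow> int \<Rightarrow> 'bb"
    and TB :: "'b \<Rightarrow> 'b"
    and \<epsilon>B :: "'b \<Rightarrow> 'k"
    and act :: "'h \<Rightarrow> 'b \<Rightarrow> 'b"
    and sA :: "'k \<Rightarrow> 'a::ab_group_add \<Rightarrow> 'a"
    and sAA :: "'k \<Rightarrow> 'aa::ab_group_add \<Rightarrow> 'aa"
    and sAAA :: "'k \<Rightarrow> 'aaa::ab_group_add \<Rightarrow> 'aaa"
    and tA :: "'b \<Rightarrow> 'h \<Rightarrow> 'a"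
    and tAA :: "'a \<Rightarrow> 'a \<Rightarrow> 'aa"
    and tAAA :: "'aa \<Rightarrow> 'a \<Rightarrow> 'aaa"
  assumes "spectral_bialgebra sH sHH sHHH tHH tHHH \<Delta>H \<epsilon>H TH R"
    and "braided_vertex_bialgebra sH sHH sHHH tHH tHHH \<Delta>H \<epsilon>H TH R
           sB sBB sBBB tBB tBBB \<Delta>B TB \<epsilon>B act"
    and "tensor_product sB sH sA tA"
    and "tensor_powers sA sAA sAAA tAA tAAA"
  shows "associative_algebra sA (smash_mult tHH \<Delta>H act tA) \<and>
    (\<forall>e. unit_of (*) e \<and> (\<forall>h. act h e = sB (\<epsilon>H h) e) \<longrightarrow>
       unit_of (smash_mult tHH \<Delta>H act tA) (tA e 1)) \<and>
    vertex_bialgebra sA sAA sAAA tAA tAAA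
      (smash_mult tHH \<Delta>H act tA)
      (smash_coproduct sHH tHH \<Delta>H TH R tBB \<Delta>B act tA tAA)
      (smash_translation TB TH tA)
      (smash_covacuum \<epsilon>B \<epsilon>H tA)"
proof -
  interpret smash_product sH sHH sHHH tHH tHHH \<Delta>H \<epsilon>H TH R sB sBB sBBB tBB tBBB \<Delta>B TB \<epsilon>B act
    sA sAA sAAA tA tAA tAAA
    by (intro smash_product.intro assms)
  show ?thesis
    using smash_algebra smash_unit smash_vertex_bialgebra by blast
qed

end
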